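(* Let $k$ be a field, $R$ a $k$-algebra and $M$ a right $R$-module. Let $K = k(x)$ be the rational function field in one variable over $k$, and let $R_K = R \otimes_k K$, $M_K = M \otimes_k K$. Assume that GK dimension is exact for right $R$-modules (over $k$) and for right $R_K$-modules (over $K$), and finitely partitive for right $R_K$-modules (over $K$). If $M$ is a critical $R$-module for GK dimension over $k$, then $M_K$ is a critical $R_K$-module for GK dimension over $K$.
   Context: Algebras are unital, associative, not necessarily commutative. For a right module $M$ over a $k$-algebra $R$, $\operatorname{GKdim}_k(M) = \sup_{W,V} \limsup_{n \to \infty} \log_n(\dim_k W V^n)$, with $W$ ranging over finite-dimensional $k$-subspaces of $M$ and $V$ over finite-dimensional $k$-subspaces of $R$; $\operatorname{GKdim}_k(0) = -1$ by convention. GK dimension of right $R$-modules is exact if $\operatorname{GKdim}(N) = \max(\operatorname{GKdim}(M), \operatorname{GKdim}(P))$ for every short exact sequence $0 \to M \to N \to P \to 0$ of right $R$-modules. It is finitely partitive if for every finitely generated right module $N$ with $\operatorname{GKdim}(N)=d$ there is an upper bound (depending on $N$) on the lengths $n$ of chains $N = N_0 \supsetneq N_1 \supsetneq \dots \supsetneq N_n$ with $\operatorname{GKdim}(N_i/N_{i+1}) = d$ for all $0 \le i \le n-1$. A nonzero right module $M$ is critical (or $d$-critical) if $\operatorname{GKdim}(M) = d < \infty$ and $\operatorname{GKdim}(M/N) < d$ for all nonzero submodules $N$ of $M$. *)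

theory Defs
  imports
    "Jordan_Normal_Form.VS_Connect"
    "HOL-Algebra.AbelCoset"
    "HOL-Computational_Algebra.Fraction_Field"
    "HOL-Library.Poly_Mapping"
    "HOL-Library.Extended_Real"
begin

hide_const (open) Modules.module Real_Vector_Spaces.subspace
hide_const (open) Real_Vector_Spaces.span Polynomial.smult Multiset.mult

section \<open>Algebras over a field and right modules\<close>

text \<open>
  The ground field is a type \<open>'k::field\<close>; \<^term>\<open>class_ring\<close> is the HOL-Algebra ring record on all of
  that type. A \<open>'k\<close>-algebra is a record of type \<open>('k,'r) module\<close>: the ring structure together with
  the scalar multiplication. (The HOL-Algebra locale \<^locale>\<open>algebra\<close> is not used because it
  requires commutativity.) The zero algebra is allowed.
\<close>

locale k_algebra = Module.module "class_ring :: 'k::field ring" R + ring R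
  for R :: "('k::field, 'r) module" (structure) +
  assumes smult_mult_left:
      "\<lbrakk>x \<in> carrier R; y \<in> carrier R\<rbrakk> \<Longrightarrow> (c \<odot> x) \<otimes> y = c \<odot> (x \<otimes> y)"
    and smult_mult_right:
      "\<lbrakk>x \<in> carrier R; y \<in> carrier R\<rbrakk> \<Longrightarrow> x \<otimes> (c \<odot> y) = c \<odot> (x \<otimes> y)"

text \<open>
  As for HOL-Algebra modules, the fields \<open>mult\<close> and \<open>one\<close> inherited from \<open>ring\<close> are irrelevant.
\<close>

record ('r, 'm) rmod = "'m ring" +
  act :: "'m \<Rightarrow> 'r \<Rightarrow> 'm" (infixl \<open>\<cdot>\<index>\<close> 70)

locale right_module = k_algebra R + Mod?: abelian_group M
  for R :: "('k::field, 'r) module" and M :: "('r, 'm) rmod" (structure) +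
  assumes act_closed: "\<lbrakk>m \<in> carrier M; r \<in> carrier R\<rbrakk> \<Longrightarrow> m \<cdot> r \<in> carrier M"
    and act_add_left: "\<lbrakk>m \<in> carrier M; m' \<in> carrier M; r \<in> carrier R\<rbrakk>
      \<Longrightarrow> (m \<oplus> m') \<cdot> r = m \<cdot> r \<oplus> m' \<cdot> r"
    and act_add_right: "\<lbrakk>m \<in> carrier M; r \<in> carrier R; s \<in> carrier R\<rbrakk>
      \<Longrightarrow> m \<cdot> (r \<oplus>\<^bsub>R\<^esub> s) = m \<cdot> r \<oplus> m \<cdot> s"
    and act_mult: "\<lbrakk>m \<in> carrier M; r \<in> carrier R; s \<in> carrier R\<rbrakk>
      \<Longrightarrow> m \<cdot> (r \<otimes>\<^bsub>R\<^esub> s) = (m \<cdot> r) \<cdot> s"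
    and act_one: "m \<in> carrier M \<Longrightarrow> m \<cdot> \<one>\<^bsub>R\<^esub> = m"

definition is_submodule :: "('k::field, 'r) module \<Rightarrow> 'm set \<Rightarrow> ('r, 'm) rmod \<Rightarrow> bool" where
  "is_submodule R N M \<longleftrightarrow> additive_subgroup N M \<and>
     (\<forall>n\<in>N. \<forall>r\<in>carrier R. n \<cdot>\<^bsub>M\<^esub> r \<in> N)"

text \<open>For \<open>N' \<subseteq> N\<close> inside \<open>M\<close>, the quotient \<open>N/N'\<close> is \<open>quot (M\<lparr>carrier := N\<rparr>) N'\<close>.\<close>

definition quot :: "('r, 'm) rmod \<Rightarrow> 'm set \<Rightarrow> ('r, 'm set) rmod" where
  "quot M N = \<lparr>carrier = a_rcosets\<^bsub>M\<^esub> N, mult = undefined, one = undefined,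
     zero = N, add = set_add M,
     act = (\<lambda>X r. \<Union>x\<in>X. N +>\<^bsub>M\<^esub> (x \<cdot>\<^bsub>M\<^esub> r))\<rparr>"

definition finitely_generated :: "('k::field, 'r) module \<Rightarrow> ('r, 'm) rmod \<Rightarrow> bool" where
  "finitely_generated R M \<longleftrightarrow> (\<exists>S. finite S \<and> S \<subseteq> carrier M \<and>
     (\<forall>N. is_submodule R N M \<and> S \<subseteq> N \<longrightarrow> N = carrier M))"

definition rmod_hom ::
    "('k::field, 'r) module \<Rightarrow> ('r, 'm) rmod \<Rightarrow> ('r, 'n) rmod \<Rightarrow> ('m \<Rightarrow> 'n) set" where
  "rmod_hom R M N = {f \<in> carrier M \<rightarrow> carrier N.
     (\<forall>x\<in>carrier M. \<forall>y\<in>carrier M. f (x \<oplus>\<^bsub>M\<^esub> y) = f x \<oplus>\<^bsub>N\<^esub> f y) \<and>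
     (\<forall>x\<in>carrier M. \<forall>r\<in>carrier R. f (x \<cdot>\<^bsub>M\<^esub> r) = f x \<cdot>\<^bsub>N\<^esub> r)}"

definition short_exact :: "('k::field, 'r) module \<Rightarrow> ('r, 'm) rmod \<Rightarrow> ('r, 'n) rmod \<Rightarrow>
    ('r, 'p) rmod \<Rightarrow> ('m \<Rightarrow> 'n) \<Rightarrow> ('n \<Rightarrow> 'p) \<Rightarrow> bool" where
  "short_exact R M N P f g \<longleftrightarrow>
     right_module R M \<and> right_module R N \<and> right_module R P \<and>
     f \<in> rmod_hom R M N \<and> g \<in> rmod_hom R N P \<and>
     inj_on f (carrier M) \<and> g ` carrier N = carrier P \<and>
     f ` carrier M = {x \<in> carrier N. g x = \<zero>\<^bsub>P\<^esub>}"


section \<open>Gelfand--Kirillov dimension\<close>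

text \<open>The underlying vector space of a right module: \<open>c\<close> acts as \<open>c \<cdot> 1\<close>, an element of \<open>R\<close>.\<close>

definition kspace :: "('k::field, 'r) module \<Rightarrow> ('r, 'm) rmod \<Rightarrow> ('k, 'm) module" where
  "kspace R M = \<lparr>carrier = carrier M, mult = mult M, one = one M, zero = zero M, add = add M,
     smult = (\<lambda>c m. m \<cdot>\<^bsub>M\<^esub> (c \<odot>\<^bsub>R\<^esub> \<one>\<^bsub>R\<^esub>))\<rparr>"

definition fd_subspaces :: "('k::field, 'a) module \<Rightarrow> 'a set set" where
  "fd_subspaces V = {W. subspace class_ring W V \<and>
     vectorspace.fin_dim class_ring (V\<lparr>carrier := W\<rparr>)}"

definition regular :: "('k::field, 'r) module \<Rightarrow> ('r, 'r) rmod" where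
  "regular R = \<lparr>carrier = carrier R, mult = mult R, one = one R, zero = zero R, add = add R,
     act = mult R\<rparr>"

definition space_prod ::
    "('k::field, 'r) module \<Rightarrow> ('r, 'm) rmod \<Rightarrow> 'm set \<Rightarrow> 'r set \<Rightarrow> 'm set" where
  "space_prod R M W V = LinearCombinations.module.span class_ring (kspace R M) {w \<cdot>\<^bsub>M\<^esub> v |w v. w \<in> W \<and> v \<in> V}"

fun space_power :: "('k::field, 'r) module \<Rightarrow> 'r set \<Rightarrow> nat \<Rightarrow> 'r set" where
  "space_power R V 0 = LinearCombinations.module.span class_ring R {\<one>\<^bsub>R\<^esub>}"
| "space_power R V (Suc n) = space_prod R (regular R) (space_power R V n) V"

definition growth ::
    "('k::field, 'r) module \<Rightarrow> ('r, 'm) rmod \<Rightarrow> 'm set \<Rightarrow> 'r set \<Rightarrow> nat \<Rightarrow> nat" where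
  "growth R M W V n = vectorspace.dim class_ring
     ((kspace R M)\<lparr>carrier := space_prod R M W (space_power R V n)\<rparr>)"

text \<open>
  In HOL \<^term>\<open>log b 0 = 0\<close>, instead of \<open>-\<infinity>\<close>. This does not affect the supremum: for
  \<open>M \<noteq> 0\<close> it is at least \<open>0\<close> in either convention, by taking \<open>W \<noteq> 0\<close> and \<open>1 \<in> V\<close>.
\<close>

definition gkdim :: "('k::field, 'r) module \<Rightarrow> ('r, 'm) rmod \<Rightarrow> ereal" where
  "gkdim R M = (if carrier M = {\<zero>\<^bsub>M\<^esub>} then -1
     else (SUP W \<in> fd_subspaces (kspace R M). SUP V \<in> fd_subspaces R.
       limsup (\<lambda>n. ereal (log (real n) (real (growth R M W V n))))))"

text \<open>
  A HOL formula can only quantify over modules whose carriers lie in a fixed type. The type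
  \<open>'r list\<close> suffices for all right modules over an algebra on \<open>'r\<close>. Every finitely generated right
  module \<open>N\<close> (a quotient of some \<open>R\<^sup>n\<close>), and every subquotient of it, is isomorphic to one carried
  by a subset of \<open>'r list\<close>: represent an element by a list of coefficients with respect to a finite
  list of generators. For exactness, \<open>GKdim N \<ge> max (GKdim M) (GKdim P)\<close> always holds, and
  \<open>GKdim N\<close> is the supremum of \<open>GKdim N'\<close> over the finitely generated submodules \<open>N'\<close> of \<open>N\<close>; so if
  some sequence \<open>0 \<rightarrow> M \<rightarrow> N \<rightarrow> P \<rightarrow> 0\<close> over \<open>R\<close>, of whatever size, violates exactness, then so does
  \<open>0 \<rightarrow> N' \<inter> M \<rightarrow> N' \<rightarrow> N'/(N' \<inter> M) \<rightarrow> 0\<close> for some finitely generated \<open>N'\<close>.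
\<close>

definition gk_exact :: "('k::field, 'r) module \<Rightarrow> bool" where
  "gk_exact R \<longleftrightarrow>
     (\<forall>(M :: ('r, 'r list) rmod) (N :: ('r, 'r list) rmod) (P :: ('r, 'r list) rmod) f g.
        short_exact R M N P f g \<longrightarrow> gkdim R N = max (gkdim R M) (gkdim R P))"

definition gk_chain ::
    "('k::field, 'r) module \<Rightarrow> ('r, 'm) rmod \<Rightarrow> nat \<Rightarrow> (nat \<Rightarrow> 'm set) \<Rightarrow> bool" where
  "gk_chain R N n C \<longleftrightarrow> C 0 = carrier N \<and> (\<forall>i\<le>n. is_submodule R (C i) N) \<and>
     (\<forall>i<n. C (Suc i) \<subset> C i \<and>
        gkdim R (quot (N\<lparr>carrier := C i\<rparr>) (C (Suc i))) = gkdim R N)"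

definition gk_finitely_partitive :: "('k::field, 'r) module \<Rightarrow> bool" where
  "gk_finitely_partitive R \<longleftrightarrow>
     (\<forall>N :: ('r, 'r list) rmod. right_module R N \<and> finitely_generated R N \<longrightarrow>
        (\<exists>B. \<forall>n C. gk_chain R N n C \<longrightarrow> n \<le> B))"

definition gk_critical :: "('k::field, 'r) module \<Rightarrow> ('r, 'm) rmod \<Rightarrow> bool" where
  "gk_critical R M \<longleftrightarrow> right_module R M \<and> carrier M \<noteq> {\<zero>\<^bsub>M\<^esub>} \<and> gkdim R M < \<infinity> \<and>
     (\<forall>N. is_submodule R N M \<and> N \<noteq> {\<zero>\<^bsub>M\<^esub>} \<longrightarrow> gkdim R (quot M N) < gkdim R M)"


section \<open>Tensor products and extension of scalars to the rational function field\<close>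

text \<open>
  \<open>A \<otimes>\<^sub>k B\<close> is the free vector space on \<open>carrier A \<times> carrier B\<close>, i.e. the finitely supported
  functions \<open>u :: 'a \<times> 'b \<Rightarrow>\<^sub>0 'k\<close> with \<open>keys u \<subseteq> carrier A \<times> carrier B\<close>, modulo the subspace
  \<open>tensor_null A B\<close> of bilinearity relations. That set is closed under scalars because each
  generator carries an arbitrary coefficient.
\<close>

inductive_set tensor_null ::
    "('k::field, 'a) module \<Rightarrow> ('k, 'b) module \<Rightarrow> ('a \<times> 'b \<Rightarrow>\<^sub>0 'k) set"
  for A :: "('k, 'a) module" and B :: "('k, 'b) module" where
  zero: "0 \<in> tensor_null A B"
| add: "\<lbrakk>u \<in> tensor_null A B; v \<in> tensor_null A B\<rbrakk> \<Longrightarrow> u + v \<in> tensor_null A B"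
| add_left: "\<lbrakk>x \<in> carrier A; x' \<in> carrier A; y \<in> carrier B\<rbrakk> \<Longrightarrow>
    Poly_Mapping.single (x \<oplus>\<^bsub>A\<^esub> x', y) c - Poly_Mapping.single (x, y) c
      - Poly_Mapping.single (x', y) c \<in> tensor_null A B"
| add_right: "\<lbrakk>x \<in> carrier A; y \<in> carrier B; y' \<in> carrier B\<rbrakk> \<Longrightarrow>
    Poly_Mapping.single (x, y \<oplus>\<^bsub>B\<^esub> y') c - Poly_Mapping.single (x, y) c
      - Poly_Mapping.single (x, y') c \<in> tensor_null A B"
| smult_left: "\<lbrakk>x \<in> carrier A; y \<in> carrier B\<rbrakk> \<Longrightarrow>
    Poly_Mapping.single (a \<odot>\<^bsub>A\<^esub> x, y) c - Poly_Mapping.single (x, y) (c * a) \<in> tensor_null A B"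
| smult_right: "\<lbrakk>x \<in> carrier A; y \<in> carrier B\<rbrakk> \<Longrightarrow>
    Poly_Mapping.single (x, a \<odot>\<^bsub>B\<^esub> y) c - Poly_Mapping.single (x, y) (c * a) \<in> tensor_null A B"

definition tensor_class :: "('k::field, 'a) module \<Rightarrow> ('k, 'b) module \<Rightarrow>
    ('a \<times> 'b \<Rightarrow>\<^sub>0 'k) \<Rightarrow> ('a \<times> 'b \<Rightarrow>\<^sub>0 'k) set" where
  "tensor_class A B u = {v. v - u \<in> tensor_null A B}"

definition tensor_carrier :: "('k::field, 'a) module \<Rightarrow> ('k, 'b) module \<Rightarrow>
    ('a \<times> 'b \<Rightarrow>\<^sub>0 'k) set set" where
  "tensor_carrier A B =
     tensor_class A B ` {u. Poly_Mapping.keys u \<subseteq> carrier A \<times> carrier B}"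

definition tensor_add :: "('k::field, 'a) module \<Rightarrow> ('k, 'b) module \<Rightarrow>
    ('a \<times> 'b \<Rightarrow>\<^sub>0 'k) set \<Rightarrow> ('a \<times> 'b \<Rightarrow>\<^sub>0 'k) set \<Rightarrow> ('a \<times> 'b \<Rightarrow>\<^sub>0 'k) set" where
  "tensor_add A B X Y = (\<Union>u\<in>X. \<Union>v\<in>Y. tensor_class A B (u + v))"

text \<open>Linear and bilinear extension of maps given on basis elements of free vector spaces.\<close>

definition lin_ext :: "('p \<Rightarrow> 'q) \<Rightarrow> ('p \<Rightarrow>\<^sub>0 'k::field) \<Rightarrow> ('q \<Rightarrow>\<^sub>0 'k)" where
  "lin_ext f u = (\<Sum>p\<in>Poly_Mapping.keys u. Poly_Mapping.single (f p) (Poly_Mapping.lookup u p))"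

definition bilin_ext ::
    "('p \<Rightarrow> 'q \<Rightarrow> 's) \<Rightarrow> ('p \<Rightarrow>\<^sub>0 'k::field) \<Rightarrow> ('q \<Rightarrow>\<^sub>0 'k) \<Rightarrow> ('s \<Rightarrow>\<^sub>0 'k)" where
  "bilin_ext f u v = (\<Sum>p\<in>Poly_Mapping.keys u. \<Sum>q\<in>Poly_Mapping.keys v.
     Poly_Mapping.single (f p q) (Poly_Mapping.lookup u p * Poly_Mapping.lookup v q))"

text \<open>The rational function field \<open>k(x)\<close> is the type \<open>'k poly fract\<close>.\<close>

type_synonym 'k ratfun = "'k poly fract"

definition ratfun :: "('k::field, 'k ratfun) module" where
  "ratfun = \<lparr>carrier = UNIV, mult = (*), one = 1, zero = 0, add = (+),
     smult = (\<lambda>c f. Fract [:c:] 1 * f)\<rparr>"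

text \<open>
  \<open>R \<otimes>\<^sub>k k(x)\<close> as a \<open>k(x)\<close>-algebra: \<open>(r \<otimes> f)(s \<otimes> g) = rs \<otimes> fg\<close> and \<open>c (r \<otimes> f) = r \<otimes> cf\<close>.
\<close>

definition ratfun_algebra :: "('k::field, 'r) module \<Rightarrow>
    ('k ratfun, ('r \<times> 'k ratfun \<Rightarrow>\<^sub>0 'k) set) module" where
  "ratfun_algebra R =
     \<lparr>carrier = tensor_carrier R ratfun,
      mult = (\<lambda>X Y. \<Union>u\<in>X. \<Union>v\<in>Y. tensor_class R ratfun
        (bilin_ext (\<lambda>(r, f) (s, g). (r \<otimes>\<^bsub>R\<^esub> s, f * g)) u v)),
      one = tensor_class R ratfun (Poly_Mapping.single (\<one>\<^bsub>R\<^esub>, 1) 1),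
      zero = tensor_class R ratfun 0,
      add = tensor_add R ratfun,
      smult = (\<lambda>c X. \<Union>u\<in>X. tensor_class R ratfun (lin_ext (\<lambda>(r, f). (r, c * f)) u))\<rparr>"

text \<open>
  \<open>M \<otimes>\<^sub>k k(x)\<close> as a right module over \<open>R \<otimes>\<^sub>k k(x)\<close>: \<open>(m \<otimes> f) \<cdot> (r \<otimes> g) = mr \<otimes> fg\<close>.
\<close>

definition ratfun_module :: "('k::field, 'r) module \<Rightarrow> ('r, 'm) rmod \<Rightarrow>
    (('r \<times> 'k ratfun \<Rightarrow>\<^sub>0 'k) set, ('m \<times> 'k ratfun \<Rightarrow>\<^sub>0 'k) set) rmod" where
  "ratfun_module R M =
     \<lparr>carrier = tensor_carrier (kspace R M) ratfun,
      mult = undefined, one = undefined,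
      zero = tensor_class (kspace R M) ratfun 0,
      add = tensor_add (kspace R M) ratfun,
      act = (\<lambda>X Y. \<Union>u\<in>X. \<Union>v\<in>Y. tensor_class (kspace R M) ratfun
        (bilin_ext (\<lambda>(m, f) (r, g). (m \<cdot>\<^bsub>M\<^esub> r, f * g)) u v))\<rparr>"

end

theory Submission
  imports Defs
begin

text \<open>
  Suppose that \<open>N\<close> is a nonzero submodule of \<open>M\<^sub>K\<close> with \<open>GKdim(M\<^sub>K/N) = d\<close>, where
  \<open>d = GKdim(M) = GKdim(M\<^sub>K)\<close>. Clearing denominators, \<open>N\<close> contains some \<open>w(x) = \<Sum>\<^sub>j\<^sub>\<le>\<^sub>n u\<^sub>j x\<^sup>j\<close> with
  \<open>u\<^sub>j \<in> M\<close> and \<open>u\<^sub>n \<noteq> 0\<close>; by exactness \<open>M\<close> may be replaced by the submodule generated by the \<open>u\<^sub>j\<close>.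
  In \<open>P = M\<^sub>K[X]\<close>, where \<open>X\<close> is a second variable, let \<open>E\<close> be the \<open>K\<close>-span of
  \<open>{p \<in> M[X]. p(x) \<in> N}\<close>. Evaluation \<open>X \<mapsto> x\<close> maps \<open>P/((X - x)P + E)\<close> onto \<open>M\<^sub>K/N\<close>, and \<open>X - x\<close> acts
  injectively on \<open>P/E\<close>, so every factor of the chain \<open>C\<^sub>i = (X - x)\<^sup>i P + E\<close> has dimension at least \<open>d\<close>.
  Let \<open>Q \<cong> M\<^sub>K\<^sup>n\<close> be the module of polynomials of degree less than \<open>n\<close>. Since \<open>w(X) \<in> E\<close> has leading
  coefficient \<open>u\<^sub>n\<close>, the module \<open>P/(Q + E)\<close> is an iterated extension of quotients of \<open>(M/u\<^sub>nR)\<^sub>K\<close>, hence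
  has dimension less than \<open>d\<close> because \<open>M\<close> is critical. Therefore the infinite chain \<open>C\<^sub>i \<inter> Q\<close> in the
  finitely generated module \<open>Q\<close> also has factors of dimension \<open>d\<close>, contradicting finite partitivity.
\<close>

section \<open>Rank modulo a subspace and relative GK dimension\<close>

text \<open>Criticality of \<open>M\<close> constrains only quotients of \<open>M\<close> by
  \<open>R\<close>-submodules, whereas \<open>N\<close> need not be extended from \<open>M\<close>.
  The second variable bridges this gap: \<open>E\<close> is spanned by polynomials with coefficients
  in \<open>M\<close>, so the leading coefficient of \<open>w(X)\<close> lies in \<open>M\<close>
  itself and criticality applies to the submodule that it generates. This also makes
  \<open>X - x\<close> injective modulo \<open>E\<close>: as \<open>E\<close> comes from a
  \<open>k\<close>-subspace of \<open>M[X]\<close> stable under \<open>X\<close>, membership can be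
  tested one power of \<open>x\<close> at a time. Partitivity does not apply to the chain
  \<open>C_i\<close> itself, since \<open>P\<close> is not finitely generated; passing to
  \<open>C_i \<inter> Q\<close> loses only a subquotient of \<open>P/(Q + E)\<close>, too small to
  carry dimension \<open>d\<close>. The passage between \<open>k\<close> and \<open>K\<close> rests
  on the \<open>k\<close>-linear functionals \<open>K \<rightarrow> k\<close>, which, applied to
  coefficients, turn relations over \<open>K\<close> into relations over \<open>k\<close>. This
  yields \<open>GKdim(M_K) \<ge> GKdim(M)\<close>; the converse holds because finitely many elements
  of \<open>M_K\<close> and \<open>R_K\<close> involve only finitely many elements of
  \<open>M\<close> and \<open>R\<close>.\<close>

lemma homogeneous_system_solution:
  fixes a :: "'i \<Rightarrow> 'j \<Rightarrow> 'a::field"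
  assumes "finite J" "finite I" "card J < card I"
  shows "\<exists>c. (\<exists>i\<in>I. c i \<noteq> 0) \<and> (\<forall>j\<in>J. (\<Sum>i\<in>I. c i * a i j) = 0)"
  using assms
proof (induction J arbitrary: I a rule: finite_induct)
  case empty
  then have "I \<noteq> {}" by auto
  then show ?case by (intro exI[of _ "\<lambda>_. 1"]) auto
next
  case (insert j J)
  show ?case
  proof (cases "\<forall>i\<in>I. a i j = 0")
    case True
    have "card J < card I" using insert by simp
    from insert.IH[OF insert.prems(1) this, of a] True show ?thesis by auto
  next
    case False
    then obtain i0 where i0: "i0 \<in> I" "a i0 j \<noteq> 0" by auto
    let ?I = "I - {i0}"
    \<comment> \<open>Gaussian elimination: equation \<open>j\<close> is solved for the unknown at
      \<open>i0\<close>, and \<open>?a\<close> is the matrix that remains for the other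
      equations.\<close>
    let ?a = "\<lambda>i l. a i l - a i j / a i0 j * a i0 l"
    have "card J < card ?I" using insert i0 by simp
    from insert.IH[OF _ this, of ?a] insert.prems(1) obtain c where
      c: "\<exists>i\<in>?I. c i \<noteq> 0" "\<forall>l\<in>J. (\<Sum>i\<in>?I. c i * ?a i l) = 0" by auto
    let ?s = "- (\<Sum>i\<in>?I. c i * (a i j / a i0 j))"
    let ?c = "c(i0 := ?s)"
    have split: "(\<Sum>i\<in>I. ?c i * a i l) = ?s * a i0 l + (\<Sum>i\<in>?I. c i * a i l)" for l
      using insert.prems(1) i0(1) by (subst sum.remove[of I i0]) auto
    have "(\<Sum>i\<in>I. ?c i * a i l) = 0" if "l \<in> insert j J" for l
    proof (cases "l = j")
      case True
      show ?thesis unfolding split True using i0(2)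
        by (simp add: sum_distrib_right)
    next
      case False
      then have "(\<Sum>i\<in>?I. c i * ?a i l) = 0" using c(2) that by auto
      moreover have "(\<Sum>i\<in>?I. c i * ?a i l)
          = (\<Sum>i\<in>?I. c i * a i l) - (\<Sum>i\<in>?I. c i * (a i j / a i0 j)) * a i0 l"
        by (simp add: right_diff_distrib sum_subtractf sum_distrib_right mult.assoc)
      ultimately show ?thesis unfolding split by simp
    qed
    moreover have "\<exists>i\<in>I. ?c i \<noteq> 0" using c(1) by auto
    ultimately show ?thesis by blast
  qed
qed

locale scalar_space = vector_space scale
  for scale :: "'a::field \<Rightarrow> 'b::ab_group_add \<Rightarrow> 'b" (infixr \<open>*s\<close> 75)
begin

definition indep_mod :: "'b set \<Rightarrow> 'b set \<Rightarrow> bool" where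
  "indep_mod B I \<longleftrightarrow> finite I \<and> (\<forall>c. (\<Sum>i\<in>I. c i *s i) \<in> B \<longrightarrow> (\<forall>i\<in>I. c i = 0))"

text \<open>This is the dimension of \<open>(span H + B)/B\<close>, obtained without forming a
  quotient space. The maximum is taken over a finite family when \<open>H\<close> is finite, the
  only case in use.\<close>

definition rank_mod :: "'b set \<Rightarrow> 'b set \<Rightarrow> nat" where
  "rank_mod B H = Max (card ` {I. I \<subseteq> H \<and> indep_mod B I})"

definition span_mod :: "'b set \<Rightarrow> 'b set \<Rightarrow> 'b set" where
  "span_mod B I = {x. \<exists>y\<in>span I. x - y \<in> B}"

lemma subspace_span_mod: "subspace B \<Longrightarrow> subspace (span_mod B I)"
proof (rule subspaceI)
  assume B: "subspace B"
  show "0 \<in> span_mod B I" unfolding span_mod_def using B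
    by (auto intro!: bexI[of _ 0] span_zero subspace_0)
  fix x y assume "x \<in> span_mod B I" "y \<in> span_mod B I"
  then obtain x' y' where "x' \<in> span I" "x - x' \<in> B" "y' \<in> span I" "y - y' \<in> B"
    unfolding span_mod_def by auto
  then show "x + y \<in> span_mod B I" unfolding span_mod_def
    using B subspace_add[OF B, of "x - x'" "y - y'"]
    by (auto intro!: bexI[of _ "x' + y'"] span_add simp: algebra_simps)
next
  assume B: "subspace B"
  fix c x assume "x \<in> span_mod B I"
  then obtain x' where "x' \<in> span I" "x - x' \<in> B"
    unfolding span_mod_def by auto
  then show "c *s x \<in> span_mod B I" unfolding span_mod_def
    using subspace_scale[OF B, of "x - x'" c]
    by (auto intro!: bexI[of _ "c *s x'"] span_scale simp: scale_right_diff_distrib)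
qed

lemma span_mod_superset: "subspace B \<Longrightarrow> I \<subseteq> span_mod B I" 
  unfolding span_mod_def by (auto intro!: bexI[OF _ span_base] subspace_0)

lemma span_mod_base: "B \<subseteq> span_mod B I" 
  unfolding span_mod_def by (auto intro!: bexI[OF _ span_zero])

lemma span_mod_minimal:
  assumes "subspace A" "B \<subseteq> A" "I \<subseteq> A"
  shows "span_mod B I \<subseteq> A"
proof
  fix x assume "x \<in> span_mod B I"
  then obtain y where y: "y \<in> span I" "x - y \<in> B" unfolding span_mod_def by auto
  then have "y \<in> A" using span_minimal[OF assms(3,1)] by auto
  with y assms subspace_add[OF assms(1), of y "x - y"] show "x \<in> A" by auto
qed

text \<open>Steinitz exchange in the quotient by \<open>B\<close>: if \<open>I\<close> were larger
  than \<open>J\<close>, the coefficients of \<open>I\<close> with respect to \<open>J\<close> would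
  form a homogeneous system with more unknowns than equations, and a nontrivial solution is a
  relation among \<open>I\<close> modulo \<open>B\<close>.\<close>

lemma indep_mod_card_le:
  assumes B: "subspace B" and I: "indep_mod B I" and J: "finite J" and IJ: "I \<subseteq> span_mod B J"
  shows "card I \<le> card J"
proof (rule ccontr)
  assume "\<not> card I \<le> card J"
  then have less: "card J < card I" by simp
  have fI: "finite I" using I by (simp add: indep_mod_def)
  have "\<exists>a. i - (\<Sum>j\<in>J. a j *s j) \<in> B" if "i \<in> I" for i
    using IJ that unfolding span_mod_def span_finite[OF J] by auto
  then obtain a where a: "\<And>i. i \<in> I \<Longrightarrow> i - (\<Sum>j\<in>J. a i j *s j) \<in> B" by metis
  obtain c where c: "\<exists>i\<in>I. c i \<noteq> 0" "\<forall>j\<in>J. (\<Sum>i\<in>I. c i * a i j) = 0"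
    using homogeneous_system_solution[OF J fI less, of a] by auto
  have "(\<Sum>i\<in>I. c i *s (i - (\<Sum>j\<in>J. a i j *s j))) \<in> B"
    by (rule subspace_sum[OF B]) (auto intro!: subspace_scale[OF B] a)
  also have "(\<Sum>i\<in>I. c i *s (i - (\<Sum>j\<in>J. a i j *s j)))
      = (\<Sum>i\<in>I. c i *s i) - (\<Sum>i\<in>I. \<Sum>j\<in>J. (c i * a i j) *s j)"
    by (simp add: scale_right_diff_distrib sum_subtractf scale_sum_right)
  also have "(\<Sum>i\<in>I. \<Sum>j\<in>J. (c i * a i j) *s j) = (\<Sum>j\<in>J. (\<Sum>i\<in>I. c i * a i j) *s j)"
    by (subst sum.swap) (simp add: scale_sum_left)
  also have "\<dots> = 0" using c(2) by simp
  finally have "(\<Sum>i\<in>I. c i *s i) \<in> B" by simp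
  then show False using I c(1) unfolding indep_mod_def by blast
qed

text \<open>An independent subset of maximal size also spans: adjoining a further \<open>h\<close>
  creates a relation, and its coefficient at \<open>h\<close> cannot vanish, so \<open>h\<close> can
  be solved for.\<close>

lemma rank_mod_basis:
  assumes B: "subspace B" and H: "finite H"
  obtains I where "I \<subseteq> H" "indep_mod B I" "card I = rank_mod B H" "H \<subseteq> span_mod B I"
proof -
  let ?F = "{I. I \<subseteq> H \<and> indep_mod B I}"
  have fin: "finite ?F" using H by (auto intro: finite_subset[OF _ finite_Pow_iff[THEN iffD2, OF H]])
  have ne: "{} \<in> ?F" by (auto simp: indep_mod_def)
  have "rank_mod B H \<in> card ` ?F" unfolding rank_mod_def
    by (rule Max_in) (use fin ne in auto)
  then obtain I where I: "I \<subseteq> H" "indep_mod B I" "card I = rank_mod B H" by auto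
  have fI: "finite I" using I by (simp add: indep_mod_def)
  have max: "card J \<le> card I" if "J \<in> ?F" for J
    unfolding I(3) rank_mod_def using fin that by auto
  have "h \<in> span_mod B I" if h: "h \<in> H" for h
  proof (cases "h \<in> I")
    case True then show ?thesis using span_mod_superset[OF B] by auto
  next
    case False
    have "\<not> indep_mod B (insert h I)"
    proof
      assume "indep_mod B (insert h I)"
      then have "insert h I \<in> ?F" using I h by auto
      from max[OF this] False fI show False by simp
    qed
    then obtain c where c: "(\<Sum>i\<in>insert h I. c i *s i) \<in> B" "\<exists>i\<in>insert h I. c i \<noteq> 0"
      unfolding indep_mod_def using fI by auto
    then have hs: "c h *s h + (\<Sum>i\<in>I. c i *s i) \<in> B" using False fI by simp
    have "c h \<noteq> 0"
    proof
      assume "c h = 0"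
      then have "(\<Sum>i\<in>I. c i *s i) \<in> B" using hs by simp
      then have "\<forall>i\<in>I. c i = 0" using I(2) unfolding indep_mod_def by auto
      with c(2) \<open>c h = 0\<close> show False by auto
    qed
    have "inverse (c h) *s (c h *s h + (\<Sum>i\<in>I. c i *s i)) \<in> B" using subspace_scale[OF B hs] .
    then have "h - (- (inverse (c h) *s (\<Sum>i\<in>I. c i *s i))) \<in> B" using \<open>c h \<noteq> 0\<close>
      by (simp add: scale_right_distrib)
    moreover have "- (inverse (c h) *s (\<Sum>i\<in>I. c i *s i)) \<in> span I"
      by (intro span_neg span_scale span_sum span_base) auto
    ultimately show ?thesis unfolding span_mod_def by blast
  qed
  with I that show ?thesis by auto
qed

lemma rank_mod_le:
  assumes B: "subspace B" and H: "finite H" and J: "finite J" and HJ: "H \<subseteq> span_mod B J"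
  shows "rank_mod B H \<le> card J"
proof -
  obtain I where "I \<subseteq> H" "indep_mod B I" "card I = rank_mod B H"
    using rank_mod_basis[OF B H] by metis
  with indep_mod_card_le[OF B _ J] HJ show ?thesis by (metis order_trans)
qed

lemma card_le_rank_mod:
  assumes B: "subspace B" and H: "finite H" and I: "indep_mod B I" and IH: "I \<subseteq> span_mod B H"
  shows "card I \<le> rank_mod B H"
proof -
  obtain J where J: "J \<subseteq> H" "card J = rank_mod B H" "H \<subseteq> span_mod B J"
    using rank_mod_basis[OF B H] by metis
  have "span_mod B H \<subseteq> span_mod B J"
    by (rule span_mod_minimal[OF subspace_span_mod[OF B] span_mod_base J(3)])
  then show ?thesis using indep_mod_card_le[OF B I finite_subset[OF J(1) H]] IH J(2) by auto
qed

end

text \<open>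
  A right module is presented as a quotient \<open>T/Z\<close> of subspaces of a vector space on a whole type, so
  that linear algebra takes place in a type class. Accordingly the module laws that involve two
  elements of the algebra are required only modulo \<open>Z\<close>.
\<close>

locale gk_space = Alg: k_algebra S + vs: scalar_space scale
  for S :: "('k::field, 's) module" and scale :: "'k \<Rightarrow> 'v::ab_group_add \<Rightarrow> 'v" +
  fixes opr :: "'v \<Rightarrow> 's \<Rightarrow> 'v" and T Z :: "'v set"
  assumes T_sub: "vs.subspace T" and Z_sub: "vs.subspace Z" and Z_T: "Z \<subseteq> T"
    and opr_T: "\<lbrakk>v \<in> T; s \<in> carrier S\<rbrakk> \<Longrightarrow> opr v s \<in> T"
    and opr_Z: "\<lbrakk>v \<in> Z; s \<in> carrier S\<rbrakk> \<Longrightarrow> opr v s \<in> Z"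
    and opr_add: "s \<in> carrier S \<Longrightarrow> opr (v + w) s = opr v s + opr w s"
    and opr_scale: "s \<in> carrier S \<Longrightarrow> opr (scale c v) s = scale c (opr v s)"
    and opr_add_right: "\<lbrakk>v \<in> T; s \<in> carrier S; t \<in> carrier S\<rbrakk> \<Longrightarrow>
      opr v (s \<oplus>\<^bsub>S\<^esub> t) - (opr v s + opr v t) \<in> Z"
    and opr_mult: "\<lbrakk>v \<in> T; s \<in> carrier S; t \<in> carrier S\<rbrakk> \<Longrightarrow>
      opr v (s \<otimes>\<^bsub>S\<^esub> t) - opr (opr v s) t \<in> Z"
    and opr_one: "v \<in> T \<Longrightarrow> opr v \<one>\<^bsub>S\<^esub> - v \<in> Z"
    and opr_smult: "\<lbrakk>v \<in> T; s \<in> carrier S\<rbrakk> \<Longrightarrow> opr v (c \<odot>\<^bsub>S\<^esub> s) - scale c (opr v s) \<in> Z"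
begin

lemma opr_0: "s \<in> carrier S \<Longrightarrow> opr 0 s = 0"
  using opr_scale[of s 0 0] by simp

lemma opr_diff: "s \<in> carrier S \<Longrightarrow> opr (v - w) s = opr v s - opr w s"
  using opr_add[of s "v - w" w] by (simp add: algebra_simps)

lemma opr_sum: "s \<in> carrier S \<Longrightarrow> opr (\<Sum>i\<in>I. f i) s = (\<Sum>i\<in>I. opr (f i) s)"
  by (induction I rule: infinite_finite_induct) (auto simp: opr_0 opr_add)

definition submod :: "'v set \<Rightarrow> bool" where
  "submod A \<longleftrightarrow> Z \<subseteq> A \<and> A \<subseteq> T \<and> vs.subspace A \<and> (\<forall>a\<in>A. \<forall>s\<in>carrier S. opr a s \<in> A)"

lemma submodD:
  assumes "submod A"
  shows "Z \<subseteq> A" "A \<subseteq> T" "vs.subspace A" "\<And>a s. \<lbrakk>a \<in> A; s \<in> carrier S\<rbrakk> \<Longrightarrow> opr a s \<in> A"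
  using assms unfolding submod_def by auto

lemma submod_T: "submod T" and submod_Z: "submod Z"
  using T_sub Z_sub Z_T opr_T opr_Z unfolding submod_def by auto

lemma submod_inter: "\<lbrakk>submod A; submod B\<rbrakk> \<Longrightarrow> submod (A \<inter> B)"
  unfolding submod_def by (auto intro: vs.subspace_inter)

definition plus_set :: "'v set \<Rightarrow> 'v set \<Rightarrow> 'v set" where
  "plus_set A B = {a + b |a b. a \<in> A \<and> b \<in> B}"

lemma submod_plus: 
  assumes A: "submod A" and B: "submod B"
  shows "submod (plus_set A B)"
  unfolding submod_def plus_set_def
proof (intro conjI)
  show "Z \<subseteq> {a + b |a b. a \<in> A \<and> b \<in> B}"
    using submodD(1)[OF A] vs.subspace_0[OF submodD(3)[OF B]] by force
  show "{a + b |a b. a \<in> A \<and> b \<in> B} \<subseteq> T"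
    using submodD(2)[OF A] submodD(2)[OF B] by (auto intro!: vs.subspace_add[OF T_sub])
  show "vs.subspace {a + b |a b. a \<in> A \<and> b \<in> B}"
    by (rule vs.subspace_sums[OF submodD(3)[OF A] submodD(3)[OF B]])
  show "\<forall>a\<in>{a + b |a b. a \<in> A \<and> b \<in> B}. \<forall>s\<in>carrier S. opr a s \<in> {a + b |a b. a \<in> A \<and> b \<in> B}"
    using submodD(4)[OF A] submodD(4)[OF B] by (auto simp: opr_add) blast
qed

lemma plus_set_left: "submod B \<Longrightarrow> A \<subseteq> plus_set A B"
  unfolding plus_set_def using vs.subspace_0[OF submodD(3)] by force

lemma plus_set_right: "submod A \<Longrightarrow> B \<subseteq> plus_set A B"
  unfolding plus_set_def using vs.subspace_0[OF submodD(3)] by force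

lemma plus_set_minimal: "\<lbrakk>submod C; A \<subseteq> C; B \<subseteq> C\<rbrakk> \<Longrightarrow> plus_set A B \<subseteq> C"
  unfolding plus_set_def using vs.subspace_add[OF submodD(3)] by blast

text \<open>These products span \<open>W V^n\<close>. Acting by one factor at a time avoids products
  inside the algebra, which agree with iterated action only modulo \<open>Z\<close>.\<close>

fun gens :: "'v set \<Rightarrow> 's set \<Rightarrow> nat \<Rightarrow> 'v set" where
  "gens W V 0 = W"
| "gens W V (Suc n) = {opr g s |g s. g \<in> gens W V n \<and> s \<in> V}"

lemma finite_gens: "\<lbrakk>finite W; finite V\<rbrakk> \<Longrightarrow> finite (gens W V n)"
  by (induction n) (auto intro: finite_image_set2)

lemma gens_subset: "\<lbrakk>submod A; W \<subseteq> A; V \<subseteq> carrier S\<rbrakk> \<Longrightarrow> gens W V n \<subseteq> A"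
  by (induction n) (auto intro!: submodD(4) | blast)+

text \<open>\<open>gkr A B\<close> is the GK dimension of \<open>A/B\<close>, computed from finite generating sets.\<close>

definition gkr1 :: "'v set \<Rightarrow> 'v set \<Rightarrow> 's set \<Rightarrow> ereal" where
  "gkr1 B W V = limsup (\<lambda>n. ereal (log (real n) (real (vs.rank_mod B (gens W V n)))))"

definition gkr :: "'v set \<Rightarrow> 'v set \<Rightarrow> ereal" where
  "gkr A B = (if A \<subseteq> B then -1 else
     (SUP W \<in> {W. finite W \<and> W \<subseteq> A}. SUP V \<in> {V. finite V \<and> V \<subseteq> carrier S}. gkr1 B W V))"

end

text \<open>No side condition is needed thanks to default values: logarithms to the bases
  \<open>0\<close> and \<open>1\<close> vanish, and so does the logarithm of \<open>0\<close>, which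
  stays below the logarithms of positive integers.\<close>

lemma log_nat_mono:
  fixes a b n :: nat
  assumes "a \<le> b"
  shows "log (real n) (real a) \<le> log (real n) (real b)"
proof (cases "n \<le> 1")
  case True
  then have "n = 0 \<or> n = 1" by auto
  then show ?thesis by (auto simp: log_def)
next
  case n: False
  show ?thesis
  proof (cases "a = 0")
    case True
    then show ?thesis using n by (cases "b = 0") (auto simp: log_def divide_nonneg_pos)
  next
    case False then show ?thesis using assms n by (auto simp: log_def divide_simps)
  qed
qed

lemma log_nat_nonneg: "0 \<le> log (real n) (real (a::nat))"
  using log_nat_mono[of 0 a n] by (simp add: log_def)

context gk_space
begin

lemma gkr1_nonneg: "0 \<le> gkr1 B W V"
proof -
  have "(0::ereal) = limsup (\<lambda>n::nat. 0)" by (simp add: Limsup_const)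
  also have "\<dots> \<le> gkr1 B W V" unfolding gkr1_def
    by (rule Limsup_mono) (auto simp: log_nat_nonneg)
  finally show ?thesis .
qed

lemma gkr1_le_gkr:
  assumes "\<not> A \<subseteq> B" "finite W" "W \<subseteq> A" "finite V" "V \<subseteq> carrier S"
  shows "gkr1 B W V \<le> gkr A B"
  unfolding gkr_def using assms by (auto intro!: SUP_upper2[of W] SUP_upper)

lemma gkr_leI:
  assumes "\<not> A \<subseteq> B" "\<And>W V. \<lbrakk>finite W; W \<subseteq> A; finite V; V \<subseteq> carrier S\<rbrakk> \<Longrightarrow> gkr1 B W V \<le> e"
  shows "gkr A B \<le> e"
  unfolding gkr_def using assms by (auto intro!: SUP_least)

lemma gkr_ge: "-1 \<le> gkr A B"
proof (cases "A \<subseteq> B")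
  case False
  have "(-1::ereal) \<le> 0" by simp
  \<comment> \<open>With the convention \<open>log b 0 = 0\<close> every \<open>gkr1\<close> is
    nonnegative, so empty generating sets already serve as witnesses.\<close>
  also have "0 \<le> gkr1 B {} {}" by (rule gkr1_nonneg)
  also have "\<dots> \<le> gkr A B" using False by (intro gkr1_le_gkr) auto
  finally show ?thesis .
qed (auto simp: gkr_def)

lemma gkr_nonneg: "\<not> A \<subseteq> B \<Longrightarrow> 0 \<le> gkr A B"
  using gkr1_le_gkr[of A B "{}" "{}"] gkr1_nonneg[of B "{}" "{}"] by auto

lemma gkr_eq: "A \<subseteq> B \<Longrightarrow> gkr A B = -1"
  by (simp add: gkr_def)

end

text \<open>The two spaces are named separately, with their own algebras and ground fields, because
  a space over \<open>k\<close> has to be compared with one over \<open>K\<close>.\<close>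

lemma gkr1_mono_gen:
  assumes "gk_space S sc1 op1 T1 Z1" "gk_space S' sc2 op2 T2 Z2"
    and "\<And>n. scalar_space.rank_mod sc1 B (gk_space.gens op1 W V n)
       \<le> scalar_space.rank_mod sc2 B' (gk_space.gens op2 W' V' n)"
  shows "gk_space.gkr1 sc1 op1 B W V \<le> gk_space.gkr1 sc2 op2 B' W' V'"
  unfolding gk_space.gkr1_def[OF assms(1)] gk_space.gkr1_def[OF assms(2)]
  by (rule Limsup_mono) (intro always_eventually allI, simp only: ereal_less_eq, intro log_nat_mono assms(3))

section \<open>Comparison of GK dimensions along module homomorphisms\<close>

locale gk_pair = X: gk_space S sc1 op1 T1 Z1 + Y: gk_space S sc2 op2 T2 Z2
  for S :: "('k::field, 's) module"
    and sc1 :: "'k \<Rightarrow> 'v::ab_group_add \<Rightarrow> 'v" and op1 T1 Z1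
    and sc2 :: "'k \<Rightarrow> 'w::ab_group_add \<Rightarrow> 'w" and op2 T2 Z2
begin

text \<open>The laws are required strictly, not modulo a submodule: the identity, powers of
  \<open>X - x\<close>, evaluation at \<open>x\<close> and \<open>a \<mapsto> a X^j\<close> all
  satisfy them on the nose.\<close>

definition hom_on :: "'v set \<Rightarrow> ('v \<Rightarrow> 'w) \<Rightarrow> bool" where
  "hom_on A f \<longleftrightarrow> (\<forall>a\<in>A. \<forall>b\<in>A. f (a + b) = f a + f b) \<and> (\<forall>c. \<forall>a\<in>A. f (sc1 c a) = sc2 c (f a))
     \<and> (\<forall>a\<in>A. \<forall>s\<in>carrier S. f (op1 a s) = op2 (f a) s)"

lemma hom_on_sum:
  assumes f: "hom_on A f" and A: "X.submod A" and "finite I" "I \<subseteq> A"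
  shows "f (\<Sum>i\<in>I. sc1 (c i) i) = (\<Sum>i\<in>I. sc2 (c i) (f i))"
  using assms(3,4)
proof (induction I rule: finite_induct)
  case empty
  have "f (sc1 0 0) = sc2 0 (f 0)" using f X.vs.subspace_0[OF X.submodD(3)[OF A]]
    unfolding hom_on_def by blast
  then show ?case by simp
next
  case (insert i I)
  have "(\<Sum>i\<in>I. sc1 (c i) i) \<in> A" "sc1 (c i) i \<in> A"
    using insert.prems by (auto intro!: X.vs.subspace_sum X.vs.subspace_scale X.submodD(3)[OF A])
  then show ?case using insert f unfolding hom_on_def by auto
qed

lemma hom_on_diff:
  assumes f: "hom_on A f" and A: "X.submod A" and "a \<in> A" "b \<in> A"
  shows "f (a - b) = f a - f b"
proof -
  have "a - b \<in> A" using X.vs.subspace_diff[OF X.submodD(3)[OF A]] assms by auto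
  then have "f ((a - b) + b) = f (a - b) + f b" using f assms unfolding hom_on_def by blast
  then show ?thesis by (simp add: algebra_simps)
qed

text \<open>Products of generators go to products of their images, and a set independent modulo
  \<open>B\<close> goes to one independent modulo \<open>B'\<close>, so ranks can only grow. As
  \<open>f\<close> need not send \<open>B\<close> into \<open>B'\<close>, this covers an embedding
  followed by passage to a quotient on the source side.\<close>

lemma gkr_le_inj:
  assumes f: "hom_on A f" and A: "X.submod A" and B: "X.submod B" and A': "Y.submod A'" and B': "Y.submod B'"
    and fA: "f ` A \<subseteq> A'" and inj: "\<And>a. \<lbrakk>a \<in> A; f a \<in> B'\<rbrakk> \<Longrightarrow> a \<in> B"
  shows "X.gkr A B \<le> Y.gkr A' B'"
proof (cases "A \<subseteq> B")
  case True then show ?thesis by (simp add: X.gkr_eq Y.gkr_ge)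
next
  case False
  have ne: "\<not> A' \<subseteq> B'" using False fA inj by auto
  show ?thesis
  proof (rule X.gkr_leI[OF False])
    fix W V assume W: "finite W" "W \<subseteq> A" and V: "finite V" "V \<subseteq> carrier S"
    have gA: "X.gens W V n \<subseteq> A" for n using X.gens_subset[OF A W(2) V(2)] .
    have g: "Y.gens (f ` W) V n = f ` X.gens W V n" for n
    proof (induction n)
      case (Suc n)
      have *: "f (op1 g s) = op2 (f g) s" if "g \<in> X.gens W V n" "s \<in> V" for g s
        using that gA[of n] V(2) f unfolding hom_on_def by blast
      show ?case unfolding X.gens.simps Y.gens.simps Suc using * by (auto simp: image_iff) metis+
    qed simp
    have "X.gkr1 B W V \<le> Y.gkr1 B' (f ` W) V"
    proof (rule gkr1_mono_gen[OF X.gk_space_axioms Y.gk_space_axioms], unfold g)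
      fix n
      let ?H = "X.gens W V n"
      have fH: "finite ?H" using X.finite_gens W V by auto
      obtain I where I: "I \<subseteq> ?H" "X.vs.indep_mod B I" "card I = X.vs.rank_mod B ?H"
        using X.vs.rank_mod_basis[OF X.submodD(3)[OF B] fH] by metis
      have fI: "finite I" using I(2) by (simp add: X.vs.indep_mod_def)
      have IA: "I \<subseteq> A" using I(1) gA by auto
      have injI: "inj_on f I"
      proof (rule inj_onI, rule ccontr)
        fix i j assume ij: "i \<in> I" "j \<in> I" "f i = f j" "i \<noteq> j"
        have "f (i - j) = 0" using hom_on_diff[OF f A, of i j] ij IA by auto
        then have "f (i - j) \<in> B'" using Y.vs.subspace_0[OF Y.submodD(3)[OF B']] by simp
        then have B1: "i - j \<in> B" using inj[of "i - j"] IA ij(1,2)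
            X.vs.subspace_diff[OF X.submodD(3)[OF A]] by auto
        let ?c = "\<lambda>l. if l = i then 1 else if l = j then -1 else (0::'k)"
        have "(\<Sum>l\<in>I. sc1 (?c l) l) = (\<Sum>l\<in>{i,j}. sc1 (?c l) l)"
          by (rule sum.mono_neutral_right) (use fI ij in auto)
        also have "\<dots> = i - j" using ij(4) by simp
        finally have "(\<Sum>l\<in>I. sc1 (?c l) l) \<in> B" using B1 by simp
        then have "\<forall>l\<in>I. ?c l = 0"
          using I(2)[unfolded X.vs.indep_mod_def, THEN conjunct2, rule_format, of ?c] by simp
        then show False using ij(1) by (metis zero_neq_one)
      qed
      have "Y.vs.indep_mod B' (f ` I)" unfolding Y.vs.indep_mod_def
      proof (intro conjI allI impI)
        show "finite (f ` I)" using fI by simp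
        fix c assume "(\<Sum>i\<in>f ` I. sc2 (c i) i) \<in> B'"
        then have "(\<Sum>i\<in>I. sc2 (c (f i)) (f i)) \<in> B'" by (simp add: sum.reindex[OF injI])
        then have "f (\<Sum>i\<in>I. sc1 (c (f i)) i) \<in> B'" using hom_on_sum[OF f A fI IA] by simp
        moreover have "(\<Sum>i\<in>I. sc1 (c (f i)) i) \<in> A"
          using IA by (auto intro!: X.vs.subspace_sum X.vs.subspace_scale X.submodD(3)[OF A])
        ultimately have "(\<Sum>i\<in>I. sc1 (c (f i)) i) \<in> B" using inj by blast
        then have "\<forall>i\<in>I. c (f i) = 0"
          using I(2)[unfolded X.vs.indep_mod_def, THEN conjunct2, rule_format, of "\<lambda>i. c (f i)"] by simp
        then show "\<forall>i\<in>f ` I. c i = 0" by blast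
      qed
      from Y.vs.card_le_rank_mod[OF Y.submodD(3)[OF B'] _ this, of "f ` ?H"]
      have "card (f ` I) \<le> Y.vs.rank_mod B' (f ` ?H)"
        using fH I(1) Y.vs.span_mod_superset[OF Y.submodD(3)[OF B']] by blast
      then show "X.vs.rank_mod B ?H \<le> Y.vs.rank_mod B' (f ` ?H)"
        using I(3) card_image[OF injI] by simp
    qed
    also have "\<dots> \<le> Y.gkr A' B'" using ne W V fA by (intro Y.gkr1_le_gkr) auto
    finally show "X.gkr1 B W V \<le> Y.gkr A' B'" .
  qed
qed

text \<open>Generators in \<open>A'\<close> are lifted to \<open>A\<close> along the induced
  surjection. Products of the lifts represent the original products modulo \<open>B'\<close>, and
  images of a spanning set still span, so ranks can only drop.\<close>

lemma gkr_le_surj: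
  assumes f: "hom_on A f" and A: "X.submod A" and B: "X.submod B" and A': "Y.submod A'" and B': "Y.submod B'"
    and fB: "\<And>b. b \<in> A \<Longrightarrow> b \<in> B \<Longrightarrow> f b \<in> B'" and BA: "B \<subseteq> A"
    and surj: "\<And>a'. a' \<in> A' \<Longrightarrow> \<exists>a\<in>A. a' - f a \<in> B'"
  shows "Y.gkr A' B' \<le> X.gkr A B"
proof (cases "A' \<subseteq> B'")
  case True then show ?thesis by (simp add: X.gkr_ge Y.gkr_eq)
next
  case False
  have sB': "Y.vs.subspace B'" using Y.submodD(3)[OF B'] .
  have ne: "\<not> A \<subseteq> B"
  proof
    assume "A \<subseteq> B"
    have "a' \<in> B'" if "a' \<in> A'" for a'
    proof -
      obtain a where "a \<in> A" "a' - f a \<in> B'" using surj \<open>a' \<in> A'\<close> by blast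
      moreover have "f a \<in> B'" using fB \<open>A \<subseteq> B\<close> \<open>a \<in> A\<close> by auto
      ultimately show ?thesis using Y.vs.subspace_add[OF sB'] by force
    qed
    then show False using False by auto
  qed
  obtain l where l: "\<And>a'. a' \<in> A' \<Longrightarrow> l a' \<in> A" "\<And>a'. a' \<in> A' \<Longrightarrow> a' - f (l a') \<in> B'"
    using surj by metis
  show ?thesis
  proof (rule Y.gkr_leI[OF False])
    fix W V assume W: "finite W" "W \<subseteq> A'" and V: "finite V" "V \<subseteq> carrier S"
    have lW: "l ` W \<subseteq> A" using l W by auto
    have gA: "X.gens (l ` W) V n \<subseteq> A" for n using X.gens_subset[OF A lW V(2)] .
    have g: "\<exists>h\<in>X.gens (l ` W) V n. g - f h \<in> B'" if "g \<in> Y.gens W V n" for g n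
      using that
    proof (induction n arbitrary: g)
      case 0 then show ?case using l W by auto
    next
      case (Suc n)
      then obtain g' s where g': "g = op2 g' s" "g' \<in> Y.gens W V n" "s \<in> V" by auto
      with Suc.IH obtain h where h: "h \<in> X.gens (l ` W) V n" "g' - f h \<in> B'" by blast
      have s: "s \<in> carrier S" using g' V by auto
      have "op2 (g' - f h) s \<in> B'" using Y.submodD(4)[OF B' h(2) s] .
      moreover have "op2 (f h) s = f (op1 h s)" using f h gA s unfolding hom_on_def by (metis subsetD)
      ultimately have "g - f (op1 h s) \<in> B'" using Y.opr_diff[OF s] g'(1) by simp
      then show ?case using h g' by auto
    qed
    have "Y.gkr1 B' W V \<le> X.gkr1 B (l ` W) V"
    proof (rule gkr1_mono_gen[OF Y.gk_space_axioms X.gk_space_axioms])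
      fix n
      let ?H = "X.gens (l ` W) V n"
      have fH: "finite ?H" using X.finite_gens W V by auto
      obtain I where I: "I \<subseteq> ?H" "card I = X.vs.rank_mod B ?H" "?H \<subseteq> X.vs.span_mod B I"
        using X.vs.rank_mod_basis[OF X.submodD(3)[OF B] fH] by metis
      have fI: "finite I" using I fH finite_subset by blast
      have IA: "I \<subseteq> A" using I(1) gA by auto
      have "Y.gens W V n \<subseteq> Y.vs.span_mod B' (f ` I)"
      proof
        fix g assume "g \<in> Y.gens W V n"
        then obtain h where h: "h \<in> ?H" "g - f h \<in> B'" using g by blast
        then obtain y where y: "y \<in> X.vs.span I" "h - y \<in> B"
          using I(3) unfolding X.vs.span_mod_def by auto
        have yA: "y \<in> A" using X.vs.span_minimal[OF IA X.submodD(3)[OF A]] y by auto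
        have "f (h - y) \<in> B'" using fB y BA by auto
        then have "f h - f y \<in> B'" using hom_on_diff[OF f A] h gA yA by (metis subsetD)
        then have "g - f y \<in> B'" using Y.vs.subspace_add[OF sB' h(2)] by force
        moreover obtain c where "y = (\<Sum>i\<in>I. sc1 (c i) i)"
          using y(1) unfolding X.vs.span_finite[OF fI] by auto
        then have "f y = (\<Sum>i\<in>I. sc2 (c i) (f i))" using hom_on_sum[OF f A fI IA] by simp
        then have "f y \<in> Y.vs.span (f ` I)"
          by (simp add: Y.vs.span_sum Y.vs.span_scale Y.vs.span_base)
        ultimately show "g \<in> Y.vs.span_mod B' (f ` I)" unfolding Y.vs.span_mod_def by blast
      qed
      from Y.vs.rank_mod_le[OF sB' _ _ this] have "Y.vs.rank_mod B' (Y.gens W V n) \<le> card (f ` I)"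
        using Y.finite_gens W V fI by auto
      also have "\<dots> \<le> X.vs.rank_mod B ?H" using card_image_le[OF fI] I(2) by metis
      finally show "Y.vs.rank_mod B' (Y.gens W V n) \<le> X.vs.rank_mod B ?H" .
    qed
    also have "\<dots> \<le> X.gkr A B" using ne W V lW by (intro X.gkr1_le_gkr) auto
    finally show "Y.gkr1 B' W V \<le> X.gkr A B" .
  qed
qed

end

section \<open>Modules presented as quotients\<close>

abbreviation kspan :: "('k::field, 'a) module \<Rightarrow> 'a set \<Rightarrow> 'a set" where
  "kspan V H \<equiv> LinearCombinations.module.span class_ring V H"

lemma field_class_ring: "field (class_ring :: 'k::field ring)"
  by (rule class_field.field_axioms)

lemma cring_class_ring: "cring (class_ring :: 'k::field ring)"
  by (rule domain.axioms(1)[OF field.axioms(1)[OF field_class_ring]])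

lemma vectorspace_class_ringI:
  "Module.module (class_ring :: 'k::field ring) V \<Longrightarrow> vectorspace class_ring V"
  using field_class_ring by (simp add: vectorspace_def)

lemma kspan_minimal:
  assumes "Module.module (class_ring :: 'k::field ring) V" "H \<subseteq> N" "submodule class_ring N V"
  shows "kspan V H \<subseteq> N"
  using module.span_is_subset[OF assms(1,2,3)] .

lemma kspan_submodule:
  assumes "Module.module (class_ring :: 'k::field ring) V" "H \<subseteq> carrier V"
  shows "submodule class_ring (kspan V H) V" "H \<subseteq> kspan V H"
  using module.span_is_submodule[OF assms] module.in_own_span[OF assms] by auto

lemma kspan_mono: "Module.module (class_ring :: 'k::field ring) V \<Longrightarrow> H \<subseteq> H' \<Longrightarrow> kspan V H \<subseteq> kspan V H'"
  using module.span_is_monotone by blast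

lemma submodule_class_ringI:
  assumes "Module.module (class_ring :: 'k::field ring) V" "N \<subseteq> carrier V"
    "\<And>v w. \<lbrakk>v \<in> N; w \<in> N\<rbrakk> \<Longrightarrow> v \<oplus>\<^bsub>V\<^esub> w \<in> N" "\<zero>\<^bsub>V\<^esub> \<in> N"
    "\<And>c v. v \<in> N \<Longrightarrow> c \<odot>\<^bsub>V\<^esub> v \<in> N"
  shows "submodule class_ring N V"
  using assms by (simp add: submodule_def)

lemma submodule_class_ringD:
  assumes "submodule (class_ring :: 'k::field ring) N V"
  shows "N \<subseteq> carrier V" "\<And>v w. \<lbrakk>v \<in> N; w \<in> N\<rbrakk> \<Longrightarrow> v \<oplus>\<^bsub>V\<^esub> w \<in> N" "\<zero>\<^bsub>V\<^esub> \<in> N"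
    "\<And>c v. v \<in> N \<Longrightarrow> c \<odot>\<^bsub>V\<^esub> v \<in> N"
  using assms by (auto simp: submodule_def)

text \<open>Allows suprema over finite-dimensional subspaces to run over finite sets instead. The
  span of \<open>H\<close> is the same in \<open>V\<close> and in the subspace \<open>W\<close>,
  which links dimension inside \<open>W\<close> with generation inside \<open>V\<close>.\<close>

lemma fd_subspaces_iff:
  assumes "Module.module (class_ring :: 'k::field ring) V"
  shows "W \<in> fd_subspaces V \<longleftrightarrow> (\<exists>H. finite H \<and> H \<subseteq> carrier V \<and> W = kspan V H)"
proof -
  interpret V: vectorspace class_ring V using vectorspace_class_ringI[OF assms] .
  show ?thesis
  proof
    assume "W \<in> fd_subspaces V"
    then have W: "subspace class_ring W V" and fd: "vectorspace.fin_dim class_ring (V\<lparr>carrier := W\<rparr>)"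
      by (auto simp: fd_subspaces_def)
    have sm: "submodule class_ring W V" using V.is_module[OF W] .
    interpret W: vectorspace class_ring "V\<lparr>carrier := W\<rparr>" using V.subspace_is_vs[OF W] .
    obtain H where H: "finite H" "H \<subseteq> W" "kspan (V\<lparr>carrier := W\<rparr>) H = W"
      using fd unfolding W.fin_dim_def by auto
    with V.span_li_not_depend(1)[OF H(2) sm] submodule_class_ringD(1)[OF sm]
    show "\<exists>H. finite H \<and> H \<subseteq> carrier V \<and> W = kspan V H" by auto
  next
    assume "\<exists>H. finite H \<and> H \<subseteq> carrier V \<and> W = kspan V H"
    then obtain H where H: "finite H" "H \<subseteq> carrier V" "W = kspan V H" by auto
    have sm: "submodule class_ring W V" "H \<subseteq> W" using kspan_submodule[OF assms H(2)] H(3) by auto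
    have W: "subspace class_ring W V" using VectorSpace.subspace.intro[OF V.vectorspace_axioms sm(1)] .
    interpret W: vectorspace class_ring "V\<lparr>carrier := W\<rparr>" using V.subspace_is_vs[OF W] .
    have "W.fin_dim" unfolding W.fin_dim_def
      using V.span_li_not_depend(1)[OF sm(2,1)] H sm by (intro exI[of _ H]) auto
    then show "W \<in> fd_subspaces V" using W by (simp add: fd_subspaces_def)
  qed
qed

lemma kspace_simps [simp]:
  "carrier (kspace R M) = carrier M" "zero (kspace R M) = zero M" "add (kspace R M) = add M"
  "smult (kspace R M) c m = m \<cdot>\<^bsub>M\<^esub> (c \<odot>\<^bsub>R\<^esub> \<one>\<^bsub>R\<^esub>)"
  by (auto simp: kspace_def)

lemma regular_simps [simp]:
  "carrier (regular R) = carrier R" "zero (regular R) = zero R" "add (regular R) = add R"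
  "act (regular R) = mult R"
  by (auto simp: regular_def)

context k_algebra
begin

lemma algebra_module: "Module.module class_ring R" ..

lemma smult_in [simp, intro]: "x \<in> carrier R \<Longrightarrow> c \<odot> x \<in> carrier R"
  using smult_closed[of c x] by simp

lemma mult_smult_one: "m \<in> carrier R \<Longrightarrow> m \<otimes> (c \<odot> \<one>) = c \<odot> m"
  by (simp add: smult_mult_right)

lemma right_module_regular: "right_module R (regular R)"
proof -
  have "abelian_group (regular R)"
    by (rule abelian_groupI) (auto simp: a_ac intro: bexI[OF _ a_inv_closed] l_neg)
  then show ?thesis
    by (auto intro!: right_module.intro k_algebra_axioms right_module_axioms.intro
        simp: l_distr r_distr m_assoc)
qed

end

context right_module
begin

lemma kspace_module: "Module.module class_ring (kspace R M)"
proof -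
  have "abelian_group (kspace R M)"
    by (rule abelian_groupI) (auto simp: Mod.a_ac intro: bexI[OF _ a_inv_closed] l_neg)
  moreover have "m \<cdot> ((a * b) \<odot>\<^bsub>R\<^esub> \<one>\<^bsub>R\<^esub>) = m \<cdot> (b \<odot>\<^bsub>R\<^esub> \<one>\<^bsub>R\<^esub>) \<cdot> (a \<odot>\<^bsub>R\<^esub> \<one>\<^bsub>R\<^esub>)"
    if "m \<in> carrier M" for m a b
  proof -
    have "(a * b) \<odot>\<^bsub>R\<^esub> \<one>\<^bsub>R\<^esub> = (b \<odot>\<^bsub>R\<^esub> \<one>\<^bsub>R\<^esub>) \<otimes>\<^bsub>R\<^esub> (a \<odot>\<^bsub>R\<^esub> \<one>\<^bsub>R\<^esub>)"
      using smult_assoc1[of a b "\<one>\<^bsub>R\<^esub>"] by (simp add: mult_smult_one)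
    then show ?thesis using that by (simp add: act_mult)
  qed
  moreover have "(a + b) \<odot>\<^bsub>R\<^esub> \<one>\<^bsub>R\<^esub> = a \<odot>\<^bsub>R\<^esub> \<one>\<^bsub>R\<^esub> \<oplus>\<^bsub>R\<^esub> b \<odot>\<^bsub>R\<^esub> \<one>\<^bsub>R\<^esub>" for a b
    using smult_l_distr[of a b "\<one>\<^bsub>R\<^esub>"] by simp
  moreover have "1 \<odot>\<^bsub>R\<^esub> \<one>\<^bsub>R\<^esub> = \<one>\<^bsub>R\<^esub>" using smult_one[of "\<one>\<^bsub>R\<^esub>"] by simp
  ultimately show ?thesis
    by (intro moduleI cring_class_ring)
      (auto simp: act_closed act_add_left act_add_right act_one)
qed

text \<open>Bilinearity, used through minimality of spans once per factor: with \<open>p\<close>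
  fixed in \<open>P\<close> the left factor is extended to the span of \<open>W\<close>, then with
  \<open>w\<close> fixed the right factor is extended to the span of \<open>P\<close>.\<close>

lemma space_prod_span:
  assumes W: "W \<subseteq> carrier M" and P: "P \<subseteq> carrier R"
  shows "space_prod R M (kspan (kspace R M) W) (kspan R P) = kspan (kspace R M) {w \<cdot> p |w p. w \<in> W \<and> p \<in> P}"
    (is "_ = kspan ?V ?G")
proof -
  note V = kspace_module
  note A = algebra_module
  have G: "?G \<subseteq> carrier ?V" using W P by (auto intro!: act_closed)
  note sG = kspan_submodule[OF V G]
  note sW = kspan_submodule[OF V, of W, unfolded kspace_simps, OF W]
  note sP = kspan_submodule[OF A P]
  let ?N = "kspan ?V ?G"
  have N: "?N \<subseteq> carrier M" "\<And>v w. \<lbrakk>v \<in> ?N; w \<in> ?N\<rbrakk> \<Longrightarrow> v \<oplus> w \<in> ?N" "\<zero> \<in> ?N"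
    "\<And>c v. v \<in> ?N \<Longrightarrow> v \<cdot> (c \<odot>\<^bsub>R\<^esub> \<one>\<^bsub>R\<^esub>) \<in> ?N"
    using submodule_class_ringD[OF sG(1)] by auto
  have z: "\<zero> \<cdot> r = \<zero>" if "r \<in> carrier R" for r
  proof -
    have "\<zero> \<cdot> r \<oplus> \<zero> \<cdot> r = \<zero> \<cdot> r" using act_add_left[of \<zero> \<zero> r] that by simp
    then show ?thesis using that act_closed[of \<zero> r] Mod.add.r_cancel_one by simp
  qed
  have z2: "w \<cdot> \<zero>\<^bsub>R\<^esub> = \<zero>" if "w \<in> carrier M" for w
  proof -
    have "w \<cdot> \<zero>\<^bsub>R\<^esub> \<oplus> w \<cdot> \<zero>\<^bsub>R\<^esub> = w \<cdot> \<zero>\<^bsub>R\<^esub>" using act_add_right[of w "\<zero>\<^bsub>R\<^esub>" "\<zero>\<^bsub>R\<^esub>"] that by simp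
    then show ?thesis using that act_closed[of w "\<zero>\<^bsub>R\<^esub>"] Mod.add.r_cancel_one by simp
  qed
  have comm: "w \<cdot> (c \<odot>\<^bsub>R\<^esub> p) = w \<cdot> p \<cdot> (c \<odot>\<^bsub>R\<^esub> \<one>\<^bsub>R\<^esub>)"
    "w \<cdot> (c \<odot>\<^bsub>R\<^esub> \<one>\<^bsub>R\<^esub>) \<cdot> p = w \<cdot> p \<cdot> (c \<odot>\<^bsub>R\<^esub> \<one>\<^bsub>R\<^esub>)"
    if "w \<in> carrier M" "p \<in> carrier R" for w p c
    using that by (simp_all add: act_mult[symmetric] smult_mult_right smult_mult_left)
  have N5: "w \<cdot> (c \<odot>\<^bsub>R\<^esub> v) \<in> ?N" if "w \<in> carrier M" "v \<in> carrier R" "w \<cdot> v \<in> ?N" for w c v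
    unfolding comm(1)[OF that(1,2)] by (rule N(4)[OF that(3)])
  have 1: "kspan ?V W \<subseteq> {w \<in> carrier M. \<forall>p\<in>P. w \<cdot> p \<in> ?N}"
  proof (rule kspan_minimal[OF V])
    show "W \<subseteq> {w \<in> carrier M. \<forall>p\<in>P. w \<cdot> p \<in> ?N}" using W sG(2) by blast
    show "submodule class_ring {w \<in> carrier M. \<forall>p\<in>P. w \<cdot> p \<in> ?N} ?V"
      using P by (intro submodule_class_ringI[OF V])
        (auto simp: act_add_left subset_iff z comm(2) intro!: N act_closed)
  qed
  have 2: "w \<cdot> v \<in> ?N" if w: "w \<in> kspan ?V W" and v: "v \<in> kspan R P" for w v
  proof -
    have wM: "w \<in> carrier M" using 1 w by auto
    have "kspan R P \<subseteq> {v \<in> carrier R. w \<cdot> v \<in> ?N}"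
    proof (rule kspan_minimal[OF A])
      show "P \<subseteq> {v \<in> carrier R. w \<cdot> v \<in> ?N}" using P 1 w by auto
      show "submodule class_ring {v \<in> carrier R. w \<cdot> v \<in> ?N} R"
        using wM by (intro submodule_class_ringI[OF A])
         (auto simp: act_add_right z2 intro!: N(2,3) N5)
    qed
    then show ?thesis using v by auto
  qed
  show ?thesis unfolding space_prod_def
  proof
    show "kspan ?V {w \<cdot> v |w v. w \<in> kspan ?V W \<and> v \<in> kspan R P} \<subseteq> ?N"
      by (rule kspan_minimal[OF V _ sG(1)]) (use 2 in auto)
    show "?N \<subseteq> kspan ?V {w \<cdot> v |w v. w \<in> kspan ?V W \<and> v \<in> kspan R P}"
      by (rule kspan_mono[OF V]) (use sW(2) sP(2) in blast)
  qed
qed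

end

fun prods :: "('k::field, 'r) module \<Rightarrow> 'r set \<Rightarrow> nat \<Rightarrow> 'r set" where
  "prods R V 0 = {\<one>\<^bsub>R\<^esub>}"
| "prods R V (Suc n) = {p \<otimes>\<^bsub>R\<^esub> v |p v. p \<in> prods R V n \<and> v \<in> V}"

context k_algebra
begin

lemma prods_carrier: "V \<subseteq> carrier R \<Longrightarrow> prods R V n \<subseteq> carrier R"
  by (induction n) auto

text \<open>In the space underlying the regular module, \<open>c\<close> acts as right
  multiplication by \<open>c 1\<close>. This agrees with the scalar multiplication of
  \<open>R\<close> only on the carrier, so the spans are compared instead of the records.\<close>

lemma kspan_regular:
  assumes "P \<subseteq> carrier R"
  shows "kspan (kspace R (regular R)) P = kspan R P"
proof -
  note V = right_module.kspace_module[OF right_module_regular]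
  note A = algebra_module
  note sP = kspan_submodule[OF A assms] 
  have P': "P \<subseteq> carrier (kspace R (regular R))" using assms by simp
  note sV = kspan_submodule[OF V P'] 
  show ?thesis
  proof
    show "kspan (kspace R (regular R)) P \<subseteq> kspan R P"
      using submodule_class_ringD[OF sP(1)]
      by (intro kspan_minimal[OF V sP(2)] submodule_class_ringI[OF V])
        (auto simp: mult_smult_one subset_iff)
    have 4: "c \<odot> v \<in> kspan (kspace R (regular R)) P" if "v \<in> kspan (kspace R (regular R)) P" for c v
      using submodule_class_ringD(4)[OF sV(1) that, of c] submodule_class_ringD(1)[OF sV(1)] that
      by (auto simp: mult_smult_one)
    show "kspan R P \<subseteq> kspan (kspace R (regular R)) P"
      using submodule_class_ringD(1,2,3)[OF sV(1)]
      by (intro kspan_minimal[OF A sV(2)] submodule_class_ringI[OF A] 4) auto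
  qed
qed

lemma space_power_span:
  assumes "V \<subseteq> carrier R"
  shows "space_power R (kspan R V) n = kspan R (prods R V n)"
proof (induction n)
  case (Suc n)
  have c: "{w \<otimes> p |w p. w \<in> prods R V n \<and> p \<in> V} \<subseteq> carrier R"
    using prods_carrier[OF assms, of "Suc n"] by simp
  show ?case using right_module.space_prod_span[OF right_module_regular, of "prods R V n" V]
    assms prods_carrier[OF assms] kspan_regular[OF prods_carrier[OF assms, of n]] kspan_regular[OF c]
    by (simp add: Suc)
qed simp

end

section \<open>Presentations and the dimension that they compute\<close>

context gk_space
begin

text \<open>Says that \<open>\<pi>\<close> induces an isomorphism from \<open>A/B\<close> onto
  \<open>Y\<close>. That \<open>Y\<close> is a module is not assumed but deduced, so for quotients
  and coded modules only these conditions need checking.\<close>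

definition presents :: "'v set \<Rightarrow> 'v set \<Rightarrow> ('s, 'y) rmod \<Rightarrow> ('v \<Rightarrow> 'y) \<Rightarrow> bool" where
  "presents A B Y \<pi> \<longleftrightarrow> submod A \<and> submod B \<and> B \<subseteq> A \<and> carrier Y = \<pi> ` A \<and> \<zero>\<^bsub>Y\<^esub> = \<pi> 0 \<and>
     (\<forall>a\<in>A. \<forall>b\<in>A. \<pi> (a + b) = \<pi> a \<oplus>\<^bsub>Y\<^esub> \<pi> b) \<and>
     (\<forall>a\<in>A. \<forall>s\<in>carrier S. \<pi> (opr a s) = \<pi> a \<cdot>\<^bsub>Y\<^esub> s) \<and>
     (\<forall>a\<in>A. \<forall>b\<in>A. \<pi> a = \<pi> b \<longleftrightarrow> a - b \<in> B)"

lemma presentsD: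
  assumes "presents A B Y \<pi>"
  shows "submod A" "submod B" "B \<subseteq> A" "carrier Y = \<pi> ` A" "\<zero>\<^bsub>Y\<^esub> = \<pi> 0"
    "\<And>a b. \<lbrakk>a \<in> A; b \<in> A\<rbrakk> \<Longrightarrow> \<pi> (a + b) = \<pi> a \<oplus>\<^bsub>Y\<^esub> \<pi> b"
    "\<And>a s. \<lbrakk>a \<in> A; s \<in> carrier S\<rbrakk> \<Longrightarrow> \<pi> (opr a s) = \<pi> a \<cdot>\<^bsub>Y\<^esub> s"
    "\<And>a b. \<lbrakk>a \<in> A; b \<in> A\<rbrakk> \<Longrightarrow> \<pi> a = \<pi> b \<longleftrightarrow> a - b \<in> B"
  using assms unfolding presents_def by auto

lemma opr_smult_one: 
  assumes "v \<in> T"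
  shows "opr v (c \<odot>\<^bsub>S\<^esub> \<one>\<^bsub>S\<^esub>) - scale c v \<in> Z"
proof -
  have "opr v (c \<odot>\<^bsub>S\<^esub> \<one>\<^bsub>S\<^esub>) - scale c (opr v \<one>\<^bsub>S\<^esub>) \<in> Z" using opr_smult assms by simp
  moreover have "scale c (opr v \<one>\<^bsub>S\<^esub> - v) \<in> Z" using vs.subspace_scale[OF Z_sub opr_one[OF assms]] .
  ultimately have "(opr v (c \<odot>\<^bsub>S\<^esub> \<one>\<^bsub>S\<^esub>) - scale c (opr v \<one>\<^bsub>S\<^esub>)) + scale c (opr v \<one>\<^bsub>S\<^esub> - v) \<in> Z"
    by (rule vs.subspace_add[OF Z_sub])
  then show ?thesis by (simp add: vs.scale_right_diff_distrib)
qed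

context
  fixes A B :: "'v set" and Y :: "('s, 'y) rmod" and \<pi>
  assumes P: "presents A B Y \<pi>"
begin

lemmas PD = presentsD[OF P]

lemma A_sub: "vs.subspace A" and B_sub: "vs.subspace B" and Z_B: "Z \<subseteq> B" and A_T: "A \<subseteq> T"
  and A_opr: "\<And>a s. \<lbrakk>a \<in> A; s \<in> carrier S\<rbrakk> \<Longrightarrow> opr a s \<in> A"
  using submodD[OF PD(1)] submodD[OF PD(2)] by auto

lemma presents_right_module: "right_module S Y"
proof -
  have ab: "abelian_group Y"
  proof (rule abelian_groupI)
    show "\<zero>\<^bsub>Y\<^esub> \<in> carrier Y" using PD(4,5) vs.subspace_0[OF A_sub] by auto
    show "\<exists>y\<in>carrier Y. y \<oplus>\<^bsub>Y\<^esub> x = \<zero>\<^bsub>Y\<^esub>" if x: "x \<in> carrier Y" for x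
    proof -
      obtain a where a: "a \<in> A" "x = \<pi> a" using x PD(4) by auto
      then show ?thesis using PD(4,5) PD(6)[of "-a" a] vs.subspace_neg[OF A_sub] by auto
    qed
    show "\<zero>\<^bsub>Y\<^esub> \<oplus>\<^bsub>Y\<^esub> x = x" if "x \<in> carrier Y" for x
      using that PD(4,5) PD(6)[of 0] vs.subspace_0[OF A_sub] by auto
  qed (auto simp: PD(4) PD(6)[symmetric] vs.subspace_add[OF A_sub] ac_simps)
  show ?thesis
  proof (rule right_module.intro[OF Alg.k_algebra_axioms ab], rule right_module_axioms.intro)
    fix m r assume m: "m \<in> carrier Y"
    then obtain a where a: "a \<in> A" "m = \<pi> a" using PD(4) by auto
    note aT = subsetD[OF A_T a(1)]
    show "m \<cdot>\<^bsub>Y\<^esub> r \<in> carrier Y" if r: "r \<in> carrier S"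
      unfolding a(2) PD(4) PD(7)[OF a(1) r, symmetric] using A_opr[OF a(1) r] by simp
    show "(m \<oplus>\<^bsub>Y\<^esub> m') \<cdot>\<^bsub>Y\<^esub> r = m \<cdot>\<^bsub>Y\<^esub> r \<oplus>\<^bsub>Y\<^esub> m' \<cdot>\<^bsub>Y\<^esub> r" if "m' \<in> carrier Y" "r \<in> carrier S" for m'
      using that a by (auto simp: PD(4) PD(6,7)[symmetric] vs.subspace_add[OF A_sub] A_opr opr_add)
    have "\<pi> (opr a \<one>\<^bsub>S\<^esub>) = \<pi> a"
      using PD(8)[of "opr a \<one>\<^bsub>S\<^esub>" a] A_opr a(1) opr_one[OF aT] Z_B by auto
    then show "m \<cdot>\<^bsub>Y\<^esub> \<one>\<^bsub>S\<^esub> = m" using a PD(7)[of a "\<one>\<^bsub>S\<^esub>"] by simp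
    fix s assume rs: "r \<in> carrier S" "s \<in> carrier S"
    have "\<pi> (opr a (r \<oplus>\<^bsub>S\<^esub> s)) = \<pi> (opr a r + opr a s)"
      using PD(8)[of "opr a (r \<oplus>\<^bsub>S\<^esub> s)" "opr a r + opr a s"] A_opr a(1) rs opr_add_right[OF aT rs] Z_B
        vs.subspace_add[OF A_sub] by auto
    then show "m \<cdot>\<^bsub>Y\<^esub> (r \<oplus>\<^bsub>S\<^esub> s) = m \<cdot>\<^bsub>Y\<^esub> r \<oplus>\<^bsub>Y\<^esub> m \<cdot>\<^bsub>Y\<^esub> s"
      using a rs A_opr by (simp add: PD(6,7)[symmetric])
    have "\<pi> (opr a (r \<otimes>\<^bsub>S\<^esub> s)) = \<pi> (opr (opr a r) s)"
      using PD(8)[of "opr a (r \<otimes>\<^bsub>S\<^esub> s)" "opr (opr a r) s"] A_opr a(1) rs opr_mult[OF aT rs] Z_B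
      by auto
    then show "m \<cdot>\<^bsub>Y\<^esub> (r \<otimes>\<^bsub>S\<^esub> s) = m \<cdot>\<^bsub>Y\<^esub> r \<cdot>\<^bsub>Y\<^esub> s"
      using a rs A_opr by (simp add: PD(6,7)[symmetric])
  qed
qed

lemma presents_scale: "a \<in> A \<Longrightarrow> \<pi> (scale c a) = \<pi> a \<cdot>\<^bsub>Y\<^esub> (c \<odot>\<^bsub>S\<^esub> \<one>\<^bsub>S\<^esub>)"
proof -
  assume a: "a \<in> A"
  have "\<pi> (opr a (c \<odot>\<^bsub>S\<^esub> \<one>\<^bsub>S\<^esub>)) = \<pi> (scale c a)"
    using PD(8)[of "opr a (c \<odot>\<^bsub>S\<^esub> \<one>\<^bsub>S\<^esub>)" "scale c a"] A_opr[OF a] opr_smult_one[of a c] a A_T Z_B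
      vs.subspace_scale[OF A_sub a] by auto
  then show ?thesis using PD(7)[OF a] by simp
qed

lemmas Y_module = right_module.kspace_module[OF presents_right_module]

lemma presents_trivial_iff: "carrier Y = {\<zero>\<^bsub>Y\<^esub>} \<longleftrightarrow> A \<subseteq> B"
proof
  assume c: "carrier Y = {\<zero>\<^bsub>Y\<^esub>}"
  show "A \<subseteq> B"
  proof
    fix a assume a: "a \<in> A"
    then have "\<pi> a \<in> carrier Y" using PD(4) by blast
    then have "\<pi> a = \<pi> 0" unfolding c PD(5)[symmetric] by simp
    then show "a \<in> B" using PD(8)[OF a, of 0] vs.subspace_0[OF A_sub] by simp
  qed
next
  assume "A \<subseteq> B"
  then have "\<pi> a = \<pi> 0" if "a \<in> A" for a using PD(8)[OF that, of 0] vs.subspace_0[OF A_sub] that by auto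
  then show "carrier Y = {\<zero>\<^bsub>Y\<^esub>}" unfolding PD(4,5) using vs.subspace_0[OF A_sub] by blast
qed

lemma kspan_image_submodule:
  assumes "H \<subseteq> A"
  shows "submodule class_ring (kspan (kspace S Y) (\<pi> ` H)) (kspace S Y)"
    "\<pi> ` H \<subseteq> kspan (kspace S Y) (\<pi> ` H)"
proof -
  have "\<pi> ` H \<subseteq> carrier (kspace S Y)" unfolding kspace_simps PD(4) using assms by (rule image_mono)
  from kspan_submodule[OF Y_module this]
  show "submodule class_ring (kspan (kspace S Y) (\<pi> ` H)) (kspace S Y)"
    "\<pi> ` H \<subseteq> kspan (kspace S Y) (\<pi> ` H)" .
qed

lemma kspan_presents:
  assumes H: "H \<subseteq> A"
  shows "kspan (kspace S Y) (\<pi> ` H) = \<pi> ` vs.span H"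
proof
  have sA: "vs.span H \<subseteq> A" using vs.span_minimal[OF H A_sub] .
  show "kspan (kspace S Y) (\<pi> ` H) \<subseteq> \<pi> ` vs.span H"
  proof (rule kspan_minimal[OF Y_module])
    show "\<pi> ` H \<subseteq> \<pi> ` vs.span H" using vs.span_base by auto
    show "submodule class_ring (\<pi> ` vs.span H) (kspace S Y)"
    proof (rule submodule_class_ringI[OF Y_module])
      show "\<pi> ` vs.span H \<subseteq> carrier (kspace S Y)" using sA PD(4) by auto
      show "\<zero>\<^bsub>kspace S Y\<^esub> \<in> \<pi> ` vs.span H" using PD(5) vs.span_zero by auto
      fix v w assume v: "v \<in> \<pi> ` vs.span H" 
      then obtain a where a: "a \<in> vs.span H" "v = \<pi> a" by auto
      show "v \<oplus>\<^bsub>kspace S Y\<^esub> w \<in> \<pi> ` vs.span H" if w: "w \<in> \<pi> ` vs.span H"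
      proof -
        obtain b where b: "b \<in> vs.span H" "w = \<pi> b" using w by auto
        have "v \<oplus>\<^bsub>kspace S Y\<^esub> w = \<pi> (a + b)" using PD(6)[OF subsetD[OF sA a(1)] subsetD[OF sA b(1)]] a b by simp
        then show ?thesis using vs.span_add[OF a(1) b(1)] by auto
      qed
      fix c 
      have "c \<odot>\<^bsub>kspace S Y\<^esub> v = \<pi> (scale c a)" using presents_scale[of a c] a sA by auto
      then show "c \<odot>\<^bsub>kspace S Y\<^esub> v \<in> \<pi> ` vs.span H" using vs.span_scale[OF a(1)] by auto
    qed
  qed
  let ?N = "kspan (kspace S Y) (\<pi> ` H)"
  have N: "submodule class_ring ?N (kspace S Y)" "\<pi> ` H \<subseteq> ?N"
    by (rule kspan_image_submodule[OF H])+
  have "vs.span H \<subseteq> {a \<in> A. \<pi> a \<in> ?N}"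
  proof (rule vs.span_minimal)
    show "H \<subseteq> {a \<in> A. \<pi> a \<in> ?N}" using N H by auto
    show "vs.subspace {a \<in> A. \<pi> a \<in> ?N}"
      using submodule_class_ringD(2,3,4)[OF N(1)] vs.subspace_0[OF A_sub] vs.subspace_add[OF A_sub] vs.subspace_scale[OF A_sub]
      by (intro vs.subspaceI) (auto simp: PD(5)[symmetric] PD(6) presents_scale)
  qed
  then show "\<pi> ` vs.span H \<subseteq> ?N" by auto
qed

text \<open>The dimension is the least size of a finite spanning set. A basis \<open>I\<close> of
  \<open>H\<close> modulo \<open>B\<close> maps to a spanning set, which bounds it from above; any
  spanning set lifts injectively to a subset of \<open>span H\<close> that spans \<open>H\<close>
  modulo \<open>B\<close>, which bounds it from below.\<close>

lemma dim_presents: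
  assumes H: "H \<subseteq> A" "finite H"
  shows "vectorspace.dim class_ring ((kspace S Y)\<lparr>carrier := kspan (kspace S Y) (\<pi> ` H)\<rparr>)
    = vs.rank_mod B H"
proof -
  interpret V: vectorspace class_ring "kspace S Y" using vectorspace_class_ringI[OF Y_module] .
  let ?U = "kspan (kspace S Y) (\<pi> ` H)"
  have sA: "vs.span H \<subseteq> A" using vs.span_minimal[OF H(1) A_sub] .
  have U: "submodule class_ring ?U (kspace S Y)" "\<pi> ` H \<subseteq> ?U"
    by (rule kspan_image_submodule[OF H(1)])+
  have "subspace class_ring ?U (kspace S Y)" using VectorSpace.subspace.intro[OF V.vectorspace_axioms U(1)] .
  then interpret W: vectorspace class_ring "(kspace S Y)\<lparr>carrier := ?U\<rparr>" using V.subspace_is_vs by auto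
  have low: "vs.rank_mod B H \<le> card G" if G: "finite G" "G \<subseteq> ?U" "kspan (kspace S Y) G = ?U" for G
  proof -
    have GU: "G \<subseteq> \<pi> ` vs.span H" using G(2) kspan_presents[OF H(1)] by simp
    then obtain G0 where G0: "G0 \<subseteq> vs.span H" "inj_on \<pi> G0" "G = \<pi> ` G0"
      by (meson subset_image_inj)
    have fG0: "finite G0" "card G = card G0" using G0 G(1) finite_imageD card_image by auto
    have G0A: "G0 \<subseteq> A" using G0(1) sA by auto
    have "H \<subseteq> vs.span_mod B G0"
    proof
      fix h assume h: "h \<in> H"
      then have "\<pi> h \<in> \<pi> ` vs.span G0" using U(2) G(3) kspan_presents[OF G0A] G0(3) by auto
      then obtain y where y: "y \<in> vs.span G0" "\<pi> h = \<pi> y" by auto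
      then have "h - y \<in> B" using PD(8)[of h y] h H(1) vs.span_minimal[OF G0A A_sub] by auto
      then show "h \<in> vs.span_mod B G0" using y by (auto simp: vs.span_mod_def)
    qed
    then show ?thesis using vs.rank_mod_le[OF B_sub H(2) fG0(1)] fG0(2) by simp
  qed
  obtain I where I: "I \<subseteq> H" "card I = vs.rank_mod B H" "H \<subseteq> vs.span_mod B I"
    using vs.rank_mod_basis[OF B_sub H(2)] by metis
  have fI: "finite I" using I(1) H(2) finite_subset by auto
  have piI: "kspan (kspace S Y) (\<pi> ` I) = ?U"
  proof
    show "kspan (kspace S Y) (\<pi> ` I) \<subseteq> ?U" using kspan_mono[OF Y_module] I(1) by (simp add: image_mono)
    have IA: "I \<subseteq> A" using I(1) H(1) by auto
    show "?U \<subseteq> kspan (kspace S Y) (\<pi> ` I)"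
    proof (rule kspan_minimal[OF Y_module])
      show "\<pi> ` H \<subseteq> kspan (kspace S Y) (\<pi> ` I)" unfolding kspan_presents[OF IA]
      proof (rule image_subsetI)
        fix h assume h: "h \<in> H"
        then obtain y where y: "y \<in> vs.span I" "h - y \<in> B" using I(3) by (auto simp: vs.span_mod_def)
        then have "\<pi> h = \<pi> y" using PD(8)[of h y] h H(1) vs.span_minimal[OF IA A_sub] by auto
        then show "\<pi> h \<in> \<pi> ` vs.span I" using y by auto
      qed
      show "submodule class_ring (kspan (kspace S Y) (\<pi> ` I)) (kspace S Y)" by (rule kspan_image_submodule(1)[OF IA])
    qed
  qed
  have IU: "\<pi> ` I \<subseteq> ?U" using U(2) I(1) by auto
  have "card (\<pi> ` I) = vs.rank_mod B H"
    using low[OF _ IU piI] card_image_le[OF fI, of \<pi>] I(2) fI by auto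
  then show ?thesis unfolding W.dim_def
    using fI IU piI V.span_li_not_depend(1)[OF _ U(1)] low
    by (intro Least_equality) (auto intro!: exI[of _ "\<pi> ` I"])
qed

text \<open>Reconciles two bracketings: \<open>gens\<close> acts factor by factor,
  \<open>prods\<close> multiplies inside the algebra first. Upstairs they agree only modulo
  \<open>Z\<close>; after \<open>\<pi>\<close> they agree exactly.\<close>

lemma gens_prods:
  assumes W: "W \<subseteq> A" and V: "V \<subseteq> carrier S"
  shows "\<pi> ` gens W V n = {w \<cdot>\<^bsub>Y\<^esub> p |w p. w \<in> \<pi> ` W \<and> p \<in> prods S V n}"
proof (induction n)
  case 0
  have "w \<cdot>\<^bsub>Y\<^esub> \<one>\<^bsub>S\<^esub> = w" if "w \<in> \<pi> ` W" for w
  proof (rule right_module.act_one[OF presents_right_module])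
    show "w \<in> carrier Y" unfolding PD(4) using that image_mono[OF W, of \<pi>] by (rule subsetD[rotated])
  qed
  then have "(\<lambda>w. w \<cdot>\<^bsub>Y\<^esub> \<one>\<^bsub>S\<^esub>) ` (\<pi> ` W) = (\<lambda>w. w) ` (\<pi> ` W)" by (intro image_cong refl)
  moreover have "{w \<cdot>\<^bsub>Y\<^esub> p |w p. w \<in> X \<and> p \<in> prods S V 0} = (\<lambda>w. w \<cdot>\<^bsub>Y\<^esub> \<one>\<^bsub>S\<^esub>) ` X" for X
    by auto
  ultimately show ?case by simp
next
  case (Suc n)
  have g: "gens W V n \<subseteq> A" using gens_subset[OF PD(1) W V] .
  have step: "\<pi> (opr g s) = w \<cdot>\<^bsub>Y\<^esub> (p \<otimes>\<^bsub>S\<^esub> s)"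
    if "g \<in> gens W V n" "s \<in> V" "w \<in> \<pi> ` W" "p \<in> prods S V n" "\<pi> g = w \<cdot>\<^bsub>Y\<^esub> p" for g s w p
  proof -
    have "g \<in> A" using g that(1) by (rule subsetD)
    have s: "s \<in> carrier S" using that(2) V by (rule subsetD[rotated])
    have p: "p \<in> carrier S" using that(4) Alg.prods_carrier[OF V, of n] by (rule subsetD[rotated])
    have w: "w \<in> carrier Y" unfolding PD(4) using that(3) image_mono[OF W, of \<pi>] by (rule subsetD[rotated])
    show ?thesis unfolding PD(7)[OF \<open>g \<in> A\<close> s] that(5) right_module.act_mult[OF presents_right_module w p s] ..
  qed
  show ?case
  proof (intro equalityI subsetI)
    fix y assume "y \<in> \<pi> ` gens W V (Suc n)"
    then obtain g s where gs: "g \<in> gens W V n" "s \<in> V" "y = \<pi> (opr g s)" by auto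
    then have "\<pi> g \<in> \<pi> ` gens W V n" by blast
    then obtain w p where wp: "w \<in> \<pi> ` W" "p \<in> prods S V n" "\<pi> g = w \<cdot>\<^bsub>Y\<^esub> p" unfolding Suc by blast
    have "p \<otimes>\<^bsub>S\<^esub> s \<in> prods S V (Suc n)" using wp(2) gs(2) by auto
    then show "y \<in> {w \<cdot>\<^bsub>Y\<^esub> p |w p. w \<in> \<pi> ` W \<and> p \<in> prods S V (Suc n)}"
      using step[OF gs(1,2) wp] gs(3) wp(1) by blast
  next
    fix y assume "y \<in> {w \<cdot>\<^bsub>Y\<^esub> p |w p. w \<in> \<pi> ` W \<and> p \<in> prods S V (Suc n)}"
    then obtain w p s where wp: "w \<in> \<pi> ` W" "p \<in> prods S V n" "s \<in> V" "y = w \<cdot>\<^bsub>Y\<^esub> (p \<otimes>\<^bsub>S\<^esub> s)" by fastforce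
    then have "w \<cdot>\<^bsub>Y\<^esub> p \<in> \<pi> ` gens W V n" unfolding Suc by blast
    then obtain g where g': "g \<in> gens W V n" "\<pi> g = w \<cdot>\<^bsub>Y\<^esub> p" by force
    have "opr g s \<in> gens W V (Suc n)" using g'(1) wp(3) by auto
    then show "y \<in> \<pi> ` gens W V (Suc n)" using step[OF g'(1) wp(3,1,2) g'(2)] wp(4) by force
  qed
qed

lemma growth_presents:
  assumes W: "W \<subseteq> A" "finite W" and V: "V \<subseteq> carrier S" "finite V"
  shows "growth S Y (kspan (kspace S Y) (\<pi> ` W)) (kspan S V) n = vs.rank_mod B (gens W V n)"
proof -
  have "space_prod S Y (kspan (kspace S Y) (\<pi> ` W)) (space_power S (kspan S V) n)
      = kspan (kspace S Y) (\<pi> ` gens W V n)"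
    unfolding Alg.space_power_span[OF V(1)] gens_prods[OF W(1) V(1)]
    by (rule right_module.space_prod_span[OF presents_right_module])
      (use W PD(4) Alg.prods_carrier[OF V(1)] in auto)
  then show ?thesis unfolding growth_def
    using dim_presents[OF gens_subset[OF PD(1) W(1) V(1)] finite_gens[OF W(2) V(2)]] by simp
qed

text \<open>Every finite-dimensional subspace of \<open>Y\<close> is spanned by the image of a
  finite subset of \<open>A\<close>, so both suprema can be reindexed by finite sets, where growth
  is a relative rank.\<close>

lemma gkdim_presents: "gkdim S Y = gkr A B"
proof (cases "A \<subseteq> B")
  case True
  then show ?thesis by (simp add: gkdim_def presents_trivial_iff gkr_eq)
next
  case False
  have "gkdim S Y = (SUP W \<in> fd_subspaces (kspace S Y). SUP V \<in> fd_subspaces S.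
       limsup (\<lambda>n. ereal (log (real n) (real (growth S Y W V n)))))"
    using False by (simp add: gkdim_def presents_trivial_iff)
  also have "fd_subspaces (kspace S Y) = (\<lambda>W. kspan (kspace S Y) (\<pi> ` W)) ` {W. finite W \<and> W \<subseteq> A}"
  proof (intro equalityI subsetI)
    fix U assume "U \<in> fd_subspaces (kspace S Y)"
    then obtain H where H: "finite H" "H \<subseteq> \<pi> ` A" "U = kspan (kspace S Y) H"
      using fd_subspaces_iff[OF Y_module] PD(4) by auto
    then obtain W where "W \<subseteq> A" "finite W" "H = \<pi> ` W" using finite_subset_image by metis
    then show "U \<in> (\<lambda>W. kspan (kspace S Y) (\<pi> ` W)) ` {W. finite W \<and> W \<subseteq> A}" using H(3) by auto
  next
    fix U assume "U \<in> (\<lambda>W. kspan (kspace S Y) (\<pi> ` W)) ` {W. finite W \<and> W \<subseteq> A}"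
    then obtain W where "finite W" "W \<subseteq> A" "U = kspan (kspace S Y) (\<pi> ` W)" by auto
    then show "U \<in> fd_subspaces (kspace S Y)"
      using fd_subspaces_iff[OF Y_module] PD(4) by (auto intro!: exI[of _ "\<pi> ` W"])
  qed
  also have "fd_subspaces S = kspan S ` {V. finite V \<and> V \<subseteq> carrier S}"
    using fd_subspaces_iff[OF Alg.algebra_module] by auto
  finally have eq: "gkdim S Y = (SUP W \<in> {W. finite W \<and> W \<subseteq> A}. SUP V \<in> {V. finite V \<and> V \<subseteq> carrier S}.
     limsup (\<lambda>n. ereal (log (real n)
       (real (growth S Y (kspan (kspace S Y) (\<pi> ` W)) (kspan S V) n)))))"
    unfolding image_image .
  show ?thesis unfolding eq gkr_def gkr1_def if_not_P[OF False]
    by (intro SUP_cong refl) (simp add: growth_presents)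
qed

end

end

section \<open>Submodules, quotients and codes of a presented module\<close>

context gk_space
begin

lemma opr_zero_right:
  assumes "v \<in> T"
  shows "opr v \<zero>\<^bsub>S\<^esub> \<in> Z"
proof -
  have "opr v (\<zero>\<^bsub>S\<^esub> \<oplus>\<^bsub>S\<^esub> \<zero>\<^bsub>S\<^esub>) - (opr v \<zero>\<^bsub>S\<^esub> + opr v \<zero>\<^bsub>S\<^esub>) \<in> Z"
    using assms by (intro opr_add_right) auto
  then show ?thesis using vs.subspace_neg[OF Z_sub] by fastforce
qed

lemma presentsI:
  assumes "submod A" "submod B" "B \<subseteq> A" "carrier Y = \<pi> ` A" "\<zero>\<^bsub>Y\<^esub> = \<pi> 0"
    "\<And>a b. \<lbrakk>a \<in> A; b \<in> A\<rbrakk> \<Longrightarrow> \<pi> (a + b) = \<pi> a \<oplus>\<^bsub>Y\<^esub> \<pi> b"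
    "\<And>a s. \<lbrakk>a \<in> A; s \<in> carrier S\<rbrakk> \<Longrightarrow> \<pi> (opr a s) = \<pi> a \<cdot>\<^bsub>Y\<^esub> s"
    "\<And>a b. \<lbrakk>a \<in> A; b \<in> A\<rbrakk> \<Longrightarrow> \<pi> a = \<pi> b \<longleftrightarrow> a - b \<in> B"
  shows "presents A B Y \<pi>"
  using assms unfolding presents_def by blast

lemma presents_restrict:
  assumes P: "presents A B Y \<pi>" and C: "submod C" "B \<subseteq> C" "C \<subseteq> A"
  shows "presents C B (Y\<lparr>carrier := \<pi> ` C\<rparr>) \<pi>"
  using presentsD[OF P] C by (intro presentsI) (auto simp: subset_iff)

text \<open>An element of the quotient is a set of elements of \<open>Y\<close>, namely the image
  under \<open>\<pi>\<close> of a coset \<open>v + D\<close>; this dictates the presenting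
  map.\<close>

lemma presents_quot:
  assumes P: "presents A B Y \<pi>" and C: "submod C" "C \<subseteq> A" and D: "submod D" "B \<subseteq> D" "D \<subseteq> C"
  shows "presents C D (quot (Y\<lparr>carrier := \<pi> ` C\<rparr>) (\<pi> ` D)) (\<lambda>v. \<pi> ` {w. w - v \<in> D})"
proof -
  note PD = presentsD[OF P]
  note sD = submodD(3)[OF D(1)]
  let ?Y = "Y\<lparr>carrier := \<pi> ` C\<rparr>" 
  define \<kappa> where "\<kappa> v = \<pi> ` {w. w - v \<in> D}" for v
  have DA: "D \<subseteq> A" using C D by blast
  have cosA: "w \<in> A" if "w - v \<in> D" "v \<in> A" for v w
    using vs.subspace_add[OF submodD(3)[OF PD(1)], of "w - v" v] that DA by auto
  have coset: "\<pi> ` D +>\<^bsub>?Y\<^esub> \<pi> v = \<kappa> v" if v: "v \<in> A" for v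
  proof -
    have "\<pi> ` D +>\<^bsub>?Y\<^esub> \<pi> v = {\<pi> d \<oplus>\<^bsub>Y\<^esub> \<pi> v |d. d \<in> D}" unfolding a_r_coset_def' by auto
    also have "\<dots> = (\<lambda>d. \<pi> d \<oplus>\<^bsub>Y\<^esub> \<pi> v) ` D" by blast
    also have "\<dots> = (\<lambda>d. \<pi> (d + v)) ` D" using PD(6) v DA by (intro image_cong) auto
    also have "\<dots> = \<pi> ` ((\<lambda>d. d + v) ` D)" by (simp add: image_image)
    also have "(\<lambda>d. d + v) ` D = {w. w - v \<in> D}"
      by (auto simp: image_iff intro!: bexI[of _ "_ - v"])
    finally show ?thesis unfolding \<kappa>_def .
  qed
  have \<kappa>_cong: "\<kappa> v = \<kappa> w" if "v - w \<in> D" for v w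
  proof -
    have "u - v \<in> D \<longleftrightarrow> u - w \<in> D" for u
      using vs.subspace_add[OF sD, of "u - v" "v - w"] vs.subspace_diff[OF sD, of "u - w" "v - w"] that
      by auto
    then show ?thesis unfolding \<kappa>_def by simp
  qed
  have "presents C D (quot ?Y (\<pi> ` D)) \<kappa>"
  proof (rule presentsI)
    show "carrier (quot ?Y (\<pi> ` D)) = \<kappa> ` C"
    proof -
      have "carrier (quot ?Y (\<pi> ` D)) = (\<lambda>a. \<pi> ` D +>\<^bsub>?Y\<^esub> a) ` (\<pi> ` C)"
        unfolding quot_def A_RCOSETS_def' by auto
      also have "\<dots> = (\<lambda>v. \<pi> ` D +>\<^bsub>?Y\<^esub> \<pi> v) ` C" by (simp add: image_image)
      also have "\<dots> = \<kappa> ` C" using C(2) coset by (intro image_cong) auto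
      finally show ?thesis .
    qed
    show "\<zero>\<^bsub>quot ?Y (\<pi> ` D)\<^esub> = \<kappa> 0" by (simp add: quot_def \<kappa>_def)
    fix v assume v: "v \<in> C"
    then have vA: "v \<in> A" using C by auto
    {
      fix w assume w: "w \<in> C"
      then have wA: "w \<in> A" using C by auto
      show "\<kappa> (v + w) = \<kappa> v \<oplus>\<^bsub>quot ?Y (\<pi> ` D)\<^esub> \<kappa> w"
      proof -
        have "\<kappa> v \<oplus>\<^bsub>quot ?Y (\<pi> ` D)\<^esub> \<kappa> w = (\<Union>h\<in>\<kappa> v. \<Union>k\<in>\<kappa> w. {h \<oplus>\<^bsub>Y\<^esub> k})"
          by (simp add: quot_def set_add_def')
        also have "\<dots> = \<kappa> (v + w)"
        proof (intro equalityI subsetI)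
          fix x assume "x \<in> (\<Union>h\<in>\<kappa> v. \<Union>k\<in>\<kappa> w. {h \<oplus>\<^bsub>Y\<^esub> k})"
          then obtain u u' where u: "u - v \<in> D" "u' - w \<in> D" "x = \<pi> u \<oplus>\<^bsub>Y\<^esub> \<pi> u'" unfolding \<kappa>_def by auto
          then have "x = \<pi> (u + u')" using PD(6)[OF cosA[OF u(1) vA] cosA[OF u(2) wA]] by simp
          moreover have "u + u' - (v + w) \<in> D" using vs.subspace_add[OF sD u(1,2)] by (simp add: algebra_simps)
          ultimately show "x \<in> \<kappa> (v + w)" unfolding \<kappa>_def by blast
        next
          fix x assume "x \<in> \<kappa> (v + w)"
          then obtain u where u: "u - (v + w) \<in> D" "x = \<pi> u" unfolding \<kappa>_def by auto
          have uv: "(u - w) - v \<in> D" using u(1) by (simp add: algebra_simps)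
          have "x = \<pi> (u - w) \<oplus>\<^bsub>Y\<^esub> \<pi> w" using PD(6)[OF cosA[OF uv vA] wA] u(2) by simp
          moreover have "\<pi> (u - w) \<in> \<kappa> v" using uv unfolding \<kappa>_def by blast
          moreover have "\<pi> w \<in> \<kappa> w" using vs.subspace_0[OF sD] unfolding \<kappa>_def by auto
          ultimately show "x \<in> (\<Union>h\<in>\<kappa> v. \<Union>k\<in>\<kappa> w. {h \<oplus>\<^bsub>Y\<^esub> k})" by blast
        qed
        finally show ?thesis by simp
      qed
      show "\<kappa> v = \<kappa> w \<longleftrightarrow> v - w \<in> D"
      proof
        assume eq: "\<kappa> v = \<kappa> w"
        have "\<pi> v \<in> \<kappa> v" using vs.subspace_0[OF sD] unfolding \<kappa>_def by auto
        then obtain u where u: "u - w \<in> D" "\<pi> v = \<pi> u" unfolding eq unfolding \<kappa>_def by auto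
        then have "v - u \<in> D" using PD(8)[OF vA cosA[OF u(1) wA]] D(2) by auto
        then show "v - w \<in> D" using vs.subspace_add[OF sD _ u(1)] by fastforce
      qed (rule \<kappa>_cong)
    }
    fix s assume s: "s \<in> carrier S"
    show "\<kappa> (opr v s) = \<kappa> v \<cdot>\<^bsub>quot ?Y (\<pi> ` D)\<^esub> s"
    proof -
      \<comment> \<open>The quotient acts by a union over representatives. All its members are the
        same coset and the index set contains \<open>v\<close>, so the union is that coset.\<close>
      have "\<kappa> v \<cdot>\<^bsub>quot ?Y (\<pi> ` D)\<^esub> s = (\<Union>x\<in>\<kappa> v. \<pi> ` D +>\<^bsub>?Y\<^esub> (x \<cdot>\<^bsub>Y\<^esub> s))"
        by (simp add: quot_def)
      also have "\<dots> = (\<Union>u\<in>{u. u - v \<in> D}. \<pi> ` D +>\<^bsub>?Y\<^esub> (\<pi> u \<cdot>\<^bsub>Y\<^esub> s))" unfolding \<kappa>_def by simp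
      also have "\<dots> = (\<Union>u\<in>{u. u - v \<in> D}. \<kappa> (opr v s))"
      proof (rule SUP_cong[OF refl])
        fix u assume "u \<in> {u. u - v \<in> D}"
        then have u: "u - v \<in> D" by simp
        note uA = cosA[OF u vA]
        have "\<pi> ` D +>\<^bsub>?Y\<^esub> (\<pi> u \<cdot>\<^bsub>Y\<^esub> s) = \<kappa> (opr u s)"
          unfolding PD(7)[OF uA s, symmetric] by (rule coset[OF submodD(4)[OF PD(1) uA s]])
        also have "\<dots> = \<kappa> (opr v s)"
          using submodD(4)[OF D(1) u s] opr_diff[OF s] by (intro \<kappa>_cong) simp
        finally show "\<pi> ` D +>\<^bsub>?Y\<^esub> (\<pi> u \<cdot>\<^bsub>Y\<^esub> s) = \<kappa> (opr v s)" .
      qed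
      also have "\<dots> = \<kappa> (opr v s)" 
      proof -
        have "v \<in> {u. u - v \<in> D}" using vs.subspace_0[OF sD] by simp
        then show ?thesis by blast
      qed
      finally show ?thesis by simp
    qed
  qed (use C D in auto)
  then show ?thesis unfolding \<kappa>_def .
qed

lemma submod_preimage:
  assumes P: "presents A B Y \<pi>" and N: "is_submodule S N Y"
  shows "submod {a \<in> A. \<pi> a \<in> N}" "B \<subseteq> {a \<in> A. \<pi> a \<in> N}" "\<pi> ` {a \<in> A. \<pi> a \<in> N} = N"
proof -
  note PD = presentsD[OF P]
  interpret N: additive_subgroup N Y using N by (simp add: is_submodule_def)
  have act: "n \<cdot>\<^bsub>Y\<^esub> r \<in> N" if "n \<in> N" "r \<in> carrier S" for n r
    using N that by (simp add: is_submodule_def)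
  have 0: "\<pi> b = \<zero>\<^bsub>Y\<^esub>" if "b \<in> B" for b
    using PD(8)[of b 0] that PD(3) vs.subspace_0[OF submodD(3)[OF PD(1)]] by (auto simp: PD(5))
  show B: "B \<subseteq> {a \<in> A. \<pi> a \<in> N}" using 0 PD(3) by auto
  note sA = submodD(3)[OF PD(1)]
  have "vs.subspace {a \<in> A. \<pi> a \<in> N}"
    using vs.subspace_0[OF sA] vs.subspace_add[OF sA] vs.subspace_scale[OF sA]
    by (intro vs.subspaceI) (auto simp: PD(5)[symmetric] PD(6) presents_scale[OF P] intro!: act)
  then show "submod {a \<in> A. \<pi> a \<in> N}"
    using B submodD[OF PD(1)] submodD[OF PD(2)] PD(7) act unfolding submod_def by auto
  show "\<pi> ` {a \<in> A. \<pi> a \<in> N} = N" using N.a_subset PD(4) by auto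
qed

lemma is_submodule_image:
  assumes P: "presents A B Y \<pi>" and C: "submod C" "C \<subseteq> A"
  shows "is_submodule S (\<pi> ` C) Y"
proof -
  note PD = presentsD[OF P]
  note sC = submodD(3)[OF C(1)]
  interpret Y: right_module S Y using presents_right_module[OF P] .
  have inv: "\<ominus>\<^bsub>Y\<^esub> \<pi> a = \<pi> (- a)" if "a \<in> C" for a
  proof -
    have "a \<in> A" "- a \<in> A" "0 \<in> A" using that C vs.subspace_neg[OF sC that] vs.subspace_0[OF sC] by auto
    moreover from this have "\<pi> (- a) \<oplus>\<^bsub>Y\<^esub> \<pi> a = \<zero>\<^bsub>Y\<^esub>" using PD(6)[of "- a" a] PD(5) by simp
    ultimately show ?thesis using Y.Mod.minus_equality[of "\<pi> (- a)" "\<pi> a"] unfolding PD(4) by simp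
  qed
  have "subgroup (\<pi> ` C) (add_monoid Y)"
  proof (rule subgroup.intro)
    fix x y assume "x \<in> \<pi> ` C" "y \<in> \<pi> ` C"
    then obtain a b where ab: "a \<in> C" "b \<in> C" "x = \<pi> a" "y = \<pi> b" by auto
    then have "x \<oplus>\<^bsub>Y\<^esub> y = \<pi> (a + b)" using PD(6)[OF subsetD[OF C(2) ab(1)] subsetD[OF C(2) ab(2)]] by simp
    then show "x \<otimes>\<^bsub>add_monoid Y\<^esub> y \<in> \<pi> ` C" using vs.subspace_add[OF sC ab(1,2)] by simp
  next
    fix x assume "x \<in> \<pi> ` C"
    then obtain a where a: "a \<in> C" "x = \<pi> a" by auto
    show "inv\<^bsub>add_monoid Y\<^esub> x \<in> \<pi> ` C" using inv[OF a(1)] a vs.subspace_neg[OF sC a(1)]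
      by (simp add: a_inv_def)
  qed (use PD(4,5) C vs.subspace_0[OF sC] in auto)
  moreover have "n \<cdot>\<^bsub>Y\<^esub> r \<in> \<pi> ` C" if "n \<in> \<pi> ` C" "r \<in> carrier S" for n r
  proof -
    obtain a where a: "a \<in> C" "n = \<pi> a" using \<open>n \<in> \<pi> ` C\<close> by auto
    then show ?thesis using PD(7)[of a r] C(2) \<open>r \<in> carrier S\<close> submodD(4)[OF C(1) a(1), of r] by force
  qed
  ultimately show ?thesis unfolding is_submodule_def using additive_subgroupI by blast
qed

definition fin_gen :: "'v set \<Rightarrow> 'v set \<Rightarrow> bool" where
  "fin_gen A B \<longleftrightarrow> (\<exists>W. finite W \<and> W \<subseteq> A \<and> (\<forall>C. submod C \<and> B \<subseteq> C \<and> W \<subseteq> C \<longrightarrow> A \<subseteq> C))"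

lemma fin_gen_mono: "\<lbrakk>fin_gen A B; B \<subseteq> B'\<rbrakk> \<Longrightarrow> fin_gen A B'"
  unfolding fin_gen_def by (meson order_trans)

lemma finitely_generated_presents:
  assumes P: "presents A B Y \<pi>" and fg: "fin_gen A B"
  shows "finitely_generated S Y"
proof -
  note PD = presentsD[OF P]
  obtain W where W: "finite W" "W \<subseteq> A" "\<And>C. \<lbrakk>submod C; B \<subseteq> C; W \<subseteq> C\<rbrakk> \<Longrightarrow> A \<subseteq> C"
    using fg unfolding fin_gen_def by auto
  have "N = carrier Y" if N: "is_submodule S N Y" "\<pi> ` W \<subseteq> N" for N
  proof -
    have "A \<subseteq> {a \<in> A. \<pi> a \<in> N}"
      using W(2) N(2) by (intro W(3) submod_preimage(1,2)[OF P N(1)]) auto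
    then have "{a \<in> A. \<pi> a \<in> N} = A" by blast
    then show ?thesis using submod_preimage(3)[OF P N(1)] PD(4) by simp
  qed
  then show ?thesis unfolding finitely_generated_def using W(1,2) PD(4)
    by (intro exI[of _ "\<pi> ` W"]) (auto simp: image_mono)
qed

text \<open>
  The hypotheses on exactness and partitivity only concern modules carried by lists of algebra
  elements; an element of \<open>A/B\<close> is coded by coefficients with respect to finitely many generators.
\<close>

lemma list_code:
  assumes A: "submod A" and B: "submod B" "B \<subseteq> A" and fg: "fin_gen A B"
  obtains c :: "'v \<Rightarrow> 's list" where "\<And>a b. \<lbrakk>a \<in> A; b \<in> A\<rbrakk> \<Longrightarrow> c a = c b \<longleftrightarrow> a - b \<in> B"
proof -
  note sB = submodD(3)[OF B(1)]
  note sA = submodD(3)[OF A]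
  obtain W where W: "finite W" "W \<subseteq> A" "\<And>C. \<lbrakk>submod C; B \<subseteq> C; W \<subseteq> C\<rbrakk> \<Longrightarrow> A \<subseteq> C"
    using fg unfolding fin_gen_def by auto
  obtain ws where ws: "set ws = W" using finite_list[OF W(1)] by auto
  define n where "n = length ws"
  have wsA: "ws ! i \<in> A" if "i < n" for i using ws W(2) that nth_mem unfolding n_def by blast
  then have wsT: "ws ! i \<in> T" if "i < n" for i using submodD(2)[OF A] that by auto
  define comb where "comb f = (\<Sum>i<n. opr (ws ! i) (f i))" for f
  define rep where "rep v ls \<longleftrightarrow> length ls = n \<and> set ls \<subseteq> carrier S \<and> v - comb (\<lambda>i. ls ! i) \<in> B" for v ls
  have combA: "comb f \<in> A" if "\<And>i. i < n \<Longrightarrow> f i \<in> carrier S" for f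
    unfolding comb_def using that wsA by (auto intro!: vs.subspace_sum[OF sA] submodD(4)[OF A])
  have repI: "\<exists>ls. rep v ls" if "\<And>i. i < n \<Longrightarrow> f i \<in> carrier S" "v - comb f \<in> B" for v f
  proof -
    have "rep v (map f [0..<n])" unfolding rep_def using that by (auto simp: comb_def)
    then show ?thesis ..
  qed
  have repE: "\<exists>f. (\<forall>i<n. f i \<in> carrier S) \<and> v - comb f \<in> B" if "rep v ls" for v ls
    using that unfolding rep_def by (intro exI[of _ "\<lambda>i. ls ! i"]) auto
  \<comment> \<open>Elements that admit a code form a submodule containing \<open>B\<close> and the
    generators, hence all of \<open>A\<close>; no expansion of a given element has to be
    constructed.\<close>
  define C where "C = {v \<in> A. \<exists>ls. rep v ls}"
  have B0: "B \<subseteq> C"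
  proof
    fix b assume b: "b \<in> B"
    have "comb (\<lambda>i. \<zero>\<^bsub>S\<^esub>) \<in> B" unfolding comb_def
    proof (rule vs.subspace_sum[OF sB])
      fix i assume i: "i \<in> {..<n}"
      show "opr (ws ! i) \<zero>\<^bsub>S\<^esub> \<in> B" using i opr_zero_right[OF wsT] submodD(1)[OF B(1)] by auto
    qed
    then have "b - comb (\<lambda>i. \<zero>\<^bsub>S\<^esub>) \<in> B" using vs.subspace_diff[OF sB b] by auto
    then show "b \<in> C" unfolding C_def using b B(2) by (auto intro: repI[of "\<lambda>i. \<zero>\<^bsub>S\<^esub>"])
  qed
  have "submod C" unfolding submod_def
  proof (intro conjI ballI)
    show "Z \<subseteq> C" using B0 submodD(1)[OF B(1)] by auto
    show "C \<subseteq> T" using submodD(2)[OF A] by (auto simp: C_def)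
    have opC: "opr v s \<in> C" if v: "v \<in> C" and s: "s \<in> carrier S" for v s
    proof -
      obtain f where f: "\<forall>i<n. f i \<in> carrier S" "v - comb f \<in> B" using v repE unfolding C_def by blast
      have "opr (v - comb f) s \<in> B" using submodD(4)[OF B(1) f(2) s] .
      moreover have "opr (comb f) s = (\<Sum>i<n. opr (opr (ws ! i) (f i)) s)" unfolding comb_def by (rule opr_sum[OF s])
      ultimately have 1: "opr v s - (\<Sum>i<n. opr (opr (ws ! i) (f i)) s) \<in> B" by (simp add: opr_diff[OF s])
      have "(\<Sum>i<n. opr (ws ! i) (f i \<otimes>\<^bsub>S\<^esub> s) - opr (opr (ws ! i) (f i)) s) \<in> B"
        using f(1) s submodD(1)[OF B(1)] by (intro vs.subspace_sum[OF sB] subsetD[OF submodD(1)[OF B(1)]] opr_mult wsT) auto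
      then have "(\<Sum>i<n. opr (ws ! i) (f i \<otimes>\<^bsub>S\<^esub> s)) - (\<Sum>i<n. opr (opr (ws ! i) (f i)) s) \<in> B"
        by (simp add: sum_subtractf)
      from vs.subspace_diff[OF sB 1 this] have "opr v s - comb (\<lambda>i. f i \<otimes>\<^bsub>S\<^esub> s) \<in> B"
        by (simp add: comb_def)
      then have "\<exists>ls. rep (opr v s) ls" using f(1) s by (intro repI[of "\<lambda>i. f i \<otimes>\<^bsub>S\<^esub> s"]) auto
      then show ?thesis using v submodD(4)[OF A _ s] by (auto simp: C_def)
    qed
    then show "opr v s \<in> C" if "v \<in> C" "s \<in> carrier S" for v s using that by auto
    show "vs.subspace C"
    proof (rule vs.subspaceI)
      show "0 \<in> C" using B0 vs.subspace_0[OF sB] by auto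
    next
      fix v w assume v: "v \<in> C" and w: "w \<in> C"
      obtain f where f: "\<forall>i<n. f i \<in> carrier S" "v - comb f \<in> B" using v repE unfolding C_def by blast
      obtain g where g: "\<forall>i<n. g i \<in> carrier S" "w - comb g \<in> B" using w repE unfolding C_def by blast
      have "(\<Sum>i<n. opr (ws ! i) (f i \<oplus>\<^bsub>S\<^esub> g i) - (opr (ws ! i) (f i) + opr (ws ! i) (g i))) \<in> B"
        using f(1) g(1) by (intro vs.subspace_sum[OF sB] subsetD[OF submodD(1)[OF B(1)]] opr_add_right wsT) auto
      then have "comb (\<lambda>i. f i \<oplus>\<^bsub>S\<^esub> g i) - (comb f + comb g) \<in> B"
        by (simp add: sum_subtractf comb_def sum.distrib)
      from vs.subspace_diff[OF sB vs.subspace_add[OF sB f(2) g(2)] this]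
      have "v + w - comb (\<lambda>i. f i \<oplus>\<^bsub>S\<^esub> g i) \<in> B" by (simp add: algebra_simps)
      then have "\<exists>ls. rep (v + w) ls" using f(1) g(1) by (intro repI[of "\<lambda>i. f i \<oplus>\<^bsub>S\<^esub> g i"]) auto
      then show "v + w \<in> C" using v w vs.subspace_add[OF sA] by (auto simp: C_def)
    next
      fix c v assume v: "v \<in> C"
      \<comment> \<open>Scalar multiples reduce to the action of \<open>c 1\<close>, for which
        closure is already known.\<close>
      have "opr v (c \<odot>\<^bsub>S\<^esub> \<one>\<^bsub>S\<^esub>) \<in> C" by (rule opC[OF v]) simp
      then obtain f where f: "\<forall>i<n. f i \<in> carrier S" "opr v (c \<odot>\<^bsub>S\<^esub> \<one>\<^bsub>S\<^esub>) - comb f \<in> B"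
        using repE unfolding C_def by blast
      have "opr v (c \<odot>\<^bsub>S\<^esub> \<one>\<^bsub>S\<^esub>) - scale c v \<in> B"
        using opr_smult_one[of v c] v submodD(2)[OF A] submodD(1)[OF B(1)] by (auto simp: C_def)
      from vs.subspace_diff[OF sB f(2) this] have "scale c v - comb f \<in> B" by simp
      then have "\<exists>ls. rep (scale c v) ls" using f(1) by (intro repI[of f]) auto
      then show "scale c v \<in> C" using v vs.subspace_scale[OF sA] by (auto simp: C_def)
    qed
  qed
  moreover note B0
  moreover have "W \<subseteq> C"
  proof
    fix w assume w: "w \<in> W"
    then obtain j where j: "j < n" "w = ws ! j" using ws unfolding n_def by (metis in_set_conv_nth)
    let ?f = "\<lambda>i. if i = j then \<one>\<^bsub>S\<^esub> else \<zero>\<^bsub>S\<^esub>"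
    have "(\<Sum>i<n. opr (ws ! i) (?f i) - (if i = j then w else 0)) \<in> B"
    proof (rule vs.subspace_sum[OF sB], rule subsetD[OF submodD(1)[OF B(1)]])
      fix i assume i: "i \<in> {..<n}"
      have "opr (ws ! i) \<zero>\<^bsub>S\<^esub> \<in> Z" using i by (intro opr_zero_right wsT) auto
      then show "opr (ws ! i) (?f i) - (if i = j then w else 0) \<in> Z"
        using opr_one[of w] wsT[OF j(1)] j(2) by auto
    qed
    then have "comb ?f - w \<in> B" using j(1) by (simp add: sum_subtractf comb_def sum.delta)
    then have "w - comb ?f \<in> B" using vs.subspace_neg[OF sB] by fastforce
    then have "\<exists>ls. rep w ls" by (intro repI[of ?f]) auto
    then show "w \<in> C" using w W(2) by (auto simp: C_def)
  qed
  ultimately have AC: "A \<subseteq> C" by (rule W(3))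
  \<comment> \<open>The choice depends on \<open>v\<close> only through the predicate
    \<open>rep v\<close>, which is the same for elements congruent modulo \<open>B\<close>; hence
    congruent elements receive the same code.\<close>
  define c where "c v = (SOME ls. rep v ls)" for v
  have c: "rep v (c v)" if "v \<in> A" for v
    unfolding c_def using that AC by (intro someI_ex[of "rep v"]) (auto simp: C_def)
  show thesis
  proof (rule that[of c])
    fix a b assume ab: "a \<in> A" "b \<in> A"
    show "c a = c b \<longleftrightarrow> a - b \<in> B"
    proof
      assume "c a = c b"
      then have "a - comb (\<lambda>i. c a ! i) \<in> B" "b - comb (\<lambda>i. c a ! i) \<in> B"
        using c[OF ab(1)] c[OF ab(2)] unfolding rep_def by auto
      from vs.subspace_diff[OF sB this] show "a - b \<in> B" by simp
    next
      assume d: "a - b \<in> B"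
      have "rep a ls = rep b ls" for ls
        unfolding rep_def using vs.subspace_add[OF sB d, of "b - comb ((!) ls)"]
          vs.subspace_diff[OF sB _ d, of "a - comb ((!) ls)"] by auto
      then have "rep a = rep b" by auto
      then show "c a = c b" unfolding c_def by simp
    qed
  qed
qed

text \<open>The operations are transported along an arbitrary preimage under \<open>c\<close>. They
  are compatible with \<open>c\<close> because the fibres of \<open>c\<close> on \<open>A\<close>
  are cosets of a submodule.\<close>

definition coded :: "('v \<Rightarrow> 'y) \<Rightarrow> 'v set \<Rightarrow> ('s, 'y) rmod" where
  "coded c A = \<lparr>carrier = c ` A, mult = undefined, one = undefined, zero = c 0,
     add = (\<lambda>p q. c (inv_into A c p + inv_into A c q)), act = (\<lambda>p s. c (opr (inv_into A c p) s))\<rparr>"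

lemma presents_coded:
  assumes A: "submod A" and B: "submod B" "B \<subseteq> A"
    and c: "\<And>a b. \<lbrakk>a \<in> A; b \<in> A\<rbrakk> \<Longrightarrow> c a = c b \<longleftrightarrow> a - b \<in> B"
  shows "presents A B (coded c A) c"
proof -
  note sB = submodD(3)[OF B(1)]
  note sA = submodD(3)[OF A]
  have d: "inv_into A c (c a) \<in> A" "inv_into A c (c a) - a \<in> B" if "a \<in> A" for a
  proof -
    show "inv_into A c (c a) \<in> A" using that by (simp add: inv_into_into)
    then show "inv_into A c (c a) - a \<in> B" using c[of "inv_into A c (c a)" a] that
      by (simp add: f_inv_into_f)
  qed
  show ?thesis
  proof (rule presentsI[OF A B])
    fix a assume a: "a \<in> A"
    show "c (a + b) = c a \<oplus>\<^bsub>coded c A\<^esub> c b" if b: "b \<in> A" for b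
    proof -
      have "(a + b) - (inv_into A c (c a) + inv_into A c (c b)) \<in> B"
        using vs.subspace_neg[OF sB vs.subspace_add[OF sB d(2)[OF a] d(2)[OF b]]] by (simp add: algebra_simps)
      then show ?thesis using c[of "a + b" "inv_into A c (c a) + inv_into A c (c b)"] a b d
        by (simp add: coded_def vs.subspace_add[OF sA])
    qed
    show "c (opr a s) = c a \<cdot>\<^bsub>coded c A\<^esub> s" if s: "s \<in> carrier S" for s
    proof -
      have "opr (inv_into A c (c a) - a) s \<in> B" using submodD(4)[OF B(1) d(2)[OF a] s] .
      then have "- opr (inv_into A c (c a) - a) s \<in> B" by (rule vs.subspace_neg[OF sB])
      then have "opr a s - opr (inv_into A c (c a)) s \<in> B" by (simp add: opr_diff[OF s])
      then show ?thesis using c[of "opr a s" "opr (inv_into A c (c a)) s"] submodD(4)[OF A _ s] a d(1)[OF a]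
        by (simp add: coded_def)
    qed
  qed (auto simp: coded_def c)
qed

text \<open>Exactness is available only for modules carried by lists, hence the finite generation.
  \<open>B/C\<close> is realised inside the code of \<open>A/C\<close>, so the first map is the
  identity; the second decodes with respect to \<open>C\<close> and recodes with respect to
  \<open>B\<close>.\<close>

lemma gkr_exact_fin_gen:
  assumes ex: "gk_exact S" and A: "submod A" and B: "submod B" "B \<subseteq> A" and C: "submod C" "C \<subseteq> B"
    and fg: "fin_gen A C"
  shows "gkr A C = max (gkr B C) (gkr A B)"
proof -
  have CA: "C \<subseteq> A" using B C by auto
  obtain c1 :: "'v \<Rightarrow> 's list" where c1: "\<And>a b. \<lbrakk>a \<in> A; b \<in> A\<rbrakk> \<Longrightarrow> c1 a = c1 b \<longleftrightarrow> a - b \<in> C"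
    using list_code[OF A C(1) CA fg] by blast
  obtain c2 :: "'v \<Rightarrow> 's list" where c2: "\<And>a b. \<lbrakk>a \<in> A; b \<in> A\<rbrakk> \<Longrightarrow> c2 a = c2 b \<longleftrightarrow> a - b \<in> B"
    using list_code[OF A B fin_gen_mono[OF fg C(2)]] by blast
  have P1: "presents A C (coded c1 A) c1" using c1 by (rule presents_coded[OF A C(1) CA])
  have P2: "presents A B (coded c2 A) c2" using c2 by (rule presents_coded[OF A B])
  note P3 = presents_restrict[OF P1 B(1) C(2) B(2)]
  let ?N = "coded c1 A" and ?P = "coded c2 A" and ?M = "(coded c1 A)\<lparr>carrier := c1 ` B\<rparr>"
  let ?g = "\<lambda>p. c2 (inv_into A c1 p)"
  note D1 = presentsD[OF P1] and D2 = presentsD[OF P2]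
  have g: "?g (c1 a) = c2 a" if "a \<in> A" for a
  proof -
    have "inv_into A c1 (c1 a) \<in> A" using that by (simp add: inv_into_into)
    moreover from this have "inv_into A c1 (c1 a) - a \<in> C" using c1[of "inv_into A c1 (c1 a)" a] that
      by (simp add: f_inv_into_f)
    ultimately show ?thesis using c2[of "inv_into A c1 (c1 a)" a] that C(2) by auto
  qed
  note A_add = vs.subspace_add[OF submodD(3)[OF A]]
  have "short_exact S ?M ?N ?P (\<lambda>x. x) ?g" unfolding short_exact_def
  proof (intro conjI)
    show "right_module S ?M" "right_module S ?N" "right_module S ?P"
      using presents_right_module[OF P1] presents_right_module[OF P2] presents_right_module[OF P3] by auto
    show "(\<lambda>x. x) \<in> rmod_hom S ?M ?N" unfolding rmod_hom_def using B(2) D1(4) by auto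
    show "?g \<in> rmod_hom S ?N ?P" unfolding rmod_hom_def
    proof (intro CollectI conjI ballI)
      show "?g \<in> carrier ?N \<rightarrow> carrier ?P"
      proof (rule Pi_I)
        fix x assume "x \<in> carrier ?N"
        then obtain a where a: "a \<in> A" "x = c1 a" unfolding D1(4) by auto
        show "?g x \<in> carrier ?P" unfolding a(2) g[OF a(1)] D2(4) using a(1) by simp
      qed
      fix x assume "x \<in> carrier ?N"
      then obtain a where a: "a \<in> A" "x = c1 a" unfolding D1(4) by auto
      show "?g (x \<cdot>\<^bsub>?N\<^esub> r) = ?g x \<cdot>\<^bsub>?P\<^esub> r" if r: "r \<in> carrier S" for r
        unfolding a(2) D1(7)[OF a(1) r, symmetric] g[OF a(1)] g[OF submodD(4)[OF A a(1) r]]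
        by (rule D2(7)[OF a(1) r])
      fix y assume "y \<in> carrier ?N"
      then obtain b where b: "b \<in> A" "y = c1 b" unfolding D1(4) by auto
      show "?g (x \<oplus>\<^bsub>?N\<^esub> y) = ?g x \<oplus>\<^bsub>?P\<^esub> ?g y"
        unfolding a(2) b(2) D1(6)[OF a(1) b(1), symmetric] g[OF a(1)] g[OF b(1)] g[OF A_add[OF a(1) b(1)]]
        by (rule D2(6)[OF a(1) b(1)])
    qed
    show "inj_on (\<lambda>x. x) (carrier ?M)" by simp
    show "?g ` carrier ?N = carrier ?P" unfolding D1(4) D2(4) image_image
      by (rule image_cong) (auto simp: g)
    show "(\<lambda>x. x) ` carrier ?M = {x \<in> carrier ?N. ?g x = \<zero>\<^bsub>?P\<^esub>}" unfolding D1(4) D2(5)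
    proof (intro equalityI subsetI)
      fix x assume "x \<in> (\<lambda>x. x) ` carrier ?M"
      then obtain b where b: "b \<in> B" "x = c1 b" by auto
      then show "x \<in> {x \<in> c1 ` A. ?g x = c2 0}" 
        using g[of b] c2[of b 0] B(2) vs.subspace_0[OF submodD(3)[OF A]] by auto
    next
      fix x assume "x \<in> {x \<in> c1 ` A. ?g x = c2 0}"
      then obtain a where a: "a \<in> A" "x = c1 a" "?g (c1 a) = c2 0" by auto
      then have "a \<in> B" using g[OF a(1)] c2[of a 0] vs.subspace_0[OF submodD(3)[OF A]] by auto
      then show "x \<in> (\<lambda>x. x) ` carrier ?M" using a(2) by auto
    qed
  qed
  then have "gkdim S ?N = max (gkdim S ?M) (gkdim S ?P)" using ex unfolding gk_exact_def by blast
  then show ?thesis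
    by (simp add: gkdim_presents[OF P1] gkdim_presents[OF P2] gkdim_presents[OF P3])
qed

end

section \<open>Exactness and chains\<close>

lemma finite_subset_UN_mono:
  fixes F :: "nat \<Rightarrow> 'a set"
  assumes F: "mono F" and "finite X" "X \<subseteq> (\<Union>i. F i)"
  shows "\<exists>i. X \<subseteq> F i"
  using assms(2,3)
proof (induction X rule: finite_induct)
  case (insert x X)
  then obtain i j where "X \<subseteq> F i" "x \<in> F j" by auto
  then have "insert x X \<subseteq> F (max i j)"
    using monoD[OF F, of i "max i j"] monoD[OF F, of j "max i j"] by auto
  then show ?case ..
qed auto

context gk_space
begin

lemma self_pair: "gk_pair S scale opr T Z scale opr T Z"
  by (intro gk_pair.intro gk_space_axioms)

lemma hom_on_id: "gk_pair.hom_on S scale opr scale opr A (\<lambda>x. x)"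
  unfolding gk_pair.hom_on_def[OF self_pair] by auto

text \<open>The identity embeds \<open>A/(A \<inter> B')\<close> into \<open>A'/B'\<close>, and
  \<open>A/B\<close> is a quotient of the former.\<close>

lemma gkr_le_sub:
  assumes "submod A" "submod B" "submod A'" "submod B'" "A \<subseteq> A'" "A \<inter> B' \<subseteq> B"
  shows "gkr A B \<le> gkr A' B'"
  by (rule gk_pair.gkr_le_inj[OF self_pair hom_on_id]) (use assms in auto)

lemma gkr_le_quot:
  assumes "submod A" "submod B" "submod A'" "submod B'" "B \<subseteq> A" "B \<subseteq> B'" "A' \<subseteq> plus_set A B'"
  shows "gkr A' B' \<le> gkr A B"
proof (rule gk_pair.gkr_le_surj[OF self_pair hom_on_id])
  fix a' assume "a' \<in> A'"
  then obtain a b where "a \<in> A" "b \<in> B'" "a' = a + b" using assms(7) unfolding plus_set_def by auto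
  then show "\<exists>a\<in>A. a' - a \<in> B'" by (intro bexI[of _ a]) auto
qed (use assms in auto)

lemma gens_mono: "W \<subseteq> W' \<Longrightarrow> gens W V n \<subseteq> gens W' V n"
  by (induction n) auto

lemma gkr1_mono:
  assumes "vs.subspace B" "W \<subseteq> W'" "finite W'" "finite V"
  shows "gkr1 B W V \<le> gkr1 B W' V"
proof (rule gkr1_mono_gen[OF gk_space_axioms gk_space_axioms])
  fix n
  note g = gens_mono[OF assms(2), of V n]
  obtain I where I: "I \<subseteq> gens W' V n" "card I = vs.rank_mod B (gens W' V n)" "gens W' V n \<subseteq> vs.span_mod B I"
    using vs.rank_mod_basis[OF assms(1) finite_gens[OF assms(3,4)]] by metis
  have "vs.rank_mod B (gens W V n) \<le> card I"
    using I(1,3) g finite_gens[OF assms(3,4), of n]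
    by (intro vs.rank_mod_le[OF assms(1)]) (auto intro: finite_subset)
  then show "vs.rank_mod B (gens W V n) \<le> vs.rank_mod B (gens W' V n)" using I(2) by simp
qed

lemma submod_Inter: 
  assumes "\<And>X. X \<in> F \<Longrightarrow> submod X" "F \<noteq> {}"
  shows "submod (\<Inter>F)"
  using assms submodD unfolding submod_def
  by (auto intro!: vs.subspace_Inter) blast+

definition gen :: "'v set \<Rightarrow> 'v set \<Rightarrow> 'v set" where
  "gen W B = \<Inter>{X. submod X \<and> B \<subseteq> X \<and> W \<subseteq> X}"

lemma gen:
  assumes "submod B" "W \<subseteq> T"
  shows "submod (gen W B)" "B \<subseteq> gen W B" "W \<subseteq> gen W B"
  using assms submod_T submodD(2)[OF assms(1)] unfolding gen_def
  by (auto intro!: submod_Inter)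

lemma gen_minimal: "\<lbrakk>submod X; B \<subseteq> X; W \<subseteq> X\<rbrakk> \<Longrightarrow> gen W B \<subseteq> X"
  unfolding gen_def by auto

lemma fin_gen_gen:
  assumes "submod B" "W \<subseteq> T" "finite W"
  shows "fin_gen (gen W B) B"
  unfolding fin_gen_def using gen[OF assms(1,2)] assms(3) gen_minimal by (intro exI[of _ W]) auto

text \<open>Finite generation is removed because the dimension of \<open>A/C\<close> is a supremum
  over finite sets \<open>W\<close>: each is treated inside the submodule generated by
  \<open>W\<close> and \<open>C\<close>. An element \<open>a\<close> outside \<open>C\<close> is
  adjoined to \<open>W\<close> so that this submodule is not trivial modulo
  \<open>C\<close>.\<close>

lemma gkr_exact:
  assumes ex: "gk_exact S" and A: "submod A" and B: "submod B" "B \<subseteq> A" and C: "submod C" "C \<subseteq> B"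
  shows "gkr A C \<le> max (gkr B C) (gkr A B)"
proof (cases "A \<subseteq> C")
  case True then show ?thesis by (simp add: gkr_eq gkr_ge le_max_iff_disj)
next
  case False
  then obtain a where a: "a \<in> A" "a \<notin> C" by auto
  show ?thesis
  proof (rule gkr_leI[OF False])
    fix W V assume W: "finite W" "W \<subseteq> A" and V: "finite V" "V \<subseteq> carrier S"
    let ?W = "insert a W"
    have WA: "?W \<subseteq> A" using a W by auto
    then have WT: "?W \<subseteq> T" using submodD(2)[OF A] by auto
    note G = gen[OF C(1) WT]
    let ?A = "gen ?W C"
    have AA: "?A \<subseteq> A" using B C WA by (intro gen_minimal[OF A]) auto
    have GB: "submod (?A \<inter> B)" using submod_inter[OF G(1) B(1)] .
    have "gkr1 C W V \<le> gkr1 C ?W V" using W V submodD(3)[OF C(1)] by (intro gkr1_mono) auto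
    also have "\<dots> \<le> gkr ?A C" using a W V G by (intro gkr1_le_gkr) auto
    also have "\<dots> = max (gkr (?A \<inter> B) C) (gkr ?A (?A \<inter> B))"
      using G C W by (intro gkr_exact_fin_gen[OF ex G(1) GB _ C(1)] fin_gen_gen[OF C(1) WT]) auto
    also have "\<dots> \<le> max (gkr B C) (gkr A B)"
    proof (rule max.mono)
      show "gkr (?A \<inter> B) C \<le> gkr B C" using GB B C by (intro gkr_le_sub) auto
      show "gkr ?A (?A \<inter> B) \<le> gkr A B" using G GB A B AA by (intro gkr_le_sub) auto
    qed
    finally show "gkr1 C W V \<le> max (gkr B C) (gkr A B)" .
  qed
qed

text \<open>A finite subset of the union lies in a single \<open>F i\<close>. Adjoining some
  \<open>a\<close> outside \<open>B\<close> keeps that \<open>F i\<close> nontrivial modulo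
  \<open>B\<close>, away from the exceptional value \<open>-1\<close>.\<close>

lemma gkr_UN:
  fixes F :: "nat \<Rightarrow> 'v set"
  assumes F: "mono F" and B: "submod B" and e: "\<And>i. gkr (F i) B \<le> e"
  shows "gkr (\<Union>i. F i) B \<le> e"
proof (cases "(\<Union>i. F i) \<subseteq> B")
  case True then show ?thesis using gkr_ge[of "F 0" B] e[of 0] by (simp add: gkr_eq)
next
  case False
  then obtain a where a: "a \<in> (\<Union>i. F i)" "a \<notin> B" by blast
  show ?thesis
  proof (rule gkr_leI[OF False])
    fix W V assume W: "finite W" "W \<subseteq> (\<Union>i. F i)" and V: "finite V" "V \<subseteq> carrier S"
    have "finite (insert a W)" "insert a W \<subseteq> (\<Union>i. F i)" using W a by auto
    then have "\<exists>i. insert a W \<subseteq> F i" by (rule finite_subset_UN_mono[OF F])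
    then obtain i where i: "insert a W \<subseteq> F i" by blast
    then have "\<not> F i \<subseteq> B" using a by auto
    then have "gkr1 B W V \<le> gkr (F i) B" using i W V by (intro gkr1_le_gkr) auto
    then show "gkr1 B W V \<le> e" using e order_trans by blast
  qed
qed

text \<open>Partitivity bounds the lengths of chains in the coded module by some \<open>N\<close>,
  while the first \<open>Suc N\<close> steps of \<open>C\<close> form such a chain. Strict decrease
  is not assumed: if \<open>C (Suc i) = C i\<close>, the factor would have dimension
  \<open>-1\<close>.\<close>

lemma no_infinite_chain:
  assumes part: "gk_finitely_partitive S" and A: "submod A" and B: "submod B" "B \<subseteq> A" and fg: "fin_gen A B"
    and C: "\<And>i. submod (C i)" "\<And>i. B \<subseteq> C i" "C 0 = A" "\<And>i. C (Suc i) \<subseteq> C i"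
    and gk: "\<And>i. gkr (C i) (C (Suc i)) = gkr A B" and ne: "gkr A B \<noteq> -1"
  shows False
proof -
  obtain c :: "'v \<Rightarrow> 's list" where c: "\<And>a b. \<lbrakk>a \<in> A; b \<in> A\<rbrakk> \<Longrightarrow> c a = c b \<longleftrightarrow> a - b \<in> B"
    using list_code[OF A B fg] by blast
  have P: "presents A B (coded c A) c" using c by (rule presents_coded[OF A B])
  have CA: "C i \<subseteq> A" for i
    by (induction i) (use C(3,4) in auto)
  obtain N where N: "\<And>n D. gk_chain S (coded c A) n D \<Longrightarrow> n \<le> N"
    using part presents_right_module[OF P] finitely_generated_presents[OF P fg]
    unfolding gk_finitely_partitive_def by blast
  have "gk_chain S (coded c A) (Suc N) (\<lambda>i. c ` C i)" unfolding gk_chain_def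
  proof (intro conjI allI impI)
    show "c ` C 0 = carrier (coded c A)" using C(3) presentsD(4)[OF P] by simp
    fix i
    show "is_submodule S (c ` C i) (coded c A)" by (rule is_submodule_image[OF P C(1) CA])
    have "gkdim S (quot ((coded c A)\<lparr>carrier := c ` C i\<rparr>) (c ` C (Suc i))) = gkr (C i) (C (Suc i))"
      by (rule gkdim_presents[OF presents_quot[OF P C(1) CA C(1) C(2) C(4)]])
    then show "gkdim S (quot ((coded c A)\<lparr>carrier := c ` C i\<rparr>) (c ` C (Suc i))) = gkdim S (coded c A)"
      by (simp add: gk gkdim_presents[OF P])
    show "c ` C (Suc i) \<subset> c ` C i"
    proof (rule psubsetI)
      show "c ` C (Suc i) \<subseteq> c ` C i" using C(4) by (rule image_mono)
      show "c ` C (Suc i) \<noteq> c ` C i"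
      proof
        assume eq: "c ` C (Suc i) = c ` C i"
        have "C i \<subseteq> C (Suc i)"
        proof
          fix a assume a: "a \<in> C i"
          then have "c a \<in> c ` C (Suc i)" using eq by auto
          then obtain a' where a': "a' \<in> C (Suc i)" "c a = c a'" by auto
          then have "a - a' \<in> C (Suc i)" using c[of a a'] CA a C(2) by blast
          then show "a \<in> C (Suc i)" using vs.subspace_add[OF submodD(3)[OF C(1)] _ a'(1)] by force
        qed
        then show False using gk[of i] ne by (simp add: gkr_eq)
      qed
    qed
  qed
  from N[OF this] show False by simp
qed

end

section \<open>The tensor product with the rational function field\<close>

lemma poly_mapping_lin_induct [consumes 1, case_names zero single add]:
  fixes u :: "'a \<Rightarrow>\<^sub>0 'b::ab_group_add"
  assumes "Poly_Mapping.keys u \<subseteq> C" "P 0" "\<And>x c. x \<in> C \<Longrightarrow> P (Poly_Mapping.single x c)"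
    "\<And>a b. \<lbrakk>Poly_Mapping.keys a \<subseteq> C; Poly_Mapping.keys b \<subseteq> C; P a; P b\<rbrakk> \<Longrightarrow> P (a + b)"
  shows "P u"
proof -
  have "P u \<and> Poly_Mapping.keys u \<subseteq> C" if "finite K" "Poly_Mapping.keys u \<subseteq> K" "K \<subseteq> C" for K u
    using that
  proof (induction K arbitrary: u rule: finite_induct)
    case empty
    then have "u = 0" by (intro poly_mapping_eqI) (simp add: not_in_keys_iff_lookup_eq_zero[symmetric])
    then show ?case using assms by simp
  next
    case (insert k K)
    let ?v = "u - Poly_Mapping.single k (Poly_Mapping.lookup u k)"
    have "Poly_Mapping.keys ?v \<subseteq> K" using insert.prems(1)
      by (auto simp: in_keys_iff lookup_minus lookup_single when_def subset_iff split: if_splits)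
    then have v: "P ?v" "Poly_Mapping.keys ?v \<subseteq> C" using insert by auto
    have "P (Poly_Mapping.single k (Poly_Mapping.lookup u k))" using insert.prems assms(3) by auto
    then have "P (?v + Poly_Mapping.single k (Poly_Mapping.lookup u k))" using v insert.prems
      by (intro assms(4)) auto
    then show ?case using insert.prems by auto
  qed
  from this[OF _ order_refl assms(1)] show ?thesis by auto
qed

definition pscale :: "'k::field \<Rightarrow> ('a \<Rightarrow>\<^sub>0 'k) \<Rightarrow> ('a \<Rightarrow>\<^sub>0 'k)" where
  "pscale c v = Poly_Mapping.map ((*) c) v"

lemma lookup_pscale [simp]: "Poly_Mapping.lookup (pscale c v) x = c * Poly_Mapping.lookup v x"
  by (simp add: pscale_def Poly_Mapping.map.rep_eq when_def)

lemma pscale_single [simp]: "pscale c (Poly_Mapping.single x d) = Poly_Mapping.single x (c * d)"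
  by (simp add: pscale_def)

lemma keys_pscale: "Poly_Mapping.keys (pscale c v) \<subseteq> Poly_Mapping.keys v"
  by (auto simp: in_keys_iff)

interpretation pm: scalar_space pscale
  by unfold_locales (auto intro!: poly_mapping_eqI simp: lookup_add algebra_simps)

definition supported :: "'a set \<Rightarrow> ('a \<Rightarrow>\<^sub>0 'k::zero) set" where
  "supported C = {v. Poly_Mapping.keys v \<subseteq> C}"

lemma supported_single: "x \<in> C \<Longrightarrow> Poly_Mapping.single x c \<in> supported C"
  by (simp add: supported_def)

lemma subspace_supported: "pm.subspace (supported C :: ('a \<Rightarrow>\<^sub>0 'b::field) set)"
proof (rule pm.subspaceI)
  fix u v :: "'a \<Rightarrow>\<^sub>0 'b" and c
  assume u: "u \<in> supported C"
  show "pscale c u \<in> supported C" using u keys_pscale[of c u] by (auto simp: supported_def)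
  assume v: "v \<in> supported C"
  show "u + v \<in> supported C" using u v keys_add[of u v] by (auto simp: supported_def)
qed (simp add: supported_def)

lemma lin_ext_add: "lin_ext f (u + v) = lin_ext f u + lin_ext f v"
  unfolding lin_ext_def by (rule setsum_keys_plus_distrib) (simp_all add: single_add)

lemma lin_ext_0 [simp]: "lin_ext f 0 = 0"
  by (simp add: lin_ext_def)

lemma lin_ext_single [simp]: "lin_ext f (Poly_Mapping.single p c) = Poly_Mapping.single (f p) c"
  by (simp add: lin_ext_def)

lemma lin_ext_pscale: "lin_ext f (pscale c u) = pscale c (lin_ext f u)"
proof (rule poly_mapping_lin_induct[of u UNIV])
qed (auto simp: lin_ext_add pm.scale_right_distrib)

lemma lin_ext_supported: 
  "\<lbrakk>u \<in> supported C; \<And>x. x \<in> C \<Longrightarrow> f x \<in> D\<rbrakk> \<Longrightarrow> lin_ext f u \<in> supported D"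
  unfolding supported_def mem_Collect_eq
proof (induction rule: poly_mapping_lin_induct)
  case (add a b)
  then show ?case using keys_add[of "lin_ext f a" "lin_ext f b"] by (auto simp: lin_ext_add)
qed auto

lemma bilin_ext_add_left: "bilin_ext f (u + u') v = bilin_ext f u v + bilin_ext f u' v"
  unfolding bilin_ext_def
  by (rule setsum_keys_plus_distrib) (simp_all add: single_add distrib_right sum.distrib)

lemma bilin_ext_swap: "bilin_ext f u v = bilin_ext (\<lambda>q p. f p q) v u"
  unfolding bilin_ext_def by (subst sum.swap) (simp add: mult.commute)

lemma bilin_ext_add_right: "bilin_ext f u (v + v') = bilin_ext f u v + bilin_ext f u v'"
  by (subst (1 2 3) bilin_ext_swap) (rule bilin_ext_add_left)

lemma bilin_ext_0 [simp]: "bilin_ext f 0 v = 0" "bilin_ext f u 0 = 0"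
  by (simp_all add: bilin_ext_def)

lemma bilin_ext_single [simp]:
  "bilin_ext f (Poly_Mapping.single p c) (Poly_Mapping.single q d) = Poly_Mapping.single (f p q) (c * d)"
  by (simp add: bilin_ext_def)

lemma bilin_ext_pscale_left: "bilin_ext f (pscale c u) v = pscale c (bilin_ext f u v)"
proof (rule poly_mapping_lin_induct[of u UNIV])
  fix x d show "bilin_ext f (pscale c (Poly_Mapping.single x d)) v = pscale c (bilin_ext f (Poly_Mapping.single x d) v)"
    by (rule poly_mapping_lin_induct[of v UNIV])
      (auto simp: bilin_ext_add_right pm.scale_right_distrib mult.assoc)
qed (auto simp: bilin_ext_add_left pm.scale_right_distrib)

lemma bilin_ext_pscale_right: "bilin_ext f u (pscale c v) = pscale c (bilin_ext f u v)"
  by (subst (1 2) bilin_ext_swap) (rule bilin_ext_pscale_left)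

lemma bilin_ext_diff_left: "bilin_ext f (u - u') v = bilin_ext f u v - bilin_ext f u' v"
  using bilin_ext_add_left[of f "u - u'" u' v] by (simp add: algebra_simps)

lemma bilin_ext_diff_right: "bilin_ext f u (v - v') = bilin_ext f u v - bilin_ext f u v'"
  using bilin_ext_add_right[of f u "v - v'" v'] by (simp add: algebra_simps)

lemma bilin_ext_supported: 
  assumes "u \<in> supported C" "v \<in> supported D" "\<And>x y. \<lbrakk>x \<in> C; y \<in> D\<rbrakk> \<Longrightarrow> f x y \<in> E"
  shows "bilin_ext f u v \<in> supported E"
  unfolding bilin_ext_def
  by (intro pm.subspace_sum[OF subspace_supported] supported_single assms(3))
    (use assms(1,2) in \<open>auto simp: supported_def\<close>)

definition kconst :: "'k::field \<Rightarrow> 'k ratfun" where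
  "kconst c = Fract [:c:] 1"

lemma kconst_simps [simp]: "kconst 0 = 0" "kconst 1 = 1" "kconst (a + b) = kconst a + kconst b"
  "kconst (a * b) = kconst a * kconst b" "kconst (- a) = - kconst a"
proof -
  show "kconst 0 = 0" by (simp add: kconst_def Zero_fract_def)
  show "kconst 1 = 1" by (simp add: kconst_def One_fract_def one_pCons)
qed (simp_all add: kconst_def mult.commute)

lemma kconst_eq_0_iff [simp]: "kconst c = 0 \<longleftrightarrow> c = 0"
  by (simp add: kconst_def Zero_fract_def eq_fract)

definition emb :: "('m \<Rightarrow>\<^sub>0 'k::field) \<Rightarrow> ('m \<Rightarrow>\<^sub>0 'k ratfun)" where
  "emb u = Poly_Mapping.map kconst u"

lemma lookup_emb [simp]: "Poly_Mapping.lookup (emb u) x = kconst (Poly_Mapping.lookup u x)"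
  by (simp add: emb_def Poly_Mapping.map.rep_eq when_def)

lemma emb_add: "emb (u + v) = emb u + emb v"
  and emb_uminus: "emb (- u) = - emb u"
  and emb_0 [simp]: "emb 0 = 0"
  and emb_pscale: "emb (pscale c u) = pscale (kconst c) (emb u)"
  by (auto intro!: poly_mapping_eqI simp: lookup_add)

lemma emb_diff: "emb (u - v) = emb u - emb v"
  using emb_add[of u "- v"] by (simp add: emb_uminus)

lemma emb_single [simp]: "emb (Poly_Mapping.single x c) = Poly_Mapping.single x (kconst c)"
  by (simp add: emb_def)

lemma keys_emb [simp]: "Poly_Mapping.keys (emb u) = Poly_Mapping.keys u"
  by (auto simp: in_keys_iff)

lemma emb_supported [simp]: "emb u \<in> supported C \<longleftrightarrow> u \<in> supported C"
  by (simp add: supported_def)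

lemma emb_bilin_ext: "emb (bilin_ext h u v) = bilin_ext h (emb u) (emb v)"
proof (rule poly_mapping_lin_induct[of u UNIV])
  fix x c show "emb (bilin_ext h (Poly_Mapping.single x c) v) = bilin_ext h (emb (Poly_Mapping.single x c)) (emb v)"
    by (rule poly_mapping_lin_induct[of v UNIV]) (auto simp: bilin_ext_add_right emb_add)
qed (auto simp: bilin_ext_add_left emb_add)

lemma lin_ext_conv_bilin_ext: "lin_ext (\<lambda>p. h p q) u = bilin_ext h u (Poly_Mapping.single q 1)"
  by (rule poly_mapping_lin_induct[of u UNIV]) (auto simp: lin_ext_add bilin_ext_add_left)

text \<open>
  \<open>collapse\<close> and its section \<open>sect\<close> compare the free \<open>k\<close>-vector space on \<open>M \<times> K\<close>, used to define the
  tensor product, with the free \<open>K\<close>-vector space on \<open>M\<close>.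
\<close>

definition collapse :: "('m \<times> 'k::field ratfun \<Rightarrow>\<^sub>0 'k) \<Rightarrow> ('m \<Rightarrow>\<^sub>0 'k ratfun)" where
  "collapse u = (\<Sum>p\<in>Poly_Mapping.keys u. Poly_Mapping.single (fst p) (kconst (Poly_Mapping.lookup u p) * snd p))"

lemma collapse_add: "collapse (u + v) = collapse u + collapse v"
  unfolding collapse_def by (rule setsum_keys_plus_distrib) (simp_all add: single_add distrib_right)

lemma collapse_0 [simp]: "collapse 0 = 0"
  by (simp add: collapse_def)

lemma collapse_single [simp]: "collapse (Poly_Mapping.single (m, f) c) = Poly_Mapping.single m (kconst c * f)"
  by (simp add: collapse_def)

lemma collapse_diff: "collapse (u - v) = collapse u - collapse v"
  using collapse_add[of "u - v" v] by (simp add: algebra_simps)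

lemma collapse_supported: "u \<in> supported (C \<times> UNIV) \<Longrightarrow> collapse u \<in> supported C"
  unfolding collapse_def by (intro pm.subspace_sum[OF subspace_supported]) (auto simp: supported_def)

text \<open>The reason for collapsing: the operation
  \<open>(m \<otimes> f)(r \<otimes> g) = h m r \<otimes> fg\<close> on representatives becomes the
  \<open>K\<close>-bilinear extension of \<open>h\<close>, so all module laws can be checked on
  basis elements.\<close>

lemma collapse_bilin_ext:
  fixes u :: "'m \<times> 'k::field ratfun \<Rightarrow>\<^sub>0 'k" and v :: "'r \<times> 'k ratfun \<Rightarrow>\<^sub>0 'k"
  shows "collapse (bilin_ext (\<lambda>(m, f) (r, g). (h m r, f * g)) u v) = bilin_ext h (collapse u) (collapse v)"
proof (rule poly_mapping_lin_induct[of u UNIV])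
  fix x :: "'m \<times> 'k ratfun" and c
  obtain m f where x: "x = (m, f)" by (cases x)
  show "collapse (bilin_ext (\<lambda>(m, f) (r, g). (h m r, f * g)) (Poly_Mapping.single x c) v)
      = bilin_ext h (collapse (Poly_Mapping.single x c)) (collapse v)"
  proof (rule poly_mapping_lin_induct[of v UNIV])
    fix y :: "'r \<times> 'k ratfun" and d
    obtain r g where y: "y = (r, g)" by (cases y)
    show "collapse (bilin_ext (\<lambda>(m, f) (r, g). (h m r, f * g)) (Poly_Mapping.single x c) (Poly_Mapping.single y d))
      = bilin_ext h (collapse (Poly_Mapping.single x c)) (collapse (Poly_Mapping.single y d))"
      by (simp add: x y mult.assoc mult.left_commute)
  qed (auto simp: bilin_ext_add_right collapse_add)
qed (auto simp: bilin_ext_add_left collapse_add)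

lemma collapse_lin_ext: 
  fixes u :: "'m \<times> 'k::field ratfun \<Rightarrow>\<^sub>0 'k"
  shows "collapse (lin_ext (\<lambda>(r, f). (r, c * f)) u) = pscale c (collapse u)"
proof (rule poly_mapping_lin_induct[of u UNIV])
  fix x :: "'m \<times> 'k ratfun" and d
  obtain r g where "x = (r, g)" by (cases x)
  then show "collapse (lin_ext (\<lambda>(r, f). (r, c * f)) (Poly_Mapping.single x d)) = pscale c (collapse (Poly_Mapping.single x d))"
    by (simp add: mult.left_commute)
qed (auto simp: lin_ext_add collapse_add pm.scale_right_distrib)

text \<open>Each term \<open>f m\<close> becomes the basis element \<open>(m, f)\<close>. The map is
  therefore not additive; it becomes additive modulo the tensor relations.\<close>

definition sect :: "('m \<Rightarrow>\<^sub>0 'k::field ratfun) \<Rightarrow> ('m \<times> 'k ratfun \<Rightarrow>\<^sub>0 'k)" where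
  "sect v = (\<Sum>m\<in>Poly_Mapping.keys v. Poly_Mapping.single (m, Poly_Mapping.lookup v m) 1)"

lemma sect_supported: "v \<in> supported C \<Longrightarrow> sect v \<in> supported (C \<times> UNIV)"
  unfolding sect_def by (intro pm.subspace_sum[OF subspace_supported]) (auto simp: supported_def)

lemma collapse_sect [simp]: "collapse (sect v) = v"
proof -
  have "collapse (\<Sum>m\<in>I. Poly_Mapping.single (m, Poly_Mapping.lookup v m) 1)
      = (\<Sum>m\<in>I. Poly_Mapping.single m (Poly_Mapping.lookup v m))" for I
    by (induction I rule: infinite_finite_induct) (auto simp: collapse_add)
  then have "collapse (sect v) = (\<Sum>m\<in>Poly_Mapping.keys v. Poly_Mapping.single m (Poly_Mapping.lookup v m))"
    unfolding sect_def .
  also have "\<dots> = lin_ext (\<lambda>x. x) v" by (simp add: lin_ext_def)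
  also have "\<dots> = v" by (rule poly_mapping_lin_induct[of v UNIV]) (auto simp: lin_ext_add)
  finally show ?thesis .
qed

lemma ratfun_simps [simp]: "carrier ratfun = UNIV" "add ratfun = (+)" "smult ratfun c f = kconst c * f"
  by (auto simp: ratfun_def kconst_def)

section \<open>The tensor product of one vector space with \<open>k(x)\<close>\<close>

locale kmod = Module.module "class_ring :: 'k::field ring" A for A :: "('k::field, 'a) module"
begin

lemma smult_in: "x \<in> carrier A \<Longrightarrow> c \<odot>\<^bsub>A\<^esub> x \<in> carrier A"
  using smult_closed[of c x] by simp

definition ev :: "('a \<Rightarrow>\<^sub>0 'k) \<Rightarrow> 'a" where
  "ev u = lincomb (Poly_Mapping.lookup u) (Poly_Mapping.keys u)"

abbreviation F :: "('a \<Rightarrow>\<^sub>0 'k) set" where "F \<equiv> supported (carrier A)"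

abbreviation FK :: "('a \<Rightarrow>\<^sub>0 'k ratfun) set" where "FK \<equiv> supported (carrier A)"

lemma smult_zero: "x \<in> carrier A \<Longrightarrow> 0 \<odot>\<^bsub>A\<^esub> x = \<zero>\<^bsub>A\<^esub>"
proof -
  assume x: "x \<in> carrier A"
  have "(0 + 0) \<odot>\<^bsub>A\<^esub> x = 0 \<odot>\<^bsub>A\<^esub> x \<oplus>\<^bsub>A\<^esub> 0 \<odot>\<^bsub>A\<^esub> x" using smult_l_distr[of 0 0 x] x by simp
  then show ?thesis using M.add.r_cancel_one[of "0 \<odot>\<^bsub>A\<^esub> x" "0 \<odot>\<^bsub>A\<^esub> x"] smult_in[OF x] by simp
qed

lemma ev_superset:
  assumes "finite I" "Poly_Mapping.keys u \<subseteq> I" "I \<subseteq> carrier A"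
  shows "ev u = lincomb (Poly_Mapping.lookup u) I"
  unfolding ev_def lincomb_def using assms
  by (intro M.add.finprod_mono_neutral_cong_left) (auto simp: in_keys_iff smult_zero subset_iff smult_in)

lemma ev_in: "u \<in> F \<Longrightarrow> ev u \<in> carrier A"
  unfolding ev_def supported_def by (intro lincomb_closed) auto

lemma ev_add:
  assumes u: "u \<in> F" and v: "v \<in> F"
  shows "ev (u + v) = ev u \<oplus>\<^bsub>A\<^esub> ev v"
proof -
  let ?I = "Poly_Mapping.keys u \<union> Poly_Mapping.keys v"
  have I: "finite ?I" "?I \<subseteq> carrier A" using u v by (auto simp: supported_def)
  have "ev (u + v) = lincomb (Poly_Mapping.lookup (u + v)) ?I"
    by (rule ev_superset[OF I(1) keys_add I(2)])
  also have "Poly_Mapping.lookup (u + v) = (\<lambda>x. Poly_Mapping.lookup u x + Poly_Mapping.lookup v x)"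
    by (simp add: lookup_add fun_eq_iff)
  also have "lincomb \<dots> ?I = lincomb (Poly_Mapping.lookup u) ?I \<oplus>\<^bsub>A\<^esub> lincomb (Poly_Mapping.lookup v) ?I"
    using lincomb_sum[OF I, of "Poly_Mapping.lookup u" "Poly_Mapping.lookup v"] by simp
  also have "\<dots> = ev u \<oplus>\<^bsub>A\<^esub> ev v" using I by (simp add: ev_superset[of ?I])
  finally show ?thesis .
qed

lemma ev_0 [simp]: "ev 0 = \<zero>\<^bsub>A\<^esub>"
  by (simp add: ev_def lincomb_def)

lemma ev_single: "x \<in> carrier A \<Longrightarrow> ev (Poly_Mapping.single x c) = c \<odot>\<^bsub>A\<^esub> x"
  using ev_superset[of "{x}" "Poly_Mapping.single x c"] smult_in[of x c]
  by (simp add: lincomb_def)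

lemma ev_pscale:
  assumes u: "u \<in> F"
  shows "ev (pscale c u) = c \<odot>\<^bsub>A\<^esub> ev u"
proof -
  have I: "finite (Poly_Mapping.keys u)" "Poly_Mapping.keys u \<subseteq> carrier A" using u by (auto simp: supported_def)
  have "ev (pscale c u) = lincomb (Poly_Mapping.lookup (pscale c u)) (Poly_Mapping.keys u)"
    by (rule ev_superset[OF I(1) keys_pscale I(2)])
  also have "Poly_Mapping.lookup (pscale c u) = (\<lambda>x. c * Poly_Mapping.lookup u x)"
    by (simp add: fun_eq_iff)
  also have "lincomb \<dots> (Poly_Mapping.keys u) = c \<odot>\<^bsub>A\<^esub> ev u"
    using lincomb_smult[OF I(2), of "Poly_Mapping.lookup u" c] by (simp add: ev_def)
  finally show ?thesis .
qed

definition Null :: "('a \<Rightarrow>\<^sub>0 'k) set" where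
  "Null = {u \<in> F. ev u = \<zero>\<^bsub>A\<^esub>}"

lemma smult_0: "c \<odot>\<^bsub>A\<^esub> \<zero>\<^bsub>A\<^esub> = \<zero>\<^bsub>A\<^esub>"
proof -
  have "c \<odot>\<^bsub>A\<^esub> (\<zero>\<^bsub>A\<^esub> \<oplus>\<^bsub>A\<^esub> \<zero>\<^bsub>A\<^esub>) = c \<odot>\<^bsub>A\<^esub> \<zero>\<^bsub>A\<^esub> \<oplus>\<^bsub>A\<^esub> c \<odot>\<^bsub>A\<^esub> \<zero>\<^bsub>A\<^esub>"
    by (rule smult_r_distr) auto
  then show ?thesis using M.add.r_cancel_one[of "c \<odot>\<^bsub>A\<^esub> \<zero>\<^bsub>A\<^esub>" "c \<odot>\<^bsub>A\<^esub> \<zero>\<^bsub>A\<^esub>"] smult_in[of "\<zero>\<^bsub>A\<^esub>" c] by simp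
qed

lemma subspace_Null: "pm.subspace Null"
proof (rule pm.subspaceI)
  show "0 \<in> Null" unfolding Null_def using pm.subspace_0[OF subspace_supported] by simp
  show "u + v \<in> Null" if "u \<in> Null" "v \<in> Null" for u v
    using that pm.subspace_add[OF subspace_supported] unfolding Null_def by (auto simp: ev_add)
  show "pscale c u \<in> Null" if "u \<in> Null" for c u
    using that pm.subspace_scale[OF subspace_supported] unfolding Null_def by (auto simp: ev_pscale smult_0)
qed

lemma ev_diff_Null: 
  assumes "u \<in> F" "v \<in> F"
  shows "u - v \<in> Null \<longleftrightarrow> ev u = ev v"
proof -
  have d: "u - v \<in> F" using pm.subspace_diff[OF subspace_supported] assms by auto
  have "ev u = ev (u - v) \<oplus>\<^bsub>A\<^esub> ev v" using ev_add[OF d assms(2)] by simp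
  then show ?thesis using d ev_in[OF d] ev_in[OF assms(2)] M.add.l_cancel_one[of "ev v" "ev (u - v)"]
    unfolding Null_def by auto
qed

text \<open>Since \<open>A\<close> is \<open>F/Null\<close>, right exactness of the tensor product
  suggests \<open>FK/NullK\<close> as a model of \<open>A \<otimes> K\<close>; \<open>TN_iff\<close>
  confirms it.\<close>

definition NullK :: "('a \<Rightarrow>\<^sub>0 'k ratfun) set" where
  "NullK = pm.span (emb ` Null)"

lemma subspace_NullK: "pm.subspace NullK"
  unfolding NullK_def by simp

lemma emb_Null: "u \<in> Null \<Longrightarrow> emb u \<in> NullK"
  unfolding NullK_def by (auto intro: pm.span_base)

lemma NullK_supported: "NullK \<subseteq> supported (carrier A)"
  unfolding NullK_def by (rule pm.span_minimal[OF _ subspace_supported]) (auto simp: Null_def)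

lemma supported_span: "FK = pm.span (emb ` F)"
proof
  show "pm.span (emb ` F) \<subseteq> FK"
    by (rule pm.span_minimal[OF _ subspace_supported]) auto
  show "FK \<subseteq> pm.span (emb ` F)"
  proof
    fix v :: "'a \<Rightarrow>\<^sub>0 'k ratfun" assume "v \<in> supported (carrier A)"
    then have "Poly_Mapping.keys v \<subseteq> carrier A" by (simp add: supported_def)
    then show "v \<in> pm.span (emb ` F)"
    proof (induction rule: poly_mapping_lin_induct)
      case (single x c)
      have "pscale c (emb (Poly_Mapping.single x 1)) \<in> pm.span (emb ` F)"
        using single by (intro pm.span_scale pm.span_base imageI supported_single)
      then show ?case by simp
    qed (auto intro: pm.span_zero pm.span_add)
  qed
qed

abbreviation TN where "TN \<equiv> tensor_null A ratfun"

text \<open>Relations in the second factor collapse to \<open>0\<close>; those in the first factor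
  collapse to \<open>K\<close>-multiples of an embedded relation of \<open>A\<close>.\<close>

lemma TN_collapse: "u \<in> TN \<Longrightarrow> u \<in> supported (carrier A \<times> UNIV) \<and> collapse u \<in> NullK"
proof (induction rule: tensor_null.induct)
  case zero
  show ?case using pm.subspace_0[OF subspace_supported] pm.subspace_0[OF subspace_NullK] by simp
next
  case (add u v)
  then show ?case
    by (auto simp: collapse_add intro!: pm.subspace_add[OF subspace_supported] pm.subspace_add[OF subspace_NullK])
next
  case (add_left x x' y c)
  let ?n = "Poly_Mapping.single (x \<oplus>\<^bsub>A\<^esub> x') 1 - Poly_Mapping.single x 1 - Poly_Mapping.single x' 1 :: 'a \<Rightarrow>\<^sub>0 'k"
  have s: "Poly_Mapping.single x 1 \<in> F" "Poly_Mapping.single x' 1 \<in> F" "Poly_Mapping.single (x \<oplus>\<^bsub>A\<^esub> x') 1 \<in> F"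
    using add_left by (auto intro: supported_single)
  have "ev (Poly_Mapping.single (x \<oplus>\<^bsub>A\<^esub> x') 1) = ev (Poly_Mapping.single x 1 + Poly_Mapping.single x' 1)"
    using add_left smult_one by (simp add: ev_add[OF s(1,2)] ev_single)
  then have "?n \<in> Null" using ev_diff_Null[OF s(3) pm.subspace_add[OF subspace_supported s(1,2)]]
    by (simp add: diff_diff_eq)
  then have "pscale (kconst c * y) (emb ?n) \<in> NullK" by (intro pm.subspace_scale[OF subspace_NullK] emb_Null)
  also have "pscale (kconst c * y) (emb ?n) = Poly_Mapping.single (x \<oplus>\<^bsub>A\<^esub> x') (kconst c * y)
      - Poly_Mapping.single x (kconst c * y) - Poly_Mapping.single x' (kconst c * y)"
    by (simp add: emb_diff pm.scale_right_diff_distrib)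
  finally show ?case using add_left
    by (auto simp: collapse_diff intro!: pm.subspace_diff[OF subspace_supported] supported_single)
next
  case (add_right x y y' c)
  then show ?case using pm.subspace_0[OF subspace_NullK]
    by (auto simp: collapse_diff distrib_left single_add intro!: pm.subspace_diff[OF subspace_supported] supported_single)
next
  case (smult_left x y a c)
  let ?n = "Poly_Mapping.single (a \<odot>\<^bsub>A\<^esub> x) 1 - Poly_Mapping.single x a :: 'a \<Rightarrow>\<^sub>0 'k"
  have s: "Poly_Mapping.single x a \<in> F" "Poly_Mapping.single (a \<odot>\<^bsub>A\<^esub> x) 1 \<in> F"
    using smult_left by (auto intro: supported_single smult_in)
  have "?n \<in> Null" using ev_diff_Null[OF s(2,1)] smult_left smult_in[of x a] smult_one[of "a \<odot>\<^bsub>A\<^esub> x"] by (simp add: ev_single)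
  then have "pscale (kconst c * y) (emb ?n) \<in> NullK" by (intro pm.subspace_scale[OF subspace_NullK] emb_Null)
  also have "pscale (kconst c * y) (emb ?n) = Poly_Mapping.single (a \<odot>\<^bsub>A\<^esub> x) (kconst c * y)
      - Poly_Mapping.single x (kconst (c * a) * y)"
    by (simp add: emb_diff pm.scale_right_diff_distrib ac_simps)
  finally show ?case using smult_left
    by (auto simp: collapse_diff intro!: pm.subspace_diff[OF subspace_supported] supported_single smult_in)
next
  case (smult_right x y a c)
  then show ?case using pm.subspace_0[OF subspace_NullK]
    by (auto simp: collapse_diff mult.assoc intro!: pm.subspace_diff[OF subspace_supported] supported_single)
qed

lemma TN_pscale: "u \<in> TN \<Longrightarrow> pscale d u \<in> TN"
proof (induction rule: tensor_null.induct)
  case zero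
  then show ?case using tensor_null.zero by simp
next
  case (add u v)
  then show ?case using tensor_null.add by (simp add: pm.scale_right_distrib)
next
  case (add_left x x' y c)
  then show ?case using tensor_null.add_left[OF add_left, of "d * c"] by (simp add: pm.scale_right_diff_distrib)
next
  case (add_right x y y' c)
  then show ?case using tensor_null.add_right[OF add_right, of "d * c"] by (simp add: pm.scale_right_diff_distrib)
next
  case (smult_left x y a c)
  then show ?case using tensor_null.smult_left[OF smult_left, of a "d * c"]
    by (simp add: pm.scale_right_diff_distrib mult.assoc)
next
  case (smult_right x y a c)
  then show ?case using tensor_null.smult_right[OF smult_right, of a "d * c"]
    by (simp add: pm.scale_right_diff_distrib mult.assoc)
qed

lemma subspace_TN: "pm.subspace TN"
  by (intro pm.subspaceI tensor_null.zero tensor_null.add TN_pscale)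

lemma TN_single_0: "x \<in> carrier A \<Longrightarrow> Poly_Mapping.single (x, 0) c \<in> TN"
  using pm.subspace_neg[OF subspace_TN tensor_null.add_right[of x A 0 ratfun 0 c]] by simp

lemma TN_const: "x \<in> carrier A \<Longrightarrow> Poly_Mapping.single (x, kconst a * f) c - Poly_Mapping.single (x, f) (c * a) \<in> TN"
  using tensor_null.smult_right[of x A f ratfun a c] by simp

lemma sect_add:
  assumes v: "v \<in> supported (carrier A)" and w: "w \<in> supported (carrier A)"
  shows "sect (v + w) - (sect v + sect w) \<in> TN"
proof -
  let ?I = "Poly_Mapping.keys v \<union> Poly_Mapping.keys w"
  have I: "finite ?I" "?I \<subseteq> carrier A" using v w by (auto simp: supported_def)
  \<comment> \<open>\<open>s\<close> is the section written over the common support of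
    \<open>v\<close> and \<open>w\<close>. It differs from \<open>sect\<close> only by terms
    \<open>m \<otimes> 0\<close>, which are null, and over a common index set additivity is checked
    term by term.\<close>
  define s where "s u = (\<Sum>m\<in>?I. Poly_Mapping.single (m, Poly_Mapping.lookup u m) (1::'k))" for u :: "'a \<Rightarrow>\<^sub>0 'k ratfun"
  have s: "s u - sect u \<in> TN" if "Poly_Mapping.keys u \<subseteq> ?I" for u
  proof -
    have "s u = sect u + (\<Sum>m\<in>?I - Poly_Mapping.keys u. Poly_Mapping.single (m, Poly_Mapping.lookup u m) 1)"
      unfolding s_def sect_def using sum.subset_diff[OF that I(1)] by (simp add: add.commute)
    moreover have "(\<Sum>m\<in>?I - Poly_Mapping.keys u. Poly_Mapping.single (m, Poly_Mapping.lookup u m) 1) \<in> TN"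
      using I(2) by (intro pm.subspace_sum[OF subspace_TN]) (auto simp: in_keys_iff intro!: TN_single_0)
    ultimately show ?thesis by simp
  qed
  have "s (v + w) - (s v + s w) = (\<Sum>m\<in>?I. Poly_Mapping.single (m, Poly_Mapping.lookup v m + Poly_Mapping.lookup w m) 1
     - Poly_Mapping.single (m, Poly_Mapping.lookup v m) 1 - Poly_Mapping.single (m, Poly_Mapping.lookup w m) 1)"
    unfolding s_def by (simp add: sum_subtractf lookup_add sum.distrib algebra_simps)
  also have "\<dots> \<in> TN"
    using I(2) tensor_null.add_right[of _ A _ ratfun _ 1] by (intro pm.subspace_sum[OF subspace_TN]) auto
  finally have 1: "s (v + w) - (s v + s w) \<in> TN" .
  have "sect (v + w) - (sect v + sect w)
     = (s (v + w) - (s v + s w)) - (s (v + w) - sect (v + w)) + (s v - sect v) + (s w - sect w)" by simp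
  also have "\<dots> \<in> TN"
    using keys_add[of v w]
    by (intro pm.subspace_add[OF subspace_TN] pm.subspace_diff[OF subspace_TN] 1 s) auto
  finally show ?thesis .
qed

lemma sect_collapse:
  assumes "u \<in> supported (carrier A \<times> UNIV)"
  shows "u - sect (collapse u) \<in> TN"
  using assms unfolding supported_def mem_Collect_eq
proof (induction rule: poly_mapping_lin_induct)
  case zero
  then show ?case using tensor_null.zero by (simp add: sect_def)
next
  case (single x c)
  then obtain m f where x: "x = (m, f)" "m \<in> carrier A" by auto
  have sect: "Poly_Mapping.single (m, g) 1 - sect (Poly_Mapping.single m g) \<in> TN" for g
    using TN_single_0[OF x(2), of 1] tensor_null.zero by (cases "g = 0") (simp_all add: sect_def)
  from pm.subspace_diff[OF subspace_TN sect[of "kconst c * f"] TN_const[OF x(2), of c f 1]]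
  show ?case by (simp add: x)
next
  case (add a b)
  have "a \<in> supported (carrier A \<times> UNIV)" "b \<in> supported (carrier A \<times> UNIV)"
    using add.hyps by (auto simp: supported_def)
  then have "collapse a \<in> FK" "collapse b \<in> FK" by (auto intro!: collapse_supported)
  from pm.subspace_diff[OF subspace_TN pm.subspace_add[OF subspace_TN add.IH] sect_add[OF this]]
  show ?case by (simp add: collapse_add algebra_simps)
qed

text \<open>Moves a formal combination into the left factor at a fixed \<open>f\<close>. For
  \<open>n\<close> in \<open>Null\<close> the result is \<open>0 \<otimes> f\<close>, which is how
  relations of \<open>A\<close> become null in the tensor product.\<close>

lemma slice_TN:
  assumes "n \<in> F"
  shows "lin_ext (\<lambda>m. (m, f)) n - Poly_Mapping.single (ev n, f) 1 \<in> TN"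
  using assms unfolding supported_def mem_Collect_eq
proof (induction rule: poly_mapping_lin_induct)
  case zero
  show ?case using pm.subspace_neg[OF subspace_TN tensor_null.smult_left[of "\<zero>\<^bsub>A\<^esub>" A f ratfun 0 1]]
    by (simp add: smult_0)
next
  case (single x c)
  show ?case using pm.subspace_neg[OF subspace_TN tensor_null.smult_left[OF single, of f ratfun c 1]] single
    by (simp add: ev_single)
next
  case (add a b)
  then have ab: "a \<in> F" "b \<in> F" by (auto simp: supported_def)
  from pm.subspace_diff[OF subspace_TN pm.subspace_add[OF subspace_TN add.IH]
      tensor_null.add_left[OF ev_in[OF ab(1)] ev_in[OF ab(2)], of f ratfun 1]]
  show ?case by (simp add: lin_ext_add ev_add[OF ab] algebra_simps)
qed

lemma sect_NullK:
  assumes "v \<in> NullK"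
  shows "sect v \<in> TN"
proof -
  have "v \<in> FK \<and> sect v \<in> TN" using assms unfolding NullK_def
  proof (induction rule: pm.span_induct_alt)
    case base
    then show ?case by (simp add: sect_def tensor_null.zero pm.subspace_0[OF subspace_supported])
  next
    case (step f x y)
    then obtain n where n: "n \<in> Null" "x = emb n" by auto
    have nF: "n \<in> F" using n by (simp add: Null_def)
    have "lin_ext (\<lambda>m. (m, f)) n - Poly_Mapping.single (\<zero>\<^bsub>A\<^esub>, f) 1 \<in> TN"
      using slice_TN[OF nF, of f] n by (simp add: Null_def)
    moreover have "Poly_Mapping.single (\<zero>\<^bsub>A\<^esub>, f) 1 \<in> TN"
      using tensor_null.smult_left[of "\<zero>\<^bsub>A\<^esub>" A f ratfun 0 1] by (simp add: smult_0)
    ultimately have 1: "lin_ext (\<lambda>m. (m, f)) n \<in> TN" using pm.subspace_add[OF subspace_TN] by fastforce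
    have 2: "collapse (lin_ext (\<lambda>m. (m, f)) u) = pscale f (emb u)" for u :: "'a \<Rightarrow>\<^sub>0 'k"
      by (rule poly_mapping_lin_induct[of u UNIV])
        (auto simp: lin_ext_add collapse_add emb_add pm.scale_right_distrib mult.commute)
    have "lin_ext (\<lambda>m. (m, f)) n \<in> supported (carrier A \<times> UNIV)" using nF by (rule lin_ext_supported) auto
    from sect_collapse[OF this] have "lin_ext (\<lambda>m. (m, f)) n - sect (pscale f (emb n)) \<in> TN" by (simp add: 2)
    from pm.subspace_diff[OF subspace_TN 1 this] have 3: "sect (pscale f x) \<in> TN" by (simp add: n)
    have xy: "pscale f x \<in> FK" "y \<in> FK"
      using n nF step(2) by (auto intro!: pm.subspace_scale[OF subspace_supported])
    from pm.subspace_add[OF subspace_TN sect_add[OF this] pm.subspace_add[OF subspace_TN 3 conjunct2[OF step(2)]]]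
    show ?case using pm.subspace_add[OF subspace_supported xy] by simp
  qed
  then show ?thesis ..
qed

text \<open>One direction is \<open>TN_collapse\<close>. Conversely \<open>u\<close> differs by a
  null element from \<open>sect (collapse u)\<close>, and the section maps \<open>NullK\<close> to
  null elements. Computations can henceforth stay in the free \<open>K\<close>-space.\<close>

lemma TN_iff: "u \<in> supported (carrier A \<times> UNIV) \<Longrightarrow> u \<in> TN \<longleftrightarrow> collapse u \<in> NullK"
  using TN_collapse[of u] sect_NullK[of "collapse u"] sect_collapse[of u]
    pm.subspace_add[OF subspace_TN, of "u - sect (collapse u)" "sect (collapse u)"] by auto

definition cls :: "('a \<Rightarrow>\<^sub>0 'k ratfun) \<Rightarrow> ('a \<times> 'k ratfun \<Rightarrow>\<^sub>0 'k) set" where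
  "cls v = tensor_class A ratfun (sect v)"

lemma mem_tensor_class:
  assumes "u \<in> supported (carrier A \<times> UNIV)"
  shows "u' \<in> tensor_class A ratfun u \<longleftrightarrow> u' \<in> supported (carrier A \<times> UNIV) \<and> collapse u' - collapse u \<in> NullK"
proof -
  have "u' \<in> supported (carrier A \<times> UNIV)" if "u' - u \<in> TN"
    using pm.subspace_add[OF subspace_supported conjunct1[OF TN_collapse[OF that]] assms] by simp
  moreover have "u' - u \<in> TN \<longleftrightarrow> collapse u' - collapse u \<in> NullK" if "u' \<in> supported (carrier A \<times> UNIV)"
    using TN_iff[OF pm.subspace_diff[OF subspace_supported that assms]] by (simp add: collapse_diff)
  ultimately show ?thesis unfolding tensor_class_def by auto
qed

lemma mem_cls:
  assumes "v \<in> supported (carrier A)"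
  shows "u \<in> cls v \<longleftrightarrow> u \<in> supported (carrier A \<times> UNIV) \<and> collapse u - v \<in> NullK"
  unfolding cls_def using mem_tensor_class[OF sect_supported[OF assms]] by simp

lemma cls_eq_iff:
  assumes "v \<in> supported (carrier A)" "w \<in> supported (carrier A)"
  shows "cls v = cls w \<longleftrightarrow> v - w \<in> NullK"
proof
  assume "cls v = cls w"
  moreover have "sect v \<in> cls v" using mem_cls[OF assms(1)] sect_supported[OF assms(1)] pm.subspace_0[OF subspace_NullK] by simp
  ultimately show "v - w \<in> NullK" using mem_cls[OF assms(2), of "sect v"] by simp
next
  assume d: "v - w \<in> NullK"
  have "x - v \<in> NullK \<longleftrightarrow> x - w \<in> NullK" for x
    using pm.subspace_add[OF subspace_NullK, of "x - v" "v - w"] pm.subspace_diff[OF subspace_NullK, of "x - w" "v - w"] d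
    by auto
  then show "cls v = cls w" using mem_cls[OF assms(1)] mem_cls[OF assms(2)] by blast
qed

lemma tensor_class_eq_cls:
  assumes "u \<in> supported (carrier A \<times> UNIV)"
  shows "tensor_class A ratfun u = cls (collapse u)"
  using mem_tensor_class[OF assms] mem_cls[OF collapse_supported[OF assms]] by blast

lemma tensor_carrier_eq: "tensor_carrier A ratfun = cls ` supported (carrier A)"
proof
  show "tensor_carrier A ratfun \<subseteq> cls ` supported (carrier A)" unfolding tensor_carrier_def
  proof (rule image_subsetI)
    fix u :: "'a \<times> 'k ratfun \<Rightarrow>\<^sub>0 'k" assume "u \<in> {u. Poly_Mapping.keys u \<subseteq> carrier A \<times> carrier ratfun}"
    then have u: "u \<in> supported (carrier A \<times> UNIV)" by (simp add: supported_def)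
    show "tensor_class A ratfun u \<in> cls ` supported (carrier A)"
      unfolding tensor_class_eq_cls[OF u] by (rule imageI[OF collapse_supported[OF u]])
  qed
  show "cls ` supported (carrier A) \<subseteq> tensor_carrier A ratfun" unfolding tensor_carrier_def cls_def
    using sect_supported by (auto simp: supported_def)
qed

lemma cls_nonempty: "v \<in> supported (carrier A) \<Longrightarrow> cls v \<noteq> {}"
  using mem_cls[of v "sect v"] sect_supported[of v] pm.subspace_0[OF subspace_NullK] by auto

lemma UN_const_eq: "\<lbrakk>X \<noteq> {}; \<And>x. x \<in> X \<Longrightarrow> f x = c\<rbrakk> \<Longrightarrow> (\<Union>x\<in>X. f x) = c"
  by auto

lemma tensor_add_cls:
  assumes v: "v \<in> supported (carrier A)" and w: "w \<in> supported (carrier A)"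
  shows "tensor_add A ratfun (cls v) (cls w) = cls (v + w)"
  unfolding tensor_add_def
proof (intro UN_const_eq cls_nonempty v w)
  fix u u' assume "u \<in> cls v" "u' \<in> cls w"
  then have u: "u \<in> supported (carrier A \<times> UNIV)" "u' \<in> supported (carrier A \<times> UNIV)"
    "collapse u - v \<in> NullK" "collapse u' - w \<in> NullK" using mem_cls v w by auto
  have uu: "u + u' \<in> supported (carrier A \<times> UNIV)" using pm.subspace_add[OF subspace_supported] u by auto
  have "collapse (u + u') - (v + w) \<in> NullK"
    using pm.subspace_add[OF subspace_NullK u(3,4)] by (simp add: collapse_add algebra_simps)
  then show "tensor_class A ratfun (u + u') = cls (v + w)" unfolding tensor_class_eq_cls[OF uu]
    using cls_eq_iff[OF collapse_supported[OF uu] pm.subspace_add[OF subspace_supported v w]] by simp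
qed

lemma smult_cls:
  assumes v: "v \<in> supported (carrier A)"
  shows "(\<Union>u\<in>cls v. tensor_class A ratfun (lin_ext (\<lambda>(r, f). (r, c * f)) u)) = cls (pscale c v)"
proof (intro UN_const_eq cls_nonempty v)
  fix u assume "u \<in> cls v"
  then have u: "u \<in> supported (carrier A \<times> UNIV)" "collapse u - v \<in> NullK" using mem_cls v by auto
  have uu: "lin_ext (\<lambda>(r, f). (r, c * f)) u \<in> supported (carrier A \<times> UNIV)"
    by (rule lin_ext_supported[OF u(1)]) auto
  have "collapse (lin_ext (\<lambda>(r, f). (r, c * f)) u) - pscale c v \<in> NullK"
    using pm.subspace_scale[OF subspace_NullK u(2), of c] by (simp add: collapse_lin_ext pm.scale_right_diff_distrib)
  then show "tensor_class A ratfun (lin_ext (\<lambda>(r, f). (r, c * f)) u) = cls (pscale c v)"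
    unfolding tensor_class_eq_cls[OF uu]
    using cls_eq_iff[OF collapse_supported[OF uu] pm.subspace_scale[OF subspace_supported v]] by simp
qed

end

lemma zero_supported [simp]: "0 \<in> supported C"
  by (simp add: supported_def)

text \<open>Covers at once the multiplication of \<open>R\<close> (with \<open>A = R\<close>) and
  the action on a module (with \<open>A\<close> its underlying vector space), so that the tensor
  computations are carried out only once.\<close>

locale bilin_act = Alg: k_algebra R + A: kmod A
  for R :: "('k::field, 'r) module" and A :: "('k::field, 'a) module" +
  fixes h :: "'a \<Rightarrow> 'r \<Rightarrow> 'a"
  assumes h_closed: "\<lbrakk>m \<in> carrier A; r \<in> carrier R\<rbrakk> \<Longrightarrow> h m r \<in> carrier A"
    and h_add_left: "\<lbrakk>m \<in> carrier A; m' \<in> carrier A; r \<in> carrier R\<rbrakk>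
      \<Longrightarrow> h (m \<oplus>\<^bsub>A\<^esub> m') r = h m r \<oplus>\<^bsub>A\<^esub> h m' r"
    and h_add_right: "\<lbrakk>m \<in> carrier A; r \<in> carrier R; s \<in> carrier R\<rbrakk>
      \<Longrightarrow> h m (r \<oplus>\<^bsub>R\<^esub> s) = h m r \<oplus>\<^bsub>A\<^esub> h m s"
    and h_smult_left: "\<lbrakk>m \<in> carrier A; r \<in> carrier R\<rbrakk> \<Longrightarrow> h (c \<odot>\<^bsub>A\<^esub> m) r = c \<odot>\<^bsub>A\<^esub> h m r"
    and h_smult_right: "\<lbrakk>m \<in> carrier A; r \<in> carrier R\<rbrakk> \<Longrightarrow> h m (c \<odot>\<^bsub>R\<^esub> r) = c \<odot>\<^bsub>A\<^esub> h m r"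
begin

sublocale B: kmod R
  by (rule kmod.intro[OF Alg.algebra_module])

lemma h_zero_left: "r \<in> carrier R \<Longrightarrow> h \<zero>\<^bsub>A\<^esub> r = \<zero>\<^bsub>A\<^esub>"
  using h_smult_left[of "\<zero>\<^bsub>A\<^esub>" r 0] by (simp add: A.smult_0 A.smult_zero h_closed)

lemma h_zero_right: "m \<in> carrier A \<Longrightarrow> h m \<zero>\<^bsub>R\<^esub> = \<zero>\<^bsub>A\<^esub>"
  using h_smult_right[of m "\<zero>\<^bsub>R\<^esub>" 0] by (simp add: B.smult_0 A.smult_zero h_closed)

lemma ev_lin_ext_left:
  assumes u: "u \<in> A.F" and r: "r \<in> carrier R"
  shows "A.ev (lin_ext (\<lambda>m. h m r) u) = h (A.ev u) r"
  using u unfolding supported_def mem_Collect_eq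
proof (induction rule: poly_mapping_lin_induct)
  case (add a b)
  then have ab: "a \<in> A.F" "b \<in> A.F" by (auto simp: supported_def)
  have "lin_ext (\<lambda>m. h m r) a \<in> A.F" "lin_ext (\<lambda>m. h m r) b \<in> A.F"
    using ab h_closed r by (auto elim!: lin_ext_supported)
  with ab r show ?case by (simp add: lin_ext_add A.ev_add h_add_left A.ev_in add)
qed (auto simp: h_zero_left r A.ev_single h_closed h_smult_left)

lemma ev_lin_ext_right:
  assumes u: "u \<in> B.F" and m: "m \<in> carrier A"
  shows "A.ev (lin_ext (\<lambda>r. h m r) u) = h m (B.ev u)"
  using u unfolding supported_def mem_Collect_eq
proof (induction rule: poly_mapping_lin_induct)
  case (add a b)
  then have ab: "a \<in> B.F" "b \<in> B.F" by (auto simp: supported_def)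
  have "lin_ext (\<lambda>r. h m r) a \<in> A.F" "lin_ext (\<lambda>r. h m r) b \<in> A.F"
    using ab h_closed m by (auto elim!: lin_ext_supported)
  with ab m show ?case by (simp add: lin_ext_add A.ev_add B.ev_add h_add_right B.ev_in add)
qed (auto simp: h_zero_right m A.ev_single B.ev_single h_closed h_smult_right)

lemma lin_ext_Null: "\<lbrakk>u \<in> A.Null; r \<in> carrier R\<rbrakk> \<Longrightarrow> lin_ext (\<lambda>m. h m r) u \<in> A.Null"
  using lin_ext_supported[of u "carrier A" "\<lambda>m. h m r" "carrier A"] ev_lin_ext_left[of u r]
  by (auto simp: A.Null_def h_closed h_zero_left)

lemma lin_ext_Null_right: "\<lbrakk>u \<in> B.Null; m \<in> carrier A\<rbrakk> \<Longrightarrow> lin_ext (\<lambda>r. h m r) u \<in> A.Null"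
  using lin_ext_supported[of u "carrier R" "\<lambda>r. h m r" "carrier A"] ev_lin_ext_right[of u m]
  by (auto simp: A.Null_def B.Null_def h_closed h_zero_right)

lemma bilin_ext_emb_single:
  "bilin_ext h (emb u) (Poly_Mapping.single r g) = pscale g (emb (lin_ext (\<lambda>m. h m r) u))"
proof -
  have "Poly_Mapping.single r g = pscale g (emb (Poly_Mapping.single r 1))" by simp
  then show ?thesis by (simp add: bilin_ext_pscale_right lin_ext_conv_bilin_ext[where h = h] emb_bilin_ext del: emb_single pscale_single)
qed

lemma bilin_ext_single_emb:
  "bilin_ext h (Poly_Mapping.single m g) (emb u) = pscale g (emb (lin_ext (\<lambda>r. h m r) u))"
proof -
  have "Poly_Mapping.single m g = pscale g (emb (Poly_Mapping.single m 1))" by simp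
  moreover have "lin_ext (\<lambda>r. h m r) u = bilin_ext h (Poly_Mapping.single m 1) u"
    using lin_ext_conv_bilin_ext[of "\<lambda>r m. h m r" m u] bilin_ext_swap[of h "Poly_Mapping.single m 1" u] by simp
  ultimately show ?thesis by (simp add: bilin_ext_pscale_left emb_bilin_ext del: emb_single pscale_single)
qed

lemma NullK_left:
  assumes "v \<in> A.NullK" "w \<in> B.FK"
  shows "bilin_ext h v w \<in> A.NullK"
  using assms(2) unfolding supported_def mem_Collect_eq
proof (induction rule: poly_mapping_lin_induct)
  case zero
  then show ?case using pm.subspace_0[OF A.subspace_NullK] by simp
next
  case (single r g)
  show ?case using assms(1) unfolding A.NullK_def
  proof (induction rule: pm.span_induct_alt)
    case base
    then show ?case using pm.span_zero by simp
  next
    case (step c x y)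
    then obtain n where n: "n \<in> A.Null" "x = emb n" by auto
    then have "emb (lin_ext (\<lambda>m. h m r) n) \<in> pm.span (emb ` A.Null)"
      using lin_ext_Null[OF _ single] by (intro pm.span_base) auto
    then show ?case using step(2) n
      by (auto simp: bilin_ext_add_left bilin_ext_pscale_left bilin_ext_emb_single
          intro!: pm.span_add pm.span_scale)
  qed
next
  case (add a b)
  then show ?case using pm.subspace_add[OF A.subspace_NullK] by (simp add: bilin_ext_add_right)
qed

lemma NullK_right:
  assumes "v \<in> A.FK" "w \<in> B.NullK"
  shows "bilin_ext h v w \<in> A.NullK"
  using assms(1) unfolding supported_def mem_Collect_eq
proof (induction rule: poly_mapping_lin_induct)
  case zero
  then show ?case using pm.subspace_0[OF A.subspace_NullK] by simp
next
  case (single m g)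
  show ?case using assms(2) unfolding B.NullK_def
  proof (induction rule: pm.span_induct_alt)
    case base
    then show ?case using pm.subspace_0[OF A.subspace_NullK] by simp
  next
    case (step c x y)
    then obtain n where n: "n \<in> B.Null" "x = emb n" by auto
    then have "emb (lin_ext (\<lambda>r. h m r) n) \<in> A.NullK"
      using lin_ext_Null_right[OF _ single] A.emb_Null by auto
    then show ?case using step(2) n
      by (auto simp: bilin_ext_add_right bilin_ext_pscale_right bilin_ext_single_emb
          intro!: pm.subspace_add[OF A.subspace_NullK] pm.subspace_scale[OF A.subspace_NullK])
  qed
next
  case (add a b)
  then show ?case using pm.subspace_add[OF A.subspace_NullK] by (simp add: bilin_ext_add_left)
qed

lemma bilin_ext_FK:
  assumes "v \<in> A.FK" "w \<in> B.FK"
  shows "bilin_ext h v w \<in> A.FK"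
  by (rule bilin_ext_supported[OF assms h_closed])

text \<open>Independence of representatives follows by splitting the error as
  \<open>(u - v) u' + v (u' - w)\<close> after collapsing; each summand lies in \<open>NullK\<close>
  because one of its factors is null.\<close>

lemma prod_cls:
  assumes v: "v \<in> A.FK" and w: "w \<in> B.FK"
  shows "(\<Union>u\<in>A.cls v. \<Union>u'\<in>B.cls w. tensor_class A ratfun
    (bilin_ext (\<lambda>(m, f) (r, g). (h m r, f * g)) u u')) = A.cls (bilin_ext h v w)"
proof (intro A.UN_const_eq A.cls_nonempty[OF v] B.cls_nonempty[OF w])
  fix u u' assume "u \<in> A.cls v" "u' \<in> B.cls w"
  then have u: "u \<in> supported (carrier A \<times> UNIV)" "u' \<in> supported (carrier R \<times> UNIV)"
    "collapse u - v \<in> A.NullK" "collapse u' - w \<in> B.NullK"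
    using A.mem_cls[OF v] B.mem_cls[OF w] by auto
  let ?p = "bilin_ext (\<lambda>(m, f) (r, g). (h m r, f * g)) u u'"
  have p: "?p \<in> supported (carrier A \<times> UNIV)"
    by (rule bilin_ext_supported[OF u(1,2)]) (auto simp: h_closed)
  have c: "collapse u \<in> A.FK" "collapse u' \<in> B.FK" using u by (auto intro: collapse_supported)
  have "bilin_ext h (collapse u - v) (collapse u') \<in> A.NullK" by (rule NullK_left[OF u(3) c(2)])
  moreover have "bilin_ext h v (collapse u' - w) \<in> A.NullK" by (rule NullK_right[OF v u(4)])
  ultimately have "bilin_ext h (collapse u - v) (collapse u') + bilin_ext h v (collapse u' - w) \<in> A.NullK"
    by (rule pm.subspace_add[OF A.subspace_NullK])
  then have "collapse ?p - bilin_ext h v w \<in> A.NullK"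
    by (simp add: collapse_bilin_ext bilin_ext_diff_left bilin_ext_diff_right)
  then show "tensor_class A ratfun ?p = A.cls (bilin_ext h v w)"
    unfolding A.tensor_class_eq_cls[OF p]
    using A.cls_eq_iff[OF collapse_supported[OF p] bilin_ext_FK[OF v w]] by simp
qed

end

text \<open>Four maps occur so that the same statement gives associativity of \<open>R_K\<close> and
  the mixed law \<open>(m r) s = m (r s)\<close> on \<open>M_K\<close>.\<close>

lemma bilin_ext_assoc:
  assumes u: "u \<in> supported C" and v: "v \<in> supported D" and w: "w \<in> supported E"
    and "\<And>x y z. \<lbrakk>x \<in> C; y \<in> D; z \<in> E\<rbrakk> \<Longrightarrow> h (g x y) z = h' x (g' y z)"
  shows "bilin_ext h (bilin_ext g u v) w = bilin_ext h' u (bilin_ext g' v w)"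
  using u unfolding supported_def mem_Collect_eq
proof (induction rule: poly_mapping_lin_induct)
  case (single x c)
  show ?case using v unfolding supported_def mem_Collect_eq
  proof (induction rule: poly_mapping_lin_induct)
    case (single y d)
    show ?case using w unfolding supported_def mem_Collect_eq
    proof (induction rule: poly_mapping_lin_induct)
      case (single z e)
      then show ?case using assms(4) \<open>x \<in> C\<close> \<open>y \<in> D\<close> by (simp add: mult.assoc)
    qed (auto simp: bilin_ext_add_right)
  qed (auto simp: bilin_ext_add_right bilin_ext_add_left)
qed (auto simp: bilin_ext_add_left)

lemma bilin_ext_unit_right:
  assumes u: "u \<in> supported C" and "\<And>x. x \<in> C \<Longrightarrow> h x e = x"
  shows "bilin_ext h u (Poly_Mapping.single e 1) = u"
  using u unfolding supported_def mem_Collect_eq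
  by (induction rule: poly_mapping_lin_induct) (auto simp: bilin_ext_add_left assms(2))

lemma bilin_ext_unit_left:
  assumes u: "u \<in> supported C" and "\<And>x. x \<in> C \<Longrightarrow> h e x = x"
  shows "bilin_ext h (Poly_Mapping.single e 1) u = u"
  using u unfolding supported_def mem_Collect_eq
  by (induction rule: poly_mapping_lin_induct) (auto simp: bilin_ext_add_right assms(2))

section \<open>The algebra \<open>R_K\<close> and the module \<open>M_K\<close>\<close>

context k_algebra
begin

lemma bilin_act_mult: "bilin_act R R (mult R)"
  by unfold_locales (auto simp: l_distr r_distr smult_mult_left smult_mult_right)

interpretation RR: bilin_act R R "mult R"
  by (rule bilin_act_mult)

abbreviation "RK \<equiv> ratfun_algebra R"
abbreviation "mulK \<equiv> bilin_ext (mult R)"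

lemma sR: "u \<in> RR.A.FK \<Longrightarrow> v \<in> RR.A.FK \<Longrightarrow> u + v \<in> RR.A.FK" "u \<in> RR.A.FK \<Longrightarrow> pscale c u \<in> RR.A.FK"
  "0 \<in> RR.A.FK" "u \<in> RR.A.FK \<Longrightarrow> - u \<in> RR.A.FK"
  using pm.subspace_add[OF subspace_supported] pm.subspace_scale[OF subspace_supported]
    pm.subspace_0[OF subspace_supported] pm.subspace_neg[OF subspace_supported] by blast+

lemma RK_carrier: "carrier RK = RR.A.cls ` RR.A.FK"
  by (simp add: ratfun_algebra_def RR.A.tensor_carrier_eq)

lemma RK_add: "\<lbrakk>u \<in> RR.A.FK; v \<in> RR.A.FK\<rbrakk> \<Longrightarrow> RR.A.cls u \<oplus>\<^bsub>RK\<^esub> RR.A.cls v = RR.A.cls (u + v)"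
  by (simp add: ratfun_algebra_def RR.A.tensor_add_cls)

lemma RK_mult: "\<lbrakk>u \<in> RR.A.FK; v \<in> RR.A.FK\<rbrakk> \<Longrightarrow> RR.A.cls u \<otimes>\<^bsub>RK\<^esub> RR.A.cls v = RR.A.cls (mulK u v)"
  using RR.prod_cls[of u v] by (simp add: ratfun_algebra_def)

lemma RK_smult: "u \<in> RR.A.FK \<Longrightarrow> c \<odot>\<^bsub>RK\<^esub> RR.A.cls u = RR.A.cls (pscale c u)"
  using RR.A.smult_cls[of u c] by (simp add: ratfun_algebra_def)

lemma RK_zero: "\<zero>\<^bsub>RK\<^esub> = RR.A.cls 0"
  using RR.A.tensor_class_eq_cls[of 0] by (simp add: ratfun_algebra_def)

lemma one_FK: "Poly_Mapping.single \<one> 1 \<in> RR.A.FK"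
  by (rule supported_single) simp

lemma RK_one: "\<one>\<^bsub>RK\<^esub> = RR.A.cls (Poly_Mapping.single \<one> 1)"
  using RR.A.tensor_class_eq_cls[of "Poly_Mapping.single (\<one>, 1) 1", OF supported_single]
  by (simp add: ratfun_algebra_def)

lemma k_algebra_RK: "k_algebra RK"
proof -
  have ab: "abelian_group RK"
  proof (rule abelian_groupI)
    fix x assume "x \<in> carrier RK"
    then obtain u where u: "u \<in> RR.A.FK" "x = RR.A.cls u" unfolding RK_carrier by auto
    show "\<zero>\<^bsub>RK\<^esub> \<oplus>\<^bsub>RK\<^esub> x = x" using u sR(3) by (simp add: RK_zero RK_add)
    show "\<exists>y\<in>carrier RK. y \<oplus>\<^bsub>RK\<^esub> x = \<zero>\<^bsub>RK\<^esub>"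
      using u sR(4)[OF u(1)] RK_add[of "- u" u] unfolding RK_carrier RK_zero by auto
  next
    show "\<zero>\<^bsub>RK\<^esub> \<in> carrier RK" unfolding RK_carrier RK_zero using sR(3) by auto
  qed (auto simp: RK_carrier RK_add sR ac_simps)
  have mon: "monoid RK"
  proof (rule monoidI)
    show "\<one>\<^bsub>RK\<^esub> \<in> carrier RK" unfolding RK_carrier RK_one using one_FK by auto
    fix x assume "x \<in> carrier RK"
    then obtain u where u: "u \<in> RR.A.FK" "x = RR.A.cls u" unfolding RK_carrier by auto
    show "\<one>\<^bsub>RK\<^esub> \<otimes>\<^bsub>RK\<^esub> x = x" using u one_FK bilin_ext_unit_left[OF u(1), of "mult R" \<one>]
      by (simp add: RK_one RK_mult)
    show "x \<otimes>\<^bsub>RK\<^esub> \<one>\<^bsub>RK\<^esub> = x" using u one_FK bilin_ext_unit_right[OF u(1), of "mult R" \<one>]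
      by (simp add: RK_one RK_mult)
    fix y assume "y \<in> carrier RK"
    then obtain v where v: "v \<in> RR.A.FK" "y = RR.A.cls v" unfolding RK_carrier by auto
    show "x \<otimes>\<^bsub>RK\<^esub> y \<in> carrier RK" using u v RR.bilin_ext_FK by (simp add: RK_mult RK_carrier)
    fix z assume "z \<in> carrier RK"
    then obtain w where w: "w \<in> RR.A.FK" "z = RR.A.cls w" unfolding RK_carrier by auto
    show "x \<otimes>\<^bsub>RK\<^esub> y \<otimes>\<^bsub>RK\<^esub> z = x \<otimes>\<^bsub>RK\<^esub> (y \<otimes>\<^bsub>RK\<^esub> z)"
      using bilin_ext_assoc[OF u(1) v(1) w(1), of "mult R" "mult R" "mult R" "mult R"] u v w RR.bilin_ext_FK
      by (simp add: RK_mult m_assoc)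
  qed
  have rng: "ring RK"
  proof (rule ringI[OF ab mon])
    fix x y z assume "x \<in> carrier RK" "y \<in> carrier RK" "z \<in> carrier RK"
    then obtain u v w where u: "u \<in> RR.A.FK" "x = RR.A.cls u" and v: "v \<in> RR.A.FK" "y = RR.A.cls v"
      and w: "w \<in> RR.A.FK" "z = RR.A.cls w" unfolding RK_carrier by auto
    show "(x \<oplus>\<^bsub>RK\<^esub> y) \<otimes>\<^bsub>RK\<^esub> z = x \<otimes>\<^bsub>RK\<^esub> z \<oplus>\<^bsub>RK\<^esub> y \<otimes>\<^bsub>RK\<^esub> z"
      using u v w sR RR.bilin_ext_FK by (simp add: RK_add RK_mult bilin_ext_add_left)
    show "z \<otimes>\<^bsub>RK\<^esub> (x \<oplus>\<^bsub>RK\<^esub> y) = z \<otimes>\<^bsub>RK\<^esub> x \<oplus>\<^bsub>RK\<^esub> z \<otimes>\<^bsub>RK\<^esub> y"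
      using u v w sR RR.bilin_ext_FK by (simp add: RK_add RK_mult bilin_ext_add_right)
  qed
  have md: "Module.module class_ring RK"
    by (rule moduleI[OF cring_class_ring ab])
      (auto simp: RK_carrier RK_smult RK_add sR pm.scale_left_distrib pm.scale_right_distrib)
  show ?thesis
    by (rule k_algebra.intro[OF md rng], unfold_locales)
      (auto simp: RK_carrier RK_smult RK_mult sR RR.bilin_ext_FK bilin_ext_pscale_left bilin_ext_pscale_right)
qed

text \<open>An element of \<open>R_K\<close> is a set of representatives, but an action on the free
  space needs one vector. The choice is arbitrary and respects no operation, which is why the laws
  of \<open>gk_space\<close> that involve the algebra are stated modulo \<open>Z\<close>.\<close>

definition rep :: "('r \<times> 'k ratfun \<Rightarrow>\<^sub>0 'k) set \<Rightarrow> ('r \<Rightarrow>\<^sub>0 'k ratfun)" where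
  "rep X = (SOME a. a \<in> RR.A.FK \<and> RR.A.cls a = X)"

lemma rep: 
  assumes "X \<in> carrier RK"
  shows "rep X \<in> RR.A.FK" "RR.A.cls (rep X) = X"
  using someI_ex[of "\<lambda>a. a \<in> RR.A.FK \<and> RR.A.cls a = X"] assms unfolding RK_carrier rep_def by auto

lemma rep_diff:
  assumes "X \<in> carrier RK" "a \<in> RR.A.FK" "RR.A.cls a = X"
  shows "rep X - a \<in> RR.A.NullK"
  using RR.A.cls_eq_iff[OF rep(1)[OF assms(1)] assms(2)] rep(2)[OF assms(1)] assms(3) by simp

end

context right_module
begin

lemma act_smult:
  assumes "m \<in> carrier M" "r \<in> carrier R"
  shows "m \<cdot> (c \<odot>\<^bsub>R\<^esub> \<one>\<^bsub>R\<^esub>) \<cdot> r = m \<cdot> r \<cdot> (c \<odot>\<^bsub>R\<^esub> \<one>\<^bsub>R\<^esub>)"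
    "m \<cdot> (c \<odot>\<^bsub>R\<^esub> r) = m \<cdot> r \<cdot> (c \<odot>\<^bsub>R\<^esub> \<one>\<^bsub>R\<^esub>)"
  using assms by (simp_all add: act_mult[symmetric] smult_mult_left smult_mult_right)

lemma bilin_act_act: "bilin_act R (kspace R M) (act M)"
proof -
  interpret V: kmod "kspace R M" by (rule kmod.intro[OF kspace_module])
  show ?thesis
    by (rule bilin_act.intro[OF k_algebra_axioms V.kmod_axioms], rule bilin_act_axioms.intro)
      (auto simp: act_closed act_add_left act_add_right act_smult(1), simp add: act_smult(2))
qed

interpretation MR: bilin_act R "kspace R M" "act M"
  by (rule bilin_act_act)

abbreviation "actk u r \<equiv> lin_ext (\<lambda>m. m \<cdot> r) u"
abbreviation "actK v X \<equiv> bilin_ext (act M) v (rep X)"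

lemma gk_space_k: "gk_space R pscale actk MR.A.F MR.A.Null"
proof (unfold_locales)
  show "pm.subspace MR.A.F" by (rule subspace_supported)
  show "pm.subspace MR.A.Null" by (rule MR.A.subspace_Null)
  show "MR.A.Null \<subseteq> MR.A.F" by (auto simp: MR.A.Null_def)
  have F: "actk v s \<in> MR.A.F" if "v \<in> MR.A.F" "s \<in> carrier R" for v s
    using that by (auto elim!: lin_ext_supported simp: act_closed)
  then show "actk v s \<in> MR.A.F" if "v \<in> MR.A.F" "s \<in> carrier R" for v s using that .
  show "actk v s \<in> MR.A.Null" if "v \<in> MR.A.Null" "s \<in> carrier R" for v s
    using MR.lin_ext_Null[OF that] .
  show "actk (v + w) s = actk v s + actk w s" for v w s by (rule lin_ext_add)
  show "actk (pscale c v) s = pscale c (actk v s)" for c v s by (rule lin_ext_pscale)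
  fix v s t assume v: "v \<in> MR.A.F" and s: "s \<in> carrier R"
  have ev: "MR.A.ev v \<in> carrier M" using MR.A.ev_in[OF v] by simp
  show "actk v (c \<odot>\<^bsub>R\<^esub> s) - pscale c (actk v s) \<in> MR.A.Null" for c
  proof -
    have cs: "c \<odot>\<^bsub>R\<^esub> s \<in> carrier R" using s by simp
    show ?thesis
      unfolding MR.A.ev_diff_Null[OF F[OF v cs] pm.subspace_scale[OF subspace_supported F[OF v s]]]
        MR.ev_lin_ext_left[OF v cs] MR.A.ev_pscale[OF F[OF v s]] MR.ev_lin_ext_left[OF v s]
      by (simp only: kspace_simps act_smult(2)[OF ev s])
  qed
  assume t: "t \<in> carrier R"
  have st: "s \<oplus>\<^bsub>R\<^esub> t \<in> carrier R" "s \<otimes>\<^bsub>R\<^esub> t \<in> carrier R" using s t by auto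
  note evs = MR.ev_lin_ext_left[OF v]
  show "actk v (s \<oplus>\<^bsub>R\<^esub> t) - (actk v s + actk v t) \<in> MR.A.Null"
    unfolding MR.A.ev_diff_Null[OF F[OF v st(1)] pm.subspace_add[OF subspace_supported F[OF v s] F[OF v t]]]
      MR.A.ev_add[OF F[OF v s] F[OF v t]] evs[OF st(1)] evs[OF s] evs[OF t] kspace_simps
    by (rule act_add_right[OF ev s t])
  show "actk v (s \<otimes>\<^bsub>R\<^esub> t) - actk (actk v s) t \<in> MR.A.Null"
    unfolding MR.A.ev_diff_Null[OF F[OF v st(2)] F[OF F[OF v s] t]]
      MR.ev_lin_ext_left[OF F[OF v s] t] evs[OF st(2)] evs[OF s]
    by (rule act_mult[OF ev s t])
next
  fix v assume v: "v \<in> MR.A.F"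
  have ev: "MR.A.ev v \<in> carrier M" using MR.A.ev_in[OF v] by simp
  have "actk v \<one>\<^bsub>R\<^esub> \<in> MR.A.F" using v by (auto elim!: lin_ext_supported simp: act_closed)
  then show "actk v \<one>\<^bsub>R\<^esub> - v \<in> MR.A.Null"
    unfolding MR.A.ev_diff_Null[OF \<open>actk v \<one>\<^bsub>R\<^esub> \<in> MR.A.F\<close> v] MR.ev_lin_ext_left[OF v one_closed]
    using act_one[OF ev] by simp
qed

text \<open>Permits replacing the arbitrary representative by one adapted to the law at hand, such
  as a sum or product of representatives.\<close>

lemma bilin_rep_cong:
  assumes v: "v \<in> MR.A.FK" and X: "X \<in> carrier RK" and a: "a \<in> MR.B.FK" "MR.B.cls a = X"
  shows "actK v X - bilin_ext (act M) v a \<in> MR.A.NullK"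
  using MR.NullK_right[OF v rep_diff[OF X a]] by (simp add: bilin_ext_diff_right)

lemma gk_space_K: "gk_space RK pscale actK MR.A.FK MR.A.NullK"
proof (rule gk_space.intro[OF k_algebra_RK], unfold_locales)
  note add = pm.subspace_add[OF MR.A.subspace_NullK]
  show "pm.subspace MR.A.FK" by (rule subspace_supported)
  show "pm.subspace MR.A.NullK" by (rule MR.A.subspace_NullK)
  show "MR.A.NullK \<subseteq> MR.A.FK" by (rule MR.A.NullK_supported)
  have F: "actK v s \<in> MR.A.FK" if "v \<in> MR.A.FK" "s \<in> carrier RK" for v s
    using MR.bilin_ext_FK[OF that(1) rep(1)[OF that(2)]] .
  then show "actK v s \<in> MR.A.FK" if "v \<in> MR.A.FK" "s \<in> carrier RK" for v s using that .
  show "actK v s \<in> MR.A.NullK" if "v \<in> MR.A.NullK" "s \<in> carrier RK" for v s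
    using MR.NullK_left[OF that(1) rep(1)[OF that(2)]] .
  show "actK (v + w) s = actK v s + actK w s" for v w s by (rule bilin_ext_add_left)
  show "actK (pscale c v) s = pscale c (actK v s)" for c v s by (rule bilin_ext_pscale_left)
  fix v s t assume v: "v \<in> MR.A.FK" and s: "s \<in> carrier RK"
  interpret RKa: k_algebra RK by (rule k_algebra_RK)
  note rs = rep[OF s]
  show "actK v (c \<odot>\<^bsub>RK\<^esub> s) - pscale c (actK v s) \<in> MR.A.NullK" for c
    using bilin_rep_cong[OF v, of "c \<odot>\<^bsub>RK\<^esub> s" "pscale c (rep s)"] RK_smult[OF rs(1), of c] rs s sR(2)[OF rs(1)]
    by (simp add: bilin_ext_pscale_right)
  assume t: "t \<in> carrier RK"
  note rt = rep[OF t]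
  show "actK v (s \<oplus>\<^bsub>RK\<^esub> t) - (actK v s + actK v t) \<in> MR.A.NullK"
    using bilin_rep_cong[OF v, of "s \<oplus>\<^bsub>RK\<^esub> t" "rep s + rep t"] RK_add[OF rs(1) rt(1)] rs rt s t sR(1)[OF rs(1) rt(1)]
    by (simp add: bilin_ext_add_right)
  have "bilin_ext (act M) (bilin_ext (act M) v (rep s)) (rep t) = bilin_ext (act M) v (bilin_ext (mult R) (rep s) (rep t))"
    by (rule bilin_ext_assoc[OF v rs(1) rt(1)]) (simp add: act_mult)
  then show "actK v (s \<otimes>\<^bsub>RK\<^esub> t) - actK (actK v s) t \<in> MR.A.NullK"
    using bilin_rep_cong[OF v, of "s \<otimes>\<^bsub>RK\<^esub> t" "mulK (rep s) (rep t)"] RK_mult[OF rs(1) rt(1)] rs rt s t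
      bilin_act.bilin_ext_FK[OF bilin_act_mult rs(1) rt(1)]
    by simp
next
  interpret RKa: k_algebra RK by (rule k_algebra_RK)
  fix v assume v: "v \<in> MR.A.FK"
  have "bilin_ext (act M) v (Poly_Mapping.single \<one>\<^bsub>R\<^esub> 1) = v"
    by (rule bilin_ext_unit_right[OF v]) (simp add: act_one)
  then show "actK v \<one>\<^bsub>RK\<^esub> - v \<in> MR.A.NullK"
    using bilin_rep_cong[OF v, of "\<one>\<^bsub>RK\<^esub>", OF _ one_FK RK_one[symmetric]] by simp
qed

lemma presents_k: "gk_space.presents R pscale actk MR.A.F MR.A.Null MR.A.F MR.A.Null M MR.A.ev"
proof -
  interpret G: gk_space R pscale actk MR.A.F MR.A.Null by (rule gk_space_k)
  show ?thesis
  proof (rule G.presentsI[OF G.submod_T G.submod_Z G.Z_T])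
    show "carrier M = MR.A.ev ` MR.A.F"
    proof (intro equalityI subsetI)
      fix m assume m: "m \<in> carrier M"
      then have "m = MR.A.ev (Poly_Mapping.single m 1)" using MR.A.ev_single[of m 1] MR.A.smult_one[of m] by simp
      moreover have "Poly_Mapping.single m 1 \<in> MR.A.F" by (rule supported_single) (simp add: m)
      ultimately show "m \<in> MR.A.ev ` MR.A.F" by (rule image_eqI)
    qed (use MR.A.ev_in in auto)
  qed (auto simp: MR.A.ev_add MR.ev_lin_ext_left MR.A.ev_diff_Null)
qed

lemma presents_K: "gk_space.presents RK pscale actK MR.A.FK MR.A.NullK MR.A.FK MR.A.NullK (ratfun_module R M) MR.A.cls"
proof -
  interpret G: gk_space RK pscale actK MR.A.FK MR.A.NullK by (rule gk_space_K)
  show ?thesis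
  proof (rule G.presentsI[OF G.submod_T G.submod_Z G.Z_T])
    show "carrier (ratfun_module R M) = MR.A.cls ` MR.A.FK"
      by (simp add: ratfun_module_def MR.A.tensor_carrier_eq)
    show "\<zero>\<^bsub>ratfun_module R M\<^esub> = MR.A.cls 0"
      using MR.A.tensor_class_eq_cls[of 0] by (simp add: ratfun_module_def)
    fix a assume a: "a \<in> MR.A.FK"
    show "MR.A.cls (a + b) = MR.A.cls a \<oplus>\<^bsub>ratfun_module R M\<^esub> MR.A.cls b" if "b \<in> MR.A.FK" for b
      using MR.A.tensor_add_cls[OF a that] by (simp add: ratfun_module_def)
    show "MR.A.cls a = MR.A.cls b \<longleftrightarrow> a - b \<in> MR.A.NullK" if "b \<in> MR.A.FK" for b
      by (rule MR.A.cls_eq_iff[OF a that])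
    fix s assume s: "s \<in> carrier RK"
    show "MR.A.cls (actK a s) = MR.A.cls a \<cdot>\<^bsub>ratfun_module R M\<^esub> s"
      using MR.prod_cls[OF a rep(1)[OF s]] rep(2)[OF s] by (simp add: ratfun_module_def)
  qed
qed

end

section \<open>Extension of scalars and GK dimension\<close>

definition lin_fun :: "('k::field ratfun \<Rightarrow> 'k) \<Rightarrow> bool" where
  "lin_fun l \<longleftrightarrow> (\<forall>f g. l (f + g) = l f + l g) \<and> (\<forall>c f. l (kconst c * f) = c * l f)"

lemma lin_funD:
  assumes "lin_fun l"
  shows "l (f + g) = l f + l g" "l (kconst c * f) = c * l f" "l 0 = 0" "l (- f) = - l f"
proof -
  show 1: "l (f + g) = l f + l g" "l (kconst c * f) = c * l f" for f g c using assms by (auto simp: lin_fun_def)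
  show "l 0 = 0" using 1(2)[of 0 0] by simp
  then show "l (- f) = - l f" using 1(1)[of f "- f"] by (simp add: eq_neg_iff_add_eq_0 add.commute)
qed

lemma lin_fun_mult: "lin_fun l \<Longrightarrow> lin_fun (\<lambda>f. l (g * f))"
  by (simp add: lin_fun_def distrib_left mult.left_commute[of g])

interpretation rv: vector_space "\<lambda>c f. kconst c * (f :: 'k::field ratfun)"
  by unfold_locales (auto simp: algebra_simps)

lemma lin_fun_extend:
  fixes g :: "'k::field ratfun \<Rightarrow> 'k"
  assumes "rv.independent B"
  shows "\<exists>l. lin_fun l \<and> (\<forall>b\<in>B. l b = g b)"
proof -
  interpret vector_space_pair "\<lambda>c f. kconst c * (f :: 'k ratfun)" "(*) :: 'k \<Rightarrow> 'k \<Rightarrow> 'k"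
    by unfold_locales (auto simp: algebra_simps)
  obtain l where l: "Vector_Spaces.linear (\<lambda>c f. kconst c * f) (*) l" "\<forall>b\<in>B. l b = g b"
    using linear_independent_extend[OF assms, of g] by auto
  then show ?thesis using linear_add[OF l(1)] linear_scale[OF l(1)] unfolding lin_fun_def by blast
qed

text \<open>A nonzero \<open>f\<close> is independent by itself, so some functional takes the value
  \<open>1\<close> at \<open>f\<close>.\<close>

lemma lin_fun_separates: "(\<And>l. lin_fun l \<Longrightarrow> l f = 0) \<Longrightarrow> f = 0"
  using lin_fun_extend[of "{f}" "\<lambda>_. 1"] by (metis insertI1 rv.dependent_single zero_neq_one)

definition pfract :: "'k::field poly \<Rightarrow> 'k ratfun" where
  "pfract p = Fract p 1"

lemma pfract_simps [simp]: "pfract 0 = 0" "pfract (p + q) = pfract p + pfract q" "pfract (p * q) = pfract p * pfract q"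
  "pfract [:c:] = kconst c"
  by (auto simp: pfract_def kconst_def Zero_fract_def)

lemma pfract_eq_0_iff [simp]: "pfract p = 0 \<longleftrightarrow> p = 0"
  by (simp add: pfract_def Zero_fract_def eq_fract)

definition xK :: "'k::field ratfun" where
  "xK = pfract [:0, 1:]"

lemma pfract_pCons: "pfract (pCons a p) = kconst a + xK * pfract p"
proof -
  have "pCons a p = [:a:] + [:0, 1:] * p" by simp
  then show ?thesis unfolding xK_def by (metis pfract_simps(2-4))
qed

lemma pfract_expand: "(\<And>i. i \<ge> n \<Longrightarrow> coeff p i = 0) \<Longrightarrow> pfract p = (\<Sum>i<n. kconst (coeff p i) * xK ^ i)"
proof (induction p arbitrary: n)
  case (pCons a p)
  show ?case
  proof (cases n)
    case 0
    then have "pCons a p = 0" using pCons.prems by (intro poly_eqI) auto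
    then show ?thesis by (simp add: 0)
  next
    case (Suc m)
    have "coeff p i = 0" if "i \<ge> m" for i using pCons.prems[of "Suc i"] that Suc by simp
    then have "pfract p = (\<Sum>i<m. kconst (coeff p i) * xK ^ i)" by (rule pCons.IH)
    then show ?thesis by (simp add: Suc pfract_pCons sum.lessThan_Suc_shift sum_distrib_left mult.left_commute del: sum.lessThan_Suc)
  qed
qed simp

lemma xK_power_eq: "xK ^ i = pfract (monom 1 i)"
  by (induction i) (auto simp: monom_0 monom_Suc pfract_pCons)

lemma inj_xK_power: "inj (\<lambda>i. (xK :: 'k::field ratfun) ^ i)"
proof (rule injI)
  fix i j assume "(xK :: 'k ratfun) ^ i = xK ^ j"
  then have "pfract (monom 1 i - monom (1::'k) j) = 0"
    using pfract_simps(2)[of "monom 1 i - monom (1::'k) j" "monom 1 j"] by (simp add: xK_power_eq)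
  then have "monom 1 i = monom (1::'k) j" by simp
  then show "i = j" by (metis coeff_monom zero_neq_one)
qed

lemma independent_powers: "rv.independent (range (\<lambda>i. (xK :: 'k::field ratfun) ^ i))"
proof -
  have inj: "inj (\<lambda>i. (xK :: 'k ratfun) ^ i)" by (rule inj_xK_power)
  show ?thesis unfolding rv.independent_explicit_finite_subsets
  proof (intro allI impI ballI)
    fix S u v assume S: "S \<subseteq> range (\<lambda>i. (xK :: 'k ratfun) ^ i)" "finite S" "(\<Sum>v\<in>S. kconst (u v) * v) = 0" "v \<in> S"
    obtain I where I: "S = (\<lambda>i. xK ^ i) ` I" using S(1) by (metis subset_image_iff)
    have fI: "finite I" using S(2) I inj finite_imageD inj_on_subset by blast
    have ip: "inj_on (\<lambda>i. (xK :: 'k ratfun) ^ i) I" using inj inj_on_subset by blast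
    have "pfract (\<Sum>i\<in>J. monom (u (xK ^ i)) i) = (\<Sum>i\<in>J. kconst (u (xK ^ i)) * xK ^ i)" for J
    proof (induction J rule: infinite_finite_induct)
      case (insert i J)
      have "monom (u (xK ^ i)) i = [:u (xK ^ i):] * monom 1 i" by (simp add: smult_monom)
      then have "pfract (monom (u (xK ^ i)) i) = kconst (u (xK ^ i)) * xK ^ i" by (simp only: pfract_simps xK_power_eq)
      then show ?case using insert by simp
    qed auto
    then have "pfract (\<Sum>i\<in>I. monom (u (xK ^ i)) i) = (\<Sum>v\<in>S. kconst (u v) * v)"
      unfolding I by (simp add: sum.reindex[OF ip])
    then have z: "(\<Sum>i\<in>I. monom (u (xK ^ i)) i) = 0" using S(3) by simp
    obtain j where j: "j \<in> I" "v = xK ^ j" using S(4) I by auto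
    have "coeff (\<Sum>i\<in>I. monom (u (xK ^ i)) i) j = u (xK ^ j)"
      using fI j(1) by (simp add: coeff_sum)
    then show "u v = 0" using z j(2) by simp
  qed
qed

text \<open>On polynomials this reads off the coefficient of \<open>x^n\<close>. It is a functional
  on all of \<open>K\<close>, obtained by extension from the independent powers of \<open>x\<close>;
  its values outside the polynomials are arbitrary.\<close>

definition cfun :: "nat \<Rightarrow> 'k::field ratfun \<Rightarrow> 'k" where
  "cfun n = (SOME l. lin_fun l \<and> (\<forall>i. l (xK ^ i) = (if i = n then 1 else 0)))"

lemma cfun: "lin_fun (cfun n :: 'k::field ratfun \<Rightarrow> 'k)" "cfun n ((xK :: 'k ratfun) ^ i) = (if i = n then 1 else 0)"
proof -
  have inj: "inj (\<lambda>i. (xK :: 'k ratfun) ^ i)" by (rule inj_xK_power)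
  obtain l where "lin_fun l" "\<forall>b\<in>range (\<lambda>i. (xK :: 'k ratfun) ^ i). l b = (if b = xK ^ n then 1 else 0)"
    using lin_fun_extend[OF independent_powers, of "\<lambda>b. if b = xK ^ n then 1 else 0"] by auto
  then have "lin_fun l \<and> (\<forall>i. l ((xK :: 'k ratfun) ^ i) = (if i = n then 1 else 0))"
    using inj by (auto simp: inj_eq)
  then have "lin_fun (cfun n :: 'k ratfun \<Rightarrow> 'k) \<and> (\<forall>i. cfun n ((xK :: 'k ratfun) ^ i) = (if i = n then 1 else 0))"
    unfolding cfun_def
    by (rule someI[where P = "\<lambda>l. lin_fun l \<and> (\<forall>i. l (xK ^ i) = (if i = n then 1 else 0))"])
  then show "lin_fun (cfun n :: 'k ratfun \<Rightarrow> 'k)" "cfun n ((xK :: 'k ratfun) ^ i) = (if i = n then 1 else 0)" by auto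
qed

lemma lin_fun_sum: "lin_fun l \<Longrightarrow> l (\<Sum>i\<in>I. f i) = (\<Sum>i\<in>I. l (f i))"
  by (induction I rule: infinite_finite_induct) (auto simp: lin_funD)

lemma cfun_one [simp]: "cfun 0 1 = 1"
  using cfun(2)[of 0 0] by simp

lemma cfun_pfract:
  fixes p :: "'k::field poly"
  shows "cfun n (pfract p) = coeff p n"
proof -
  let ?m = "Suc (max n (degree p))"
  have "pfract p = (\<Sum>i<?m. kconst (coeff p i) * xK ^ i)"
    by (rule pfract_expand) (auto intro: coeff_eq_0)
  then show ?thesis 
    by (simp add: cfun lin_fun_sum[OF cfun(1)] lin_funD[OF cfun(1)] if_distrib[of "\<lambda>x. _ * x"] sum.delta cong: if_cong del: sum.lessThan_Suc)
qed

lemma common_denominator: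
  fixes S :: "'k::field ratfun set"
  assumes "finite S"
  shows "\<exists>q. q \<noteq> 0 \<and> (\<forall>f\<in>S. pfract q * f \<in> range pfract)"
  using assms
proof (induction S rule: finite_induct)
  case empty
  show ?case by (intro exI[of _ 1]) auto
next
  case (insert f S)
  then obtain q where q: "q \<noteq> 0" "\<forall>f\<in>S. pfract q * f \<in> range pfract" by auto
  obtain a b where ab: "f = Fract a b" "b \<noteq> 0" by (cases f) auto
  have bf: "pfract b * f = pfract a" using ab by (simp add: pfract_def eq_fract)
  show ?case
  proof (intro exI[of _ "b * q"] conjI ballI)
    show "b * q \<noteq> 0" using q ab by simp
    fix g assume "g \<in> insert f S"
    then show "pfract (b * q) * g \<in> range pfract"
    proof
      assume "g = f"
      then have "pfract (b * q) * g = pfract (q * a)" using bf by (simp add: ac_simps)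
      then show ?thesis by blast
    next
      assume "g \<in> S"
      then obtain c where "pfract q * g = pfract c" using q by auto
      then have "pfract (b * q) * g = pfract (b * c)" by (simp add: mult.assoc)
      then show ?thesis by blast
    qed
  qed
qed

text \<open>For linear \<open>l\<close> this is the map \<open>id \<otimes> l\<close>. It sends
  \<open>NullK\<close> into \<open>Null\<close>, so it descends to a \<open>k\<close>-linear map
  from \<open>M_K\<close> to \<open>M\<close>.\<close>

definition Lam :: "('k::field ratfun \<Rightarrow> 'k) \<Rightarrow> ('m \<Rightarrow>\<^sub>0 'k ratfun) \<Rightarrow> ('m \<Rightarrow>\<^sub>0 'k)" where
  "Lam l u = Poly_Mapping.map l u"

context
  fixes l :: "'k::field ratfun \<Rightarrow> 'k"
  assumes l: "lin_fun l"
begin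

lemma lookup_Lam: "Poly_Mapping.lookup (Lam l u) x = l (Poly_Mapping.lookup u x)"
  by (simp add: Lam_def Poly_Mapping.map.rep_eq when_def lin_funD[OF l])

lemma Lam_add: "Lam l (u + v) = Lam l u + Lam l v"
  and Lam_0: "Lam l 0 = 0"
  and Lam_pscale_emb: "Lam l (pscale f (emb w)) = pscale (l f) w"
  by (auto intro!: poly_mapping_eqI simp: lookup_add lookup_Lam lin_funD[OF l] mult.commute[of _ "kconst _"])

lemma Lam_diff: "Lam l (u - v) = Lam l u - Lam l v"
  using Lam_add[of "u - v" v] by (simp add: algebra_simps)

lemma Lam_sum: "Lam l (\<Sum>i\<in>I. f i) = (\<Sum>i\<in>I. Lam l (f i))"
  by (induction I rule: infinite_finite_induct) (auto simp: Lam_add Lam_0)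

lemma Lam_supported: "u \<in> supported C \<Longrightarrow> Lam l u \<in> supported C"
  using lin_funD(3)[OF l] by (auto simp: supported_def in_keys_iff lookup_Lam subset_iff) metis

lemma Lam_emb: "Lam l (emb u) = pscale (l 1) u"
  using Lam_pscale_emb[of 1 u] by simp

end

lemma Lam_pscale: "lin_fun l \<Longrightarrow> Lam l (pscale f u) = Lam (\<lambda>g. l (f * g)) u"
  by (rule poly_mapping_eqI) (simp add: lookup_Lam lin_fun_mult)

context kmod
begin

lemma Lam_NullK:
  assumes l: "lin_fun l" and "v \<in> NullK"
  shows "Lam l v \<in> Null"
  using assms(2) unfolding NullK_def
proof (induction rule: pm.span_induct_alt)
  case base
  then show ?case using pm.subspace_0[OF subspace_Null] by (simp add: Lam_0[OF l])
next
  case (step c x y)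
  then obtain n where "n \<in> Null" "x = emb n" by auto
  then show ?case using step(2)
    by (auto simp: Lam_add[OF l] Lam_pscale_emb[OF l] 
        intro!: pm.subspace_add[OF subspace_Null] pm.subspace_scale[OF subspace_Null])
qed

end

text \<open>The vectors without denominators, that is, those of \<open>M[x]\<close> inside
  \<open>M_K\<close> at the level of free spaces.\<close>

definition integral :: "('m \<Rightarrow>\<^sub>0 'k::field ratfun) \<Rightarrow> bool" where
  "integral v \<longleftrightarrow> (\<forall>a. Poly_Mapping.lookup v a \<in> range pfract)"

lemma integral_expand:
  fixes v :: "'m \<Rightarrow>\<^sub>0 'k::field ratfun"
  assumes "integral v"
  obtains n where "\<And>j. j \<ge> n \<Longrightarrow> Lam (cfun j) v = 0"
    "\<And>m. m \<ge> n \<Longrightarrow> v = (\<Sum>j<m. pscale (xK ^ j) (emb (Lam (cfun j) v)))"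
proof -
  have "\<forall>a. \<exists>p. Poly_Mapping.lookup v a = pfract p" using assms unfolding integral_def by blast
  then obtain p where p: "\<And>a. Poly_Mapping.lookup v a = pfract (p a)" by metis
  \<comment> \<open>\<open>Suc\<close> makes \<open>n\<close> exceed every degree that occurs, and
    the inserted \<open>0\<close> keeps the maximum meaningful when the support is empty.\<close>
  define n where "n = Suc (Max (insert 0 (degree ` p ` Poly_Mapping.keys v)))"
  have deg: "coeff (p a) j = 0" if "j \<ge> n" for a j
  proof (cases "a \<in> Poly_Mapping.keys v")
    case True
    then have "degree (p a) \<le> Max (insert 0 (degree ` p ` Poly_Mapping.keys v))" by (intro Max_ge) auto
    then show ?thesis using that by (intro coeff_eq_0) (auto simp: n_def)
  next
    case False
    then have "pfract (p a) = 0" using p[of a] by (simp add: in_keys_iff)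
    then show ?thesis by simp
  qed
  have lam: "Poly_Mapping.lookup (Lam (cfun j) v) a = coeff (p a) j" for j a
    by (simp add: lookup_Lam[OF cfun(1)] p cfun_pfract)
  show thesis
  proof (rule that[of n])
    show "Lam (cfun j) v = 0" if "j \<ge> n" for j
      by (rule poly_mapping_eqI) (simp add: lam deg that)
    show "v = (\<Sum>j<m. pscale (xK ^ j) (emb (Lam (cfun j) v)))" if "m \<ge> n" for m
    proof (rule poly_mapping_eqI)
      fix a
      have "pfract (p a) = (\<Sum>j<m. kconst (coeff (p a) j) * xK ^ j)"
        by (rule pfract_expand) (use deg that in auto)
      then show "Poly_Mapping.lookup v a = Poly_Mapping.lookup (\<Sum>j<m. pscale (xK ^ j) (emb (Lam (cfun j) v))) a"
        by (simp add: p lookup_sum lam mult.commute)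
    qed
  qed
qed

lemma clear_denominators:
  fixes S :: "('m \<Rightarrow>\<^sub>0 'k::field ratfun) set"
  assumes "finite S"
  obtains q where "q \<noteq> 0" "\<And>v. v \<in> S \<Longrightarrow> integral (pscale (pfract q) v)"
proof -
  let ?S = "\<Union>v\<in>S. Poly_Mapping.lookup v ` Poly_Mapping.keys v"
  have "finite ?S" using assms by auto
  from common_denominator[OF this] obtain q where q: "q \<noteq> 0" "\<And>f. f \<in> ?S \<Longrightarrow> pfract q * f \<in> range pfract" by auto
  show thesis
  proof (rule that[of q, OF q(1)])
    fix v assume v: "v \<in> S"
    have "pfract q * Poly_Mapping.lookup v a \<in> range pfract" for a
    proof (cases "a \<in> Poly_Mapping.keys v")
      case True then show ?thesis using q(2) v by auto
    next
      case False
      then have "pfract q * Poly_Mapping.lookup v a = pfract 0" by (simp add: in_keys_iff)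
      then show ?thesis by blast
    qed
    then show "integral (pscale (pfract q) v)" by (simp add: integral_def)
  qed
qed

section \<open>Equality of the dimensions over \<open>k\<close> and over \<open>K\<close>\<close>

context right_module
begin

interpretation MR: bilin_act R "kspace R M" "act M"
  by (rule bilin_act_act)

interpretation Gk: gk_space R pscale actk MR.A.F MR.A.Null
  by (rule gk_space_k)

interpretation GK: gk_space RK pscale actK MR.A.FK MR.A.NullK
  by (rule gk_space_K)

lemma emb_span: "u \<in> pm.span I \<Longrightarrow> emb u \<in> pm.span (emb ` I)"
  by (induction rule: pm.span_induct_alt)
    (auto simp: emb_add emb_pscale intro!: pm.span_zero pm.span_add pm.span_scale intro: pm.span_base)

lemma span_emb_singles:
  fixes v :: "'x \<Rightarrow>\<^sub>0 'k::field ratfun"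
  shows "v \<in> supported C \<Longrightarrow> v \<in> pm.span (emb ` (\<lambda>m. Poly_Mapping.single m 1) ` C)"
  unfolding supported_def mem_Collect_eq
proof (induction rule: poly_mapping_lin_induct)
  case (single x c)
  have "pscale c (emb (Poly_Mapping.single x 1)) \<in> pm.span (emb ` (\<lambda>m. Poly_Mapping.single m 1) ` C)"
    using single by (intro pm.span_scale pm.span_base imageI)
  then show ?case by simp
qed (auto intro: pm.span_zero pm.span_add)

text \<open>If generators over \<open>K\<close> are combinations of \<open>W1\<close> and
  \<open>V1\<close>, which live over \<open>k\<close>, then their products are
  \<open>K\<close>-combinations of products formed entirely over \<open>k\<close>.\<close>

lemma gens_K_subset:
  assumes W: "W \<subseteq> pm.span (emb ` W1)" and V: "\<And>X. X \<in> V \<Longrightarrow> rep X \<in> supported V1"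
  shows "GK.gens W V n \<subseteq> pm.span (emb ` Gk.gens W1 V1 n)"
proof (induction n)
  case (Suc n)
  have "bilin_ext (act M) g a \<in> pm.span (emb ` Gk.gens W1 V1 (Suc n))"
    if g: "g \<in> pm.span (emb ` Gk.gens W1 V1 n)" and a: "a \<in> supported V1" for g a
    using g
  proof (induction rule: pm.span_induct_alt)
    case (step c x y)
    then obtain u where u: "u \<in> Gk.gens W1 V1 n" "x = emb u" by auto
    have "bilin_ext (act M) x a \<in> pm.span (emb ` Gk.gens W1 V1 (Suc n))"
      using a unfolding supported_def mem_Collect_eq
    proof (induction rule: poly_mapping_lin_induct)
      case (single r f)
      have "actk u r \<in> Gk.gens W1 V1 (Suc n)" using u(1) single by auto
      then show ?case unfolding u(2) MR.bilin_ext_emb_single by (intro pm.span_scale pm.span_base imageI)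
    qed (auto simp: bilin_ext_add_right intro: pm.span_zero pm.span_add simp del: Gk.gens.simps)
    then show ?case using step(2)
      by (auto simp: bilin_ext_add_left bilin_ext_pscale_left intro!: pm.span_add pm.span_scale simp del: Gk.gens.simps)
  qed (auto intro: pm.span_zero)
  then show ?case using Suc V by (auto simp del: Gk.gens.simps)
qed (use W in auto)

text \<open>\<open>M_K/B\<close> is a quotient of \<open>(M/L)_K\<close>. The finite sets
  \<open>W\<close> and \<open>V\<close> over \<open>K\<close> involve only finitely many basis
  elements, collected in \<open>W1\<close> and \<open>V1\<close>, and a \<open>k\<close>-basis
  modulo \<open>L\<close> of the products of these spans all products of \<open>W\<close> and
  \<open>V\<close> modulo \<open>B\<close>.\<close>

lemma gkr_extend_le:
  assumes L: "Gk.submod L" and B: "GK.submod B" and LB: "emb ` L \<subseteq> B"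
  shows "GK.gkr MR.A.FK B \<le> Gk.gkr MR.A.F L"
proof (cases "MR.A.FK \<subseteq> B")
  case True
  then show ?thesis using Gk.gkr_ge by (simp add: GK.gkr_eq)
next
  case False
  note sB = GK.submodD(3)[OF B] and sL = Gk.submodD(3)[OF L]
  have ne: "\<not> MR.A.F \<subseteq> L"
  proof
    assume "MR.A.F \<subseteq> L"
    then have "emb ` MR.A.F \<subseteq> B" using LB by blast
    then have "MR.A.FK \<subseteq> B" unfolding MR.A.supported_span by (rule pm.span_minimal[OF _ sB])
    then show False using False by simp
  qed
  show ?thesis
  proof (rule GK.gkr_leI[OF False])
    fix W V assume W: "finite W" "W \<subseteq> MR.A.FK" and V: "finite V" "V \<subseteq> carrier RK"
    define C where "C = (\<Union>w\<in>W. Poly_Mapping.keys w)"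
    define W1 :: "('m \<Rightarrow>\<^sub>0 'k) set" where "W1 = (\<lambda>m. Poly_Mapping.single m 1) ` C"
    define V1 where "V1 = (\<Union>X\<in>V. Poly_Mapping.keys (rep X))"
    have C: "C \<subseteq> carrier M" using W unfolding C_def supported_def by auto
    have W1: "finite W1" "W1 \<subseteq> MR.A.F" using W C unfolding W1_def by (auto simp: C_def supported_def)
    have V1: "finite V1" "V1 \<subseteq> carrier R" using V rep(1) unfolding V1_def by (auto simp: supported_def)
    have WW: "W \<subseteq> pm.span (emb ` W1)"
      unfolding W1_def by (auto intro!: span_emb_singles simp: C_def supported_def)
    have VV: "rep X \<in> supported V1" if "X \<in> V" for X using that by (auto simp: V1_def supported_def)
    have "GK.gkr1 B W V \<le> Gk.gkr1 L W1 V1"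
    proof (rule gkr1_mono_gen[OF GK.gk_space_axioms Gk.gk_space_axioms])
      fix n
      let ?H = "Gk.gens W1 V1 n"
      have fH: "finite ?H" using Gk.finite_gens[OF W1(1) V1(1)] .
      obtain I where I: "I \<subseteq> ?H" "card I = pm.rank_mod L ?H" "?H \<subseteq> pm.span_mod L I"
        using pm.rank_mod_basis[OF sL fH] by metis
      have fI: "finite I" using I fH finite_subset by blast
      have "emb ` ?H \<subseteq> pm.span_mod B (emb ` I)"
      proof (rule image_subsetI)
        fix h assume "h \<in> ?H"
        then obtain y where y: "y \<in> pm.span I" "h - y \<in> L" using I(3) by (auto simp: pm.span_mod_def)
        have "emb h - emb y \<in> B" using y(2) LB by (auto simp: emb_diff[symmetric])
        then show "emb h \<in> pm.span_mod B (emb ` I)" using emb_span[OF y(1)] by (auto simp: pm.span_mod_def)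
      qed
      then have "pm.span (emb ` ?H) \<subseteq> pm.span_mod B (emb ` I)"
        by (rule pm.span_minimal[OF _ pm.subspace_span_mod[OF sB]])
      then have "GK.gens W V n \<subseteq> pm.span_mod B (emb ` I)" using gens_K_subset[OF WW VV, of V n] by blast
      then have "pm.rank_mod B (GK.gens W V n) \<le> card (emb ` I)"
        using fI GK.finite_gens[OF W(1) V(1)] by (intro pm.rank_mod_le[OF sB]) auto
      also have "\<dots> \<le> pm.rank_mod L ?H" using card_image_le[OF fI] I(2) by metis
      finally show "pm.rank_mod B (GK.gens W V n) \<le> pm.rank_mod L ?H" .
    qed
    also have "\<dots> \<le> Gk.gkr MR.A.F L" using ne W1 V1 by (intro Gk.gkr1_le_gkr) auto
    finally show "GK.gkr1 B W V \<le> Gk.gkr MR.A.F L" .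
  qed
qed

definition incl :: "'r \<Rightarrow> ('r \<times> 'k ratfun \<Rightarrow>\<^sub>0 'k) set" where
  "incl r = MR.B.cls (Poly_Mapping.single r 1)"

lemma single_FK: "r \<in> carrier R \<Longrightarrow> Poly_Mapping.single r c \<in> MR.B.FK"
  by (rule supported_single)

lemma incl_carrier: "r \<in> carrier R \<Longrightarrow> incl r \<in> carrier RK"
  unfolding RK_carrier incl_def using single_FK by blast

lemma actK_incl:
  assumes "v \<in> MR.A.FK" "r \<in> carrier R"
  shows "actK v (incl r) - bilin_ext (act M) v (Poly_Mapping.single r 1) \<in> MR.A.NullK"
  by (rule bilin_rep_cong[OF assms(1) incl_carrier[OF assms(2)] single_FK[OF assms(2)]]) (simp add: incl_def)

lemma actK_emb_incl:
  assumes "u \<in> MR.A.F" "r \<in> carrier R"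
  shows "actK (emb u) (incl r) - emb (actk u r) \<in> MR.A.NullK"
  using actK_incl[of "emb u" r] assms MR.bilin_ext_emb_single[of u r 1] by simp

text \<open>Applying a functional \<open>l\<close> to a relation over \<open>K\<close> among the
  \<open>emb i\<close> gives a relation over \<open>k\<close> with coefficients
  \<open>l (c (emb i))\<close>. These vanish for every \<open>l\<close>, and functionals separate
  elements of \<open>K\<close>.\<close>

lemma emb_indep:
  assumes I: "pm.indep_mod MR.A.Null I"
  shows "pm.indep_mod MR.A.NullK (emb ` I)" "card (emb ` I) = card I"
proof -
  have inj: "inj_on emb I"
  proof (rule inj_onI)
    fix u v :: "'m \<Rightarrow>\<^sub>0 'k" assume "emb u = emb v"
    then have "Lam (cfun 0) (emb u) = Lam (cfun 0) (emb v)" by simp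
    then show "u = v" by (simp add: Lam_emb[OF cfun(1)])
  qed
  show "card (emb ` I) = card I" by (rule card_image[OF inj])
  show "pm.indep_mod MR.A.NullK (emb ` I)" unfolding pm.indep_mod_def
  proof (intro conjI allI impI ballI)
    show "finite (emb ` I)" using I by (simp add: pm.indep_mod_def)
    fix c j assume s: "(\<Sum>i\<in>emb ` I. pscale (c i) i) \<in> MR.A.NullK" and "j \<in> emb ` I"
    then obtain i where i: "i \<in> I" "j = emb i" by auto
    have "l (c (emb i)) = 0" if l: "lin_fun l" for l
    proof -
      have "(\<Sum>i\<in>I. pscale (c (emb i)) (emb i)) \<in> MR.A.NullK" using s by (simp add: sum.reindex[OF inj])
      from MR.A.Lam_NullK[OF l this] have "(\<Sum>i\<in>I. pscale (l (c (emb i))) i) \<in> MR.A.Null"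
        by (simp add: Lam_sum[OF l] Lam_pscale_emb[OF l])
      then show ?thesis
        using I[unfolded pm.indep_mod_def, THEN conjunct2, rule_format, of "\<lambda>i. l (c (emb i))" i] i(1) by simp
    qed
    then show "c j = 0" unfolding i(2) by (rule lin_fun_separates)
  qed
qed

lemma gens_k_lift:
  assumes W: "W \<subseteq> MR.A.F" and V: "V \<subseteq> carrier R" and "u \<in> Gk.gens W V n"
  shows "\<exists>g\<in>GK.gens (emb ` W) (incl ` V) n. g - emb u \<in> MR.A.NullK"
  using assms(3)
proof (induction n arbitrary: u)
  case 0
  then show ?case using pm.subspace_0[OF MR.A.subspace_NullK] by (intro bexI[of _ "emb u"]) auto
next
  case (Suc n)
  then obtain u' r where u: "u = actk u' r" "u' \<in> Gk.gens W V n" "r \<in> V" by auto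
  with Suc.IH obtain g where g: "g \<in> GK.gens (emb ` W) (incl ` V) n" "g - emb u' \<in> MR.A.NullK" by blast
  have r: "r \<in> carrier R" using u(3) V by auto
  have u': "u' \<in> MR.A.F" using Gk.gens_subset[OF Gk.submod_T W V] u(2) by blast
  have "actK (g - emb u') (incl r) \<in> MR.A.NullK" by (rule GK.opr_Z[OF g(2) incl_carrier[OF r]])
  from pm.subspace_add[OF MR.A.subspace_NullK this actK_emb_incl[OF u' r]]
  have "actK g (incl r) - emb u \<in> MR.A.NullK" by (simp add: u(1) bilin_ext_diff_left)
  then show ?case using g(1) u(3) by auto
qed

text \<open>Sets independent over \<open>k\<close> stay independent over \<open>K\<close>, and
  products formed in \<open>M\<close> lift to products formed in \<open>M_K\<close> up to
  \<open>NullK\<close>. Together with \<open>gkr_extend_le\<close> at \<open>Null\<close> and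
  \<open>NullK\<close> the two dimensions agree.\<close>

lemma gkr_extend_ge: "Gk.gkr MR.A.F MR.A.Null \<le> GK.gkr MR.A.FK MR.A.NullK"
proof (cases "MR.A.F \<subseteq> MR.A.Null")
  case True
  then show ?thesis using GK.gkr_ge by (simp add: Gk.gkr_eq)
next
  case False
  note sB = MR.A.subspace_NullK
  have ne: "\<not> MR.A.FK \<subseteq> MR.A.NullK"
  proof
    assume s: "MR.A.FK \<subseteq> MR.A.NullK"
    have "u \<in> MR.A.Null" if "u \<in> MR.A.F" for u
    proof -
      have "emb u \<in> MR.A.NullK" using s that by auto
      from MR.A.Lam_NullK[OF cfun(1)[of 0] this] show ?thesis by (simp add: Lam_emb[OF cfun(1)])
    qed
    then show False using False by auto
  qed
  show ?thesis
  proof (rule Gk.gkr_leI[OF False])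
    fix W V assume W: "finite W" "W \<subseteq> MR.A.F" and V: "finite V" "V \<subseteq> carrier R"
    have W': "finite (emb ` W)" "emb ` W \<subseteq> MR.A.FK" using W by auto
    have V': "finite (incl ` V)" "incl ` V \<subseteq> carrier RK" using V incl_carrier by auto
    have "Gk.gkr1 MR.A.Null W V \<le> GK.gkr1 MR.A.NullK (emb ` W) (incl ` V)"
    proof (rule gkr1_mono_gen[OF Gk.gk_space_axioms GK.gk_space_axioms])
      fix n
      let ?H = "Gk.gens W V n" and ?G = "GK.gens (emb ` W) (incl ` V) n"
      obtain I where I: "I \<subseteq> ?H" "pm.indep_mod MR.A.Null I" "card I = pm.rank_mod MR.A.Null ?H"
        using pm.rank_mod_basis[OF MR.A.subspace_Null Gk.finite_gens[OF W(1) V(1)]] by metis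
      have "emb ` I \<subseteq> pm.span_mod MR.A.NullK ?G"
      proof (rule image_subsetI)
        fix i assume "i \<in> I"
        then obtain g where g: "g \<in> ?G" "g - emb i \<in> MR.A.NullK" using gens_k_lift[OF W(2) V(2)] I(1) by blast
        then have "emb i - g \<in> MR.A.NullK" using pm.subspace_neg[OF sB g(2)] by simp
        then show "emb i \<in> pm.span_mod MR.A.NullK ?G" using g(1) pm.span_base by (auto simp: pm.span_mod_def)
      qed
      from pm.card_le_rank_mod[OF sB GK.finite_gens[OF W'(1) V'(1)] emb_indep(1)[OF I(2)] this]
      show "pm.rank_mod MR.A.Null ?H \<le> pm.rank_mod MR.A.NullK ?G"
        using emb_indep(2)[OF I(2)] I(3) by simp
    qed
    also have "\<dots> \<le> GK.gkr MR.A.FK MR.A.NullK" using ne W' V' by (intro GK.gkr1_le_gkr) auto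
    finally show "Gk.gkr1 MR.A.Null W V \<le> GK.gkr MR.A.FK MR.A.NullK" .
  qed
qed

end

section \<open>Polynomials over a module\<close>

context gk_space
begin

definition polys :: "'v set \<Rightarrow> 'v poly set" where
  "polys A = {p. \<forall>i. coeff p i \<in> A}"

definition pscl :: "'k \<Rightarrow> 'v poly \<Rightarrow> 'v poly" where
  "pscl c p = map_poly (scale c) p"

definition popr :: "'v poly \<Rightarrow> 's \<Rightarrow> 'v poly" where
  "popr p s = map_poly (\<lambda>v. opr v s) p"

lemma coeff_pscl [simp]: "coeff (pscl c p) i = scale c (coeff p i)"
  by (simp add: pscl_def coeff_map_poly)

lemma coeff_popr: "s \<in> carrier S \<Longrightarrow> coeff (popr p s) i = opr (coeff p i) s"
  by (simp add: popr_def coeff_map_poly opr_0)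

lemma scalar_space_pscl: "scalar_space pscl"
  by unfold_locales
    (auto intro!: poly_eqI simp: vs.scale_right_distrib vs.scale_left_distrib)

lemma polysD: "p \<in> polys A \<Longrightarrow> coeff p i \<in> A"
  by (simp add: polys_def)

lemma polysI: "(\<And>i. coeff p i \<in> A) \<Longrightarrow> p \<in> polys A"
  by (simp add: polys_def)

lemma subspace_polys:
  assumes "vs.subspace A"
  shows "module.subspace pscl (polys A)"
proof -
  interpret P: scalar_space pscl by (rule scalar_space_pscl)
  show ?thesis using assms
    by (intro P.subspaceI polysI)
      (auto simp: vs.subspace_0 vs.subspace_add vs.subspace_scale polysD)
qed

text \<open>Polynomials over a presented module are again presented, with relations imposed
  coefficientwise. Exactness and partitivity of \<open>S\<close> thereby become usable for modules
  of polynomials, through their codes by lists.\<close>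

lemma gk_space_poly: "gk_space S pscl popr (polys T) (polys Z)"
proof -
  interpret P: scalar_space pscl by (rule scalar_space_pscl)
  show ?thesis
  proof unfold_locales
    show "P.subspace (polys T)" "P.subspace (polys Z)" by (rule subspace_polys[OF T_sub] subspace_polys[OF Z_sub])+
    show "polys Z \<subseteq> polys T" using Z_T by (auto simp: polys_def)
    fix v s assume s: "s \<in> carrier S"
    show "popr (v + w) s = popr v s + popr w s" for w by (rule poly_eqI) (simp add: coeff_popr s opr_add)
    show "popr (pscl c v) s = pscl c (popr v s)" for c by (rule poly_eqI) (simp add: coeff_popr s opr_scale)
    show "popr v s \<in> polys Z" if "v \<in> polys Z" using that s by (auto simp: polys_def coeff_popr opr_Z)
    assume v: "v \<in> polys T"
    show "popr v s \<in> polys T" using v s by (auto simp: polys_def coeff_popr opr_T)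
    show "popr v (c \<odot>\<^bsub>S\<^esub> s) - pscl c (popr v s) \<in> polys Z" for c
      by (rule polysI) (simp add: coeff_popr s opr_smult polysD[OF v])
    fix t assume t: "t \<in> carrier S"
    show "popr v (s \<oplus>\<^bsub>S\<^esub> t) - (popr v s + popr v t) \<in> polys Z"
      by (rule polysI) (simp add: coeff_popr s t opr_add_right polysD[OF v])
    show "popr v (s \<otimes>\<^bsub>S\<^esub> t) - popr (popr v s) t \<in> polys Z"
      by (rule polysI) (simp add: coeff_popr s t opr_mult polysD[OF v])
  next
    fix v assume v: "v \<in> polys T"
    show "popr v \<one>\<^bsub>S\<^esub> - v \<in> polys Z"
      by (rule polysI) (simp add: coeff_popr opr_one polysD[OF v])
  qed
qed

definition evp :: "'k \<Rightarrow> 'v poly \<Rightarrow> 'v" where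
  "evp x p = (\<Sum>i\<le>degree p. scale (x ^ i) (coeff p i))"

lemma evp_eq:
  assumes "\<And>i. i \<ge> n \<Longrightarrow> coeff p i = 0"
  shows "evp x p = (\<Sum>i<n. scale (x ^ i) (coeff p i))"
proof -
  have "evp x p = (\<Sum>i\<in>{..degree p} \<union> {..<n}. scale (x ^ i) (coeff p i))"
    unfolding evp_def by (rule sum.mono_neutral_left) (auto simp: coeff_eq_0)
  also have "\<dots> = (\<Sum>i<n. scale (x ^ i) (coeff p i))"
    by (rule sum.mono_neutral_right) (use assms in auto)
  finally show ?thesis .
qed

lemma evp_add: "evp x (p + q) = evp x p + evp x q"
proof -
  let ?n = "Suc (max (degree p) (degree q))"
  have "coeff p i = 0" "coeff q i = 0" if "i \<ge> ?n" for i
    using that by (auto intro!: coeff_eq_0)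
  then show ?thesis
    by (simp add: evp_eq[of ?n] vs.scale_right_distrib sum.distrib del: sum.lessThan_Suc)
qed

lemma evp_pscl: "evp x (pscl c p) = scale c (evp x p)"
proof -
  let ?n = "Suc (degree p)"
  have "coeff p i = 0" if "i \<ge> ?n" for i using that by (auto intro!: coeff_eq_0)
  then show ?thesis
    by (simp add: evp_eq[of ?n] vs.scale_sum_right mult.commute del: sum.lessThan_Suc)
qed

lemma evp_popr: "s \<in> carrier S \<Longrightarrow> evp x (popr p s) = opr (evp x p) s"
proof -
  assume s: "s \<in> carrier S"
  let ?n = "Suc (degree p)"
  have "coeff p i = 0" if "i \<ge> ?n" for i using that by (auto intro!: coeff_eq_0)
  then show ?thesis
    by (simp add: evp_eq[of ?n] coeff_popr s opr_sum opr_scale opr_0 del: sum.lessThan_Suc)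
qed

lemma evp_monom: "evp x (monom v i) = scale (x ^ i) v"
  by (simp add: evp_eq[of "Suc i"] if_distrib[of "scale _"] cong: if_cong)

lemma evp_shift: "evp x (pCons 0 p) = scale x (evp x p)"
proof -
  let ?n = "Suc (degree p)"
  have z: "coeff p i = 0" if "i \<ge> ?n" for i using that by (auto intro!: coeff_eq_0)
  have z': "coeff (pCons 0 p) i = 0" if "i \<ge> Suc ?n" for i using that z by (cases i) auto
  have "evp x (pCons 0 p) = (\<Sum>i<Suc ?n. scale (x ^ i) (coeff (pCons 0 p) i))" by (rule evp_eq) (rule z')
  also have "\<dots> = scale x (\<Sum>i<?n. scale (x ^ i) (coeff p i))"
    by (subst sum.lessThan_Suc_shift) (simp add: vs.scale_sum_right del: sum.lessThan_Suc)
  also have "(\<Sum>i<?n. scale (x ^ i) (coeff p i)) = evp x p" by (rule evp_eq[symmetric]) (rule z)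
  finally show ?thesis .
qed

text \<open>Multiplication by \<open>X - x\<close>.\<close>

definition Dx :: "'k \<Rightarrow> 'v poly \<Rightarrow> 'v poly" where
  "Dx x p = pCons 0 p - pscl x p"

lemma coeff_Dx: "coeff (Dx x p) i = (case i of 0 \<Rightarrow> 0 | Suc j \<Rightarrow> coeff p j) - scale x (coeff p i)"
  by (simp add: Dx_def coeff_pCons)

lemma Dx_add: "Dx x (p + q) = Dx x p + Dx x q"
  by (rule poly_eqI) (auto simp: coeff_Dx vs.scale_right_distrib split: nat.split)

lemma Dx_pscl: "Dx x (pscl c p) = pscl c (Dx x p)"
  by (rule poly_eqI) (auto simp: coeff_Dx vs.scale_right_diff_distrib mult.commute split: nat.split)

lemma Dx_popr: "s \<in> carrier S \<Longrightarrow> Dx x (popr p s) = popr (Dx x p) s"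
  by (rule poly_eqI) (auto simp: coeff_Dx coeff_popr opr_diff opr_scale opr_0 split: nat.split)

lemma Dx_polys: "vs.subspace A \<Longrightarrow> p \<in> polys A \<Longrightarrow> Dx x p \<in> polys A"
  by (rule polysI)
    (auto simp: coeff_Dx polysD split: nat.split intro!: vs.subspace_diff vs.subspace_scale vs.subspace_0 vs.subspace_neg)

lemma evp_Dx: "evp x (Dx x p) = 0"
proof -
  have "evp x (pCons 0 p) = evp x (Dx x p) + evp x (pscl x p)"
    unfolding evp_add[symmetric] by (simp add: Dx_def)
  then show ?thesis by (simp add: evp_shift evp_pscl)
qed

text \<open>
  In the application \<open>A\<close> is the submodule of \<open>M\<^sub>K\<close> generated by the coefficients \<open>u\<^sub>j\<close>, and \<open>L\<close> is the
  submodule generated by \<open>u\<^sub>n\<close>.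
\<close>

lemma poly_chain_contradiction:
  assumes ex: "gk_exact S" and part: "gk_finitely_partitive S"
    and A: "submod A" and fg: "fin_gen A Z"
    and E: "gk_space.submod S pscl popr (polys T) (polys Z) E" "E \<subseteq> polys A"
    and sat: "\<And>p. \<lbrakk>p \<in> polys A; Dx x p \<in> E\<rbrakk> \<Longrightarrow> p \<in> E"
    and N: "submod N" and evN: "\<And>p. p \<in> E \<Longrightarrow> evp x p \<in> N"
    and L: "submod L" "L \<subseteq> A"
    and lead: "\<And>v j. \<lbrakk>v \<in> L; j \<ge> n\<rbrakk> \<Longrightarrow> \<exists>p\<in>E. \<forall>i\<ge>j. coeff p i - coeff (monom v j) i \<in> Z"
    and dA: "gkr A Z \<le> d" and dN: "d \<le> gkr A N" and dL: "gkr A L < d" and d: "d \<noteq> -1"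
  shows False
proof -
  interpret H: gk_space S pscl popr "polys T" "polys Z" by (rule gk_space_poly)
  interpret HH: gk_pair S pscl popr "polys T" "polys Z" pscl popr "polys T" "polys Z" ..
  interpret HG: gk_pair S pscl popr "polys T" "polys Z" scale opr T Z ..
  interpret GH: gk_pair S scale opr T Z pscl popr "polys T" "polys Z" ..
  note sA = submodD(3)[OF A] and sE = H.submodD(3)[OF E(1)]
  let ?P = "polys A"
  have P: "H.submod ?P" unfolding H.submod_def
    using submodD[OF A] subspace_polys[OF sA] by (auto simp: polys_def coeff_popr)
  define F where "F i = (Dx x ^^ i) ` ?P" for i
  define C where "C i = H.plus_set (F i) E" for i
  have DP: "(Dx x ^^ i) p \<in> ?P" if "p \<in> ?P" for i p
    by (induction i) (auto intro: Dx_polys[OF sA] that)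
  have Dadd: "(Dx x ^^ i) (p + q) = (Dx x ^^ i) p + (Dx x ^^ i) q" for i p q
    by (induction i) (auto simp: Dx_add)
  have Dscl: "(Dx x ^^ i) (pscl c p) = pscl c ((Dx x ^^ i) p)" for i c p
    by (induction i) (auto simp: Dx_pscl)
  have Dopr: "(Dx x ^^ i) (popr p s) = popr ((Dx x ^^ i) p) s" if "s \<in> carrier S" for i p s
    using that by (induction i) (auto simp: Dx_popr)
  have Dhom: "HH.hom_on ?P (Dx x ^^ i)" for i
    unfolding HH.hom_on_def using Dadd Dscl Dopr by auto
  have Ddiff: "(Dx x ^^ i) (p - q) = (Dx x ^^ i) p - (Dx x ^^ i) q" for i p q
    using Dadd[of i "p - q" q] by (simp add: algebra_simps)
  have satn: "p \<in> E" if "p \<in> ?P" "(Dx x ^^ i) p \<in> E" for i p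
    using that
  proof (induction i)
    case (Suc i)
    then show ?case using sat[OF DP[OF Suc.prems(1), of i]] by auto
  qed auto
  have PE: "polys Z \<subseteq> E" using H.submodD(1)[OF E(1)] .
  have C_alt: "C i = {(Dx x ^^ i) p + e |p e. p \<in> ?P \<and> e \<in> E}" for i
    unfolding C_def F_def H.plus_set_def by auto
  have C: "H.submod (C i)" for i
    unfolding H.submod_def
  proof (intro conjI ballI)
    have 0: "(Dx x ^^ i) 0 = 0" using Dadd[of i 0 0] by simp
    have E: "E \<subseteq> C i" unfolding C_alt using H.vs.subspace_0[OF H.submodD(3)[OF P]] 0 by force
    show "polys Z \<subseteq> C i" using E PE by auto
    show "C i \<subseteq> polys T"
    proof
      fix p assume "p \<in> C i"
      then obtain p1 e1 where p1: "p1 \<in> ?P" "e1 \<in> E" "p = (Dx x ^^ i) p1 + e1" unfolding C_alt by auto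
      have "p \<in> ?P" unfolding p1(3)
        by (rule H.vs.subspace_add[OF H.submodD(3)[OF P] DP[OF p1(1)]]) (use p1(2) \<open>E \<subseteq> polys A\<close> in blast)
      then show "p \<in> polys T" using H.submodD(2)[OF P] by blast
    qed
    show "H.vs.subspace (C i)"
    proof (rule H.vs.subspaceI)
      show "0 \<in> C i" using E H.vs.subspace_0[OF sE] by auto
      fix p q assume p: "p \<in> C i"
      then obtain p1 e1 where p1: "p1 \<in> ?P" "e1 \<in> E" "p = (Dx x ^^ i) p1 + e1" unfolding C_alt by auto
      {
        assume "q \<in> C i"
        then obtain p2 e2 where p2: "p2 \<in> ?P" "e2 \<in> E" "q = (Dx x ^^ i) p2 + e2" unfolding C_alt by auto
        have "p + q = (Dx x ^^ i) (p1 + p2) + (e1 + e2)" by (simp add: p1 p2 Dadd)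
        then show "p + q \<in> C i" unfolding C_alt
          using H.vs.subspace_add[OF H.submodD(3)[OF P] p1(1) p2(1)] H.vs.subspace_add[OF sE p1(2) p2(2)] by blast
      }
      fix c
      have "pscl c p = (Dx x ^^ i) (pscl c p1) + pscl c e1" by (simp add: p1 Dscl H.vs.scale_right_distrib)
      then show "pscl c p \<in> C i" unfolding C_alt
        using H.vs.subspace_scale[OF H.submodD(3)[OF P] p1(1)] H.vs.subspace_scale[OF sE p1(2)] by blast
    qed
    fix p s assume p: "p \<in> C i" and s: "s \<in> carrier S"
    then obtain p1 e1 where p1: "p1 \<in> ?P" "e1 \<in> E" "p = (Dx x ^^ i) p1 + e1" unfolding C_alt by auto
    have "popr p s = (Dx x ^^ i) (popr p1 s) + popr e1 s" by (simp add: p1 Dopr s H.opr_add)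
    then show "popr p s \<in> C i" unfolding C_alt
      using H.submodD(4)[OF P p1(1) s] H.submodD(4)[OF \<open>H.submod E\<close> p1(2) s] by blast
  qed
  have EC: "E \<subseteq> C i" for i
    unfolding C_alt using H.vs.subspace_0[OF H.submodD(3)[OF P]] Dadd[of i 0 0] by force
  have CP: "C i \<subseteq> ?P" for i
    unfolding C_alt using DP E(2) H.vs.subspace_add[OF H.submodD(3)[OF P]] by blast
  have Cdec: "C (Suc i) \<subseteq> C i" for i
  proof
    fix p assume "p \<in> C (Suc i)"
    then obtain p1 e1 where p1: "p1 \<in> ?P" "e1 \<in> E" "p = (Dx x ^^ Suc i) p1 + e1" unfolding C_alt by auto
    have "p = (Dx x ^^ i) (Dx x p1) + e1" using p1(3) by (simp add: funpow_swap1)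
    then show "p \<in> C i" unfolding C_alt using p1 Dx_polys[OF sA p1(1)] by blast
  qed
  have evC: "evp x p \<in> N" if p: "p \<in> C 1" for p
  proof -
    obtain p1 e1 where "p1 \<in> ?P" "e1 \<in> E" "p = Dx x p1 + e1" using p unfolding C_alt by auto
    then show ?thesis using evN by (simp add: evp_add evp_Dx)
  qed
  \<comment> \<open>Evaluation at \<open>x\<close> kills multiples of \<open>X - x\<close> and sends
    \<open>E\<close> into \<open>N\<close>, so it induces a map from \<open>P/C 1\<close> to
    \<open>A/N\<close>; constant polynomials show that it is onto.\<close>
  have "gkr A N \<le> H.gkr ?P (C 1)"
  proof (rule HG.gkr_le_surj)
    show "HG.hom_on ?P (evp x)" unfolding HG.hom_on_def by (auto simp: evp_add evp_pscl evp_popr)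
    fix a assume a: "a \<in> A"
    have "a - evp x (monom a 0) \<in> N" using vs.subspace_0[OF submodD(3)[OF N]] by (simp add: evp_monom)
    moreover have "monom a 0 \<in> ?P" using a vs.subspace_0[OF sA] by (auto intro!: polysI)
    ultimately show "\<exists>p\<in>?P. a - evp x p \<in> N" by blast
  qed (use P C A N evC CP in auto)
  \<comment> \<open>Multiplication by \<open>(X - x)^i\<close> is injective from
    \<open>P/C 1\<close> to \<open>C i/C (Suc i)\<close>: if
    \<open>(X - x)^i p = (X - x)^(i+1) q + e\<close> with \<open>e\<close> in \<open>E\<close>, then
    saturation puts \<open>p - (X - x) q\<close> into \<open>E\<close>.\<close>
  moreover have "H.gkr ?P (C 1) \<le> H.gkr (C i) (C (Suc i))" for i
  proof (rule HH.gkr_le_inj[OF Dhom P C C C])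
    show "(Dx x ^^ i) ` ?P \<subseteq> C i"
    proof (rule image_subsetI)
      fix p assume "p \<in> ?P"
      then show "(Dx x ^^ i) p \<in> C i" unfolding C_alt using H.vs.subspace_0[OF sE] by force
    qed
    fix p assume p: "p \<in> ?P" "(Dx x ^^ i) p \<in> C (Suc i)"
    then obtain q e where q: "q \<in> ?P" "e \<in> E" "(Dx x ^^ i) p = (Dx x ^^ Suc i) q + e" unfolding C_alt by auto
    then have "(Dx x ^^ i) (p - Dx x q) = e" by (simp add: Ddiff funpow_swap1)
    then have "p - Dx x q \<in> E"
      using satn[of "p - Dx x q" i] q p(1) Dx_polys[OF sA q(1)] H.vs.subspace_diff[OF H.submodD(3)[OF P]] by auto
    moreover have "p = (Dx x ^^ 1) q + (p - Dx x q)" by simp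
    ultimately show "p \<in> C 1" unfolding C_alt using q(1) by blast
  qed
  ultimately have dC: "d \<le> H.gkr (C i) (C (Suc i))" for i using dN order_trans by meson
  \<comment> \<open>Degree less than \<open>m\<close> is understood modulo \<open>Z\<close>: the
    higher coefficients need only lie in \<open>Z\<close>, since every submodule has to contain
    \<open>polys Z\<close>.\<close>
  define Q where "Q m = {p \<in> ?P. \<forall>i\<ge>m. coeff p i \<in> Z}" for m
  note sZ = Z_sub and ZA = submodD(1)[OF A]
  have Q: "H.submod (Q m)" for m
  proof -
    have "H.vs.subspace (Q m)"
      using H.submodD(3)[OF P] unfolding Q_def
      by (intro H.vs.subspaceI) (auto simp: H.vs.subspace_0 H.vs.subspace_add H.vs.subspace_scale 
          vs.subspace_0[OF sZ] vs.subspace_add[OF sZ] vs.subspace_scale[OF sZ])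
    then show ?thesis unfolding H.submod_def using H.submodD(2,4)[OF P] ZA
      by (auto simp: Q_def coeff_popr opr_Z intro!: polysI dest: polysD)
  qed
  have Q0: "Q 0 = polys Z" using ZA by (auto simp: Q_def intro!: polysI dest: polysD)
  have Qmono: "Q i \<subseteq> Q j" if "i \<le> j" for i j using that by (auto simp: Q_def)
  have monomA: "monom a j \<in> ?P" if "a \<in> A" for a j using that vs.subspace_0[OF sA] by (auto intro!: polysI)
  have hm: "GH.hom_on A (\<lambda>a. monom a j)" for j
    unfolding GH.hom_on_def by (auto intro!: poly_eqI simp: coeff_popr opr_0)
  have Qrest: "q - monom (coeff q j) j \<in> Q j" if "q \<in> Q (Suc j)" for q j
  proof -
    have "q - monom (coeff q j) j \<in> ?P" using that monomA[of "coeff q j" j]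
      by (intro H.vs.subspace_diff[OF H.submodD(3)[OF P]]) (auto simp: Q_def dest: polysD)
    moreover have "coeff (q - monom (coeff q j) j) i \<in> Z" if "i \<ge> j" for i
      using \<open>q \<in> Q (Suc j)\<close> that vs.subspace_0[OF sZ] by (cases "i = j") (auto simp: Q_def)
    ultimately show ?thesis by (simp add: Q_def)
  qed
  \<comment> \<open>The map \<open>a \<mapsto> a X^j\<close> sends \<open>A/Z\<close> onto
    \<open>Q (Suc j)/Q j\<close>; by exactness each \<open>Q m\<close> then has dimension at most
    \<open>d\<close>.\<close>
  have Qstep: "H.gkr (Q (Suc j)) (Q j) \<le> gkr A Z" for j
  proof (rule GH.gkr_le_surj[OF hm A submod_Z Q Q _ ZA])
    show "monom b j \<in> Q j" if "b \<in> A" "b \<in> Z" for b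
      using that monomA vs.subspace_0[OF sZ] by (auto simp: Q_def)
    show "\<exists>a\<in>A. q - monom a j \<in> Q j" if "q \<in> Q (Suc j)" for q
      using Qrest[OF that] that by (intro bexI[of _ "coeff q j"]) (auto simp: Q_def dest: polysD)
  qed
  have QZ: "H.gkr (Q m) (polys Z) \<le> d" for m
  proof (induction m)
    case 0
    show ?case using gkr_ge[of A Z] dA by (simp add: Q0 H.gkr_eq)
  next
    case (Suc m)
    have "H.gkr (Q (Suc m)) (polys Z) \<le> max (H.gkr (Q m) (polys Z)) (H.gkr (Q (Suc m)) (Q m))"
      using Qmono[of 0 m] by (intro H.gkr_exact[OF ex Q Q _ H.submod_Z] Qmono) (auto simp: Q0)
    also have "\<dots> \<le> d" using Suc Qstep[of m] dA by auto
    finally show ?case .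
  qed
  define G where "G j = H.plus_set (Q j) E" for j
  have G: "H.submod (G j)" for j unfolding G_def by (rule H.submod_plus[OF Q E(1)])
  have Gmono: "G i \<subseteq> G j" if "i \<le> j" for i j
    using Qmono[OF that] unfolding G_def H.plus_set_def by blast
  \<comment> \<open>The map \<open>a \<mapsto> a X^j\<close> sends \<open>A\<close> onto
    \<open>G (Suc j)/G j\<close>. It kills \<open>L\<close> when \<open>j \<ge> n\<close>, because
    \<open>b X^j\<close> with \<open>b\<close> in \<open>L\<close> is the top term, modulo
    \<open>Z\<close>, of an element of \<open>E\<close> and thus congruent to something of lower
    degree.\<close>
  have Gstep: "H.gkr (G (Suc j)) (G j) \<le> gkr A L" if j: "j \<ge> n" for j
  proof (rule GH.gkr_le_surj[OF hm A L(1) G G _ L(2)])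
    fix b assume b: "b \<in> A" "b \<in> L"
    obtain p where p: "p \<in> E" "\<And>i. i \<ge> j \<Longrightarrow> coeff p i - coeff (monom b j) i \<in> Z" using lead[OF b(2) j] by blast
    have "monom b j - p \<in> ?P" using monomA[OF b(1)] p(1) E(2) H.vs.subspace_diff[OF H.submodD(3)[OF P]] by blast
    moreover have "coeff (monom b j - p) i \<in> Z" if "i \<ge> j" for i
      using vs.subspace_neg[OF sZ p(2)[OF that]] by simp
    ultimately have "monom b j - p \<in> Q j" by (simp add: Q_def)
    then have "(monom b j - p) + p \<in> G j" unfolding G_def H.plus_set_def using p(1) by blast
    then show "monom b j \<in> G j" by simp
  next
    fix a' assume "a' \<in> G (Suc j)"
    then obtain q e where q: "q \<in> Q (Suc j)" "e \<in> E" "a' = q + e" unfolding G_def H.plus_set_def by auto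
    have "a' - monom (coeff q j) j = (q - monom (coeff q j) j) + e" using q(3) by simp
    then have "a' - monom (coeff q j) j \<in> G j" unfolding G_def H.plus_set_def using Qrest[OF q(1)] q(2) by blast
    then show "\<exists>a\<in>A. a' - monom a j \<in> G j" using q(1) by (auto simp: Q_def dest: polysD)
  qed
  have GL: "H.gkr (G (n + j)) (G n) \<le> gkr A L" for j
  proof (induction j)
    case 0
    show ?case using gkr_ge[of A L] by (simp add: H.gkr_eq)
  next
    case (Suc j)
    have "H.gkr (G (n + Suc j)) (G n) \<le> max (H.gkr (G (n + j)) (G n)) (H.gkr (G (n + Suc j)) (G (n + j)))"
      by (intro H.gkr_exact[OF ex G G _ G] Gmono) auto
    also have "\<dots> \<le> gkr A L" using Suc Gstep[of "n + j"] by auto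
    finally show ?case .
  qed
  have UN: "(\<Union>j. G (n + j)) = ?P"
  proof
    have "G j \<subseteq> ?P" for j
      unfolding G_def by (rule H.plus_set_minimal[OF P _ E(2)]) (auto simp: Q_def)
    then show "(\<Union>j. G (n + j)) \<subseteq> ?P" by blast
    show "?P \<subseteq> (\<Union>j. G (n + j))"
    proof
      fix p assume p: "p \<in> ?P"
      have "p \<in> Q (n + Suc (degree p))" using p vs.subspace_0[OF sZ] by (auto simp: Q_def coeff_eq_0)
      then have "p \<in> G (n + Suc (degree p))" unfolding G_def using H.plus_set_left[OF E(1)] by blast
      then show "p \<in> (\<Union>j. G (n + j))" by blast
    qed
  qed
  \<comment> \<open>Infinitely many extension steps lead from \<open>G n\<close> to
    \<open>P\<close>; the bound survives because dimension passes to increasing unions.\<close>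
  have "mono (\<lambda>j. G (n + j))" by (auto intro!: monoI Gmono)
  from H.gkr_UN[OF this G GL] have PG: "H.gkr ?P (G n) \<le> gkr A L" unfolding UN .
  define K where "K i = C i \<inter> Q n" for i
  have K: "H.submod (K i)" for i unfolding K_def by (rule H.submod_inter[OF C Q])
  \<comment> \<open>\<open>?X\<close> is inserted between \<open>C (Suc i)\<close> and
    \<open>C i\<close>. The factor \<open>C i/?X\<close> is a subquotient of
    \<open>P/(Q n + E)\<close> and has dimension below \<open>d\<close>, so exactness leaves
    \<open>d\<close> to \<open>?X/C (Suc i)\<close>, which is \<open>K i/K (Suc i)\<close> by the
    second isomorphism theorem.\<close>
  have dK: "d \<le> H.gkr (K i) (K (Suc i))" for i
  proof -
    let ?X = "H.plus_set (K i) (C (Suc i))"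
    have X: "H.submod ?X" by (rule H.submod_plus[OF K C])
    have XC: "?X \<subseteq> C i" by (rule H.plus_set_minimal[OF C]) (use Cdec in \<open>auto simp: K_def\<close>)
    have "d \<le> max (H.gkr ?X (C (Suc i))) (H.gkr (C i) ?X)"
      using dC[of i] H.gkr_exact[OF ex C[of i] X XC C[of "Suc i"] H.plus_set_right[OF K]] by (rule order_trans)
    moreover have "H.gkr (C i) ?X \<le> H.gkr ?P (G n)"
    proof (rule H.gkr_le_sub[OF C X P G CP])
      show "C i \<inter> G n \<subseteq> ?X"
      proof
        fix p assume p: "p \<in> C i \<inter> G n"
        then obtain q e where q: "q \<in> Q n" "e \<in> E" "p = q + e" unfolding G_def H.plus_set_def by auto
        have "q = p - e" using q by simp
        then have "q \<in> C i" using p q(2) EC[of i] H.vs.subspace_diff[OF H.submodD(3)[OF C[of i]]] by blast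
        then have "q \<in> K i" using q by (simp add: K_def)
        then show "p \<in> ?X" unfolding H.plus_set_def using q(2,3) EC[of "Suc i"] by blast
      qed
    qed
    ultimately have "d \<le> H.gkr ?X (C (Suc i))" using PG dL by (auto simp: le_max_iff_disj)
    also have "\<dots> \<le> H.gkr (K i) (K (Suc i))"
      by (rule H.gkr_le_quot[OF K K X C]) (use Cdec in \<open>auto simp: K_def\<close>)
    finally show ?thesis .
  qed
  have ZK: "polys Z \<subseteq> K i" for i using PE EC[of i] Qmono[of 0 n] by (auto simp: K_def Q0)
  have Kd: "H.gkr (K i) (K (Suc i)) \<le> H.gkr (Q n) (polys Z)" for i
  proof -
    have "H.gkr (K i) (K (Suc i)) \<le> H.gkr (K i) (polys Z)"
      by (rule H.gkr_le_quot[OF K H.submod_Z K K ZK ZK H.plus_set_left[OF K]])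
    also have "\<dots> \<le> H.gkr (Q n) (polys Z)"
      by (rule H.gkr_le_sub[OF K H.submod_Z Q H.submod_Z]) (auto simp: K_def)
    finally show ?thesis .
  qed
  \<comment> \<open>The factors of the new chain are squeezed: at least \<open>d\<close>, at most
    the dimension of \<open>Q n\<close>, which is at most \<open>d\<close>.\<close>
  have Qd: "H.gkr (Q n) (polys Z) = d" using QZ[of n] Kd[of 0] dK[of 0] by auto
  have fgQ: "H.fin_gen (Q n) (polys Z)"
  proof -
    obtain W where W: "finite W" "W \<subseteq> A" "\<And>C. \<lbrakk>submod C; Z \<subseteq> C; W \<subseteq> C\<rbrakk> \<Longrightarrow> A \<subseteq> C"
      using fg unfolding fin_gen_def by auto
    \<comment> \<open>Generators of \<open>A\<close> placed in each degree below \<open>n\<close>.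
      For fixed \<open>i\<close>, the \<open>a\<close> with \<open>a X^i\<close> in a given
      submodule form a submodule of \<open>A\<close>, so it suffices to have the generators of
      \<open>A\<close> there.\<close>
    let ?W = "(\<lambda>(w, i). monom w i) ` (W \<times> {..<n})"
    have "?W \<subseteq> Q n" using W(2) monomA vs.subspace_0[OF sZ] by (auto simp: Q_def)
    moreover have "Q n \<subseteq> X" if X: "H.submod X" "polys Z \<subseteq> X" "?W \<subseteq> X" for X
    proof -
      note sX = H.submodD(3)[OF X(1)]
      have mon: "monom a i \<in> X" if i: "i < n" and a: "a \<in> A" for a i
      proof -
        let ?B = "{a \<in> A. monom a i \<in> X}"
        have "submod ?B" unfolding submod_def
        proof (intro conjI ballI)
          show "Z \<subseteq> ?B" using ZA X(2) vs.subspace_0[OF sZ] by (auto intro!: subsetD[OF X(2)] polysI)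
          show "?B \<subseteq> T" using submodD(2)[OF A] by auto
          show "vs.subspace ?B"
          proof (rule vs.subspaceI)
            show "0 \<in> ?B" using vs.subspace_0[OF sA] H.vs.subspace_0[OF sX] by simp
            show "a + b \<in> ?B" if "a \<in> ?B" "b \<in> ?B" for a b
              using that vs.subspace_add[OF sA] H.vs.subspace_add[OF sX] by (auto simp: add_monom[symmetric])
            show "scale c a \<in> ?B" if "a \<in> ?B" for a c
            proof -
              have "monom (scale c a) i = pscl c (monom a i)" by (rule poly_eqI) simp
              then show ?thesis using that vs.subspace_scale[OF sA] H.vs.subspace_scale[OF sX] by auto
            qed
          qed
          show "opr a s \<in> ?B" if "a \<in> ?B" "s \<in> carrier S" for a s
          proof -
            have "monom (opr a s) i = popr (monom a i) s" using that(2) by (intro poly_eqI) (simp add: coeff_popr opr_0)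
            then show ?thesis using that submodD(4)[OF A] H.submodD(4)[OF X(1)] by auto
          qed
        qed
        moreover have "W \<subseteq> ?B" using W(2) X(3) i by auto
        ultimately have "A \<subseteq> ?B" using ZA W(3)[of ?B] submodD(1) by blast
        then show ?thesis using a by auto
      qed
      have "q \<in> X" if "q \<in> Q m" "m \<le> n" for q m
        using that
      proof (induction m arbitrary: q)
        case 0
        then show ?case using X(2) by (auto simp: Q0)
      next
        case (Suc m)
        have "q - monom (coeff q m) m \<in> X" using Suc Qrest by auto
        moreover have "monom (coeff q m) m \<in> X" using Suc.prems by (intro mon) (auto simp: Q_def dest: polysD)
        ultimately show ?case using H.vs.subspace_add[OF sX] by fastforce
      qed
      then show ?thesis by blast
    qed
    ultimately show ?thesis unfolding H.fin_gen_def using W(1) by (intro exI[of _ ?W]) blast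
  qed
  have K0: "K 0 = Q n"
  proof -
    have "Q n \<subseteq> C 0" unfolding C_alt using H.vs.subspace_0[OF sE] by (force simp: Q_def)
    then show ?thesis by (auto simp: K_def)
  qed
  show False
  proof (rule H.no_infinite_chain[OF part Q[of n] H.submod_Z _ fgQ, where C = K])
    show "H.submod (K i)" "polys Z \<subseteq> K i" "K 0 = Q n" for i by (rule K ZK K0)+
    show "polys Z \<subseteq> Q n" using Qmono[of 0 n] by (simp add: Q0)
    show "K (Suc i) \<subseteq> K i" for i using Cdec by (auto simp: K_def)
    show "H.gkr (K i) (K (Suc i)) = H.gkr (Q n) (polys Z)" for i
      using Kd[of i] dK[of i] Qd by auto
    show "H.gkr (Q n) (polys Z) \<noteq> -1" using Qd d by simp
  qed
qed

end

section \<open>Critical modules\<close>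

lemma rmod_update_carrier: "M\<lparr>carrier := carrier M\<rparr> = (M :: ('r, 'm) rmod)"
  by simp

lemma coeff_map_emb [simp]: "coeff (map_poly emb c) i = emb (coeff c i)"
  by (simp add: coeff_map_poly)

lemma coeff_map_Lam: "lin_fun l \<Longrightarrow> coeff (map_poly (Lam l) p) i = Lam l (coeff p i)"
  by (simp add: coeff_map_poly Lam_0)

text \<open>Multiplication by \<open>x\<close> shifts coefficients. Integrality is essential, since
  \<open>cfun\<close> is a coefficient functional on polynomials only.\<close>

lemma integral_cfun_shift:
  assumes "integral v"
  shows "Lam (cfun l) (pscale xK v) = (case l of 0 \<Rightarrow> 0 | Suc m \<Rightarrow> Lam (cfun m) v)"
proof (rule poly_mapping_eqI)
  fix a
  obtain p where p: "Poly_Mapping.lookup v a = pfract p" using assms unfolding integral_def by blast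
  have "xK * pfract p = pfract (pCons 0 p)" by (simp add: pfract_pCons)
  then have "cfun l (xK * pfract p) = coeff (pCons 0 p) l" by (simp only: cfun_pfract)
  then show "Poly_Mapping.lookup (Lam (cfun l) (pscale xK v)) a
      = Poly_Mapping.lookup (case l of 0 \<Rightarrow> 0 | Suc m \<Rightarrow> Lam (cfun m) v) a"
    by (simp add: lookup_Lam[OF cfun(1)] p cfun_pfract coeff_pCons split: nat.split)
qed

text \<open>Regroups a polynomial in \<open>X\<close> by powers of \<open>x\<close>. One bound
  \<open>n\<close> serves for all coefficients because only finitely many of them are
  nonzero.\<close>

lemma poly_integral_expand:
  fixes p :: "('m \<Rightarrow>\<^sub>0 'k::field ratfun) poly"
  assumes "\<And>i. integral (coeff p i)"
  obtains n where "\<And>l. l \<ge> n \<Longrightarrow> map_poly (Lam (cfun l)) p = 0"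
    "\<And>i. coeff p i = (\<Sum>l<n. pscale (xK ^ l) (emb (Lam (cfun l) (coeff p i))))"
proof -
  define bound where "bound i n \<longleftrightarrow> (\<forall>l\<ge>n. Lam (cfun l) (coeff p i) = 0) \<and>
      (\<forall>m\<ge>n. coeff p i = (\<Sum>l<m. pscale (xK ^ l) (emb (Lam (cfun l) (coeff p i)))))" for i n
  have "\<exists>n. bound i n" for i
  proof (rule integral_expand[OF assms[of i]])
    fix n
    assume 1: "\<And>j. n \<le> j \<Longrightarrow> Lam (cfun j) (coeff p i) = 0"
      and 2: "\<And>m. n \<le> m \<Longrightarrow> coeff p i = (\<Sum>j<m. pscale (xK ^ j) (emb (Lam (cfun j) (coeff p i))))"
    show ?thesis unfolding bound_def by (intro exI[of _ n] conjI allI impI 1 2)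
  qed
  then obtain N where bound: "\<And>i. bound i (N i)" by metis
  have N: "Lam (cfun l) (coeff p i) = 0" if "l \<ge> N i" for i l
    using bound[of i] that unfolding bound_def by blast
  have N': "coeff p i = (\<Sum>l<m. pscale (xK ^ l) (emb (Lam (cfun l) (coeff p i))))" if "m \<ge> N i" for i m
    using bound[of i, unfolded bound_def] that by blast
  define n where "n = Max (N ` {..Suc (degree p)})"
  have n: "N i \<le> n" if "i \<le> Suc (degree p)" for i unfolding n_def using that by (intro Max_ge) auto
  show thesis
  proof (rule that[of n])
    show "map_poly (Lam (cfun l)) p = 0" if l: "l \<ge> n" for l
    proof (rule poly_eqI)
      fix i
      have "Lam (cfun l) (coeff p i) = 0"
      proof (cases "i \<le> degree p")
        case True
        then show ?thesis using n[of i] l by (intro N) auto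
      qed (simp add: coeff_eq_0 Lam_0[OF cfun(1)])
      then show "coeff (map_poly (Lam (cfun l)) p) i = coeff 0 i" by (simp add: coeff_map_Lam[OF cfun(1)])
    qed
    show "coeff p i = (\<Sum>l<n. pscale (xK ^ l) (emb (Lam (cfun l) (coeff p i))))" for i
    proof (cases "i \<le> degree p")
      case True
      then show ?thesis using n[of i] by (intro N') auto
    qed (simp add: coeff_eq_0 Lam_0[OF cfun(1)])
  qed
qed

section \<open>Evaluation at \<open>x\<close> and the submodule \<open>E\<close>\<close>

context right_module
begin

interpretation MR: bilin_act R "kspace R M" "act M"
  by (rule bilin_act_act)

interpretation Gk: gk_space R pscale actk MR.A.F MR.A.Null
  by (rule gk_space_k)

interpretation GK: gk_space RK pscale actK MR.A.FK MR.A.NullK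
  by (rule gk_space_K)

text \<open>The factor \<open>f\<close> of \<open>r \<otimes> f\<close> is absorbed into the
  functional, leaving the action of \<open>r\<close> over \<open>k\<close>. Hence a condition
  imposed for all functionals is stable under the action of \<open>R_K\<close>.\<close>

lemma Lam_bilin_single:
  assumes l: "lin_fun l"
  shows "Lam l (bilin_ext (act M) v (Poly_Mapping.single r f)) = actk (Lam (\<lambda>g. l (f * g)) v) r"
proof (rule poly_mapping_lin_induct[of v UNIV])
  fix m g
  have *: "Lam l (Poly_Mapping.single y h) = Poly_Mapping.single y (l h)" if "lin_fun l" for l y h
    using that by (simp add: Lam_def lin_funD)
  show "Lam l (bilin_ext (act M) (Poly_Mapping.single m g) (Poly_Mapping.single r f))
      = actk (Lam (\<lambda>g. l (f * g)) (Poly_Mapping.single m g)) r"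
    using l lin_fun_mult[OF l, of f] by (simp add: * mult.commute)
qed (auto simp: bilin_ext_add_left Lam_add l lin_fun_mult lin_ext_add Lam_0)

definition evx :: "('m \<Rightarrow>\<^sub>0 'k) poly \<Rightarrow> ('m \<Rightarrow>\<^sub>0 'k ratfun)" where
  "evx c = GK.evp xK (map_poly emb c)"

lemma evx_add: "evx (c + d) = evx c + evx d"
proof -
  have "map_poly emb (c + d) = map_poly emb c + map_poly emb d" by (rule poly_eqI) (simp add: emb_add)
  then show ?thesis by (simp add: evx_def GK.evp_add)
qed

lemma evx_pscl: "evx (Gk.pscl a c) = pscale (kconst a) (evx c)"
proof -
  have "map_poly emb (Gk.pscl a c) = GK.pscl (kconst a) (map_poly emb c)" by (rule poly_eqI) (simp add: emb_pscale)
  then show ?thesis by (simp add: evx_def GK.evp_pscl)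
qed

lemma evx_pCons: "evx (pCons 0 c) = pscale xK (evx c)"
proof -
  have "map_poly emb (pCons 0 c) = pCons 0 (map_poly emb c)"
    by (rule poly_eqI) (simp add: coeff_pCons split: nat.split)
  then show ?thesis by (simp add: evx_def GK.evp_shift)
qed

lemma evx_eq:
  assumes "\<And>i. i \<ge> n \<Longrightarrow> coeff c i = 0"
  shows "evx c = (\<Sum>i<n. pscale (xK ^ i) (emb (coeff c i)))"
  unfolding evx_def by (subst GK.evp_eq[of n]) (simp_all add: assms)

lemma evx_actk:
  assumes c: "c \<in> Gk.polys MR.A.F" and r: "r \<in> carrier R"
  shows "evx (Gk.popr c r) - actK (evx c) (incl r) \<in> MR.A.NullK"
proof -
  let ?n = "Suc (degree c)"
  have z: "coeff c i = 0" if "i \<ge> ?n" for i using that by (auto intro!: coeff_eq_0)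
  have ec: "evx c = (\<Sum>i<?n. pscale (xK ^ i) (emb (coeff c i)))" by (rule evx_eq) (rule z)
  have "evx (Gk.popr c r) = (\<Sum>i<?n. pscale (xK ^ i) (emb (coeff (Gk.popr c r) i)))"
    by (rule evx_eq) (simp add: Gk.coeff_popr r z)
  then have "evx (Gk.popr c r) - actK (evx c) (incl r)
    = (\<Sum>i<?n. pscale (xK ^ i) (emb (actk (coeff c i) r) - actK (emb (coeff c i)) (incl r)))"
    unfolding ec by (simp add: Gk.coeff_popr r GK.opr_sum[OF incl_carrier[OF r]] bilin_ext_pscale_left
        pm.scale_right_diff_distrib sum_subtractf del: sum.lessThan_Suc)
  also have "\<dots> \<in> MR.A.NullK"
  proof (intro pm.subspace_sum[OF MR.A.subspace_NullK] pm.subspace_scale[OF MR.A.subspace_NullK])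
    fix i
    have "coeff c i \<in> MR.A.F" using c by (rule Gk.polysD)
    from pm.subspace_neg[OF MR.A.subspace_NullK actK_emb_incl[OF this r]]
    show "emb (actk (coeff c i) r) - actK (emb (coeff c i)) (incl r) \<in> MR.A.NullK" by simp
  qed
  finally show ?thesis .
qed

context
  fixes N :: "('m \<Rightarrow>\<^sub>0 'k ratfun) set"
  assumes N: "GK.submod N"
begin

lemma N_sub: "pm.subspace N" and NullK_N: "MR.A.NullK \<subseteq> N"
  using GK.submodD[OF N] by auto

definition E0 :: "('m \<Rightarrow>\<^sub>0 'k) poly set" where
  "E0 = {c \<in> Gk.polys MR.A.F. evx c \<in> N}"

text \<open>Substituting \<open>x\<close> turns multiplication by \<open>X\<close> into scalar
  multiplication by \<open>xK\<close>, under which \<open>N\<close> is stable. So \<open>E0\<close>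
  is stable under \<open>X\<close> as well as under \<open>R\<close>, and it is stability under
  \<open>X\<close> that the descending induction for saturation needs.\<close>

lemma E0_0: "0 \<in> E0" and E0_add: "\<lbrakk>c \<in> E0; d \<in> E0\<rbrakk> \<Longrightarrow> c + d \<in> E0"
  and E0_scale: "c \<in> E0 \<Longrightarrow> Gk.pscl a c \<in> E0" and E0_pCons: "c \<in> E0 \<Longrightarrow> pCons 0 c \<in> E0"
  and E0_popr: "\<lbrakk>c \<in> E0; r \<in> carrier R\<rbrakk> \<Longrightarrow> Gk.popr c r \<in> E0"
proof -
  note sF = subspace_supported[of "carrier (kspace R M)", where 'b = 'k]
  have 0: "evx 0 = 0" using evx_add[of 0 0] by simp
  show "0 \<in> E0" using pm.subspace_0[OF sF] pm.subspace_0[OF N_sub] by (simp add: E0_def Gk.polys_def 0)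
  show "c + d \<in> E0" if "c \<in> E0" "d \<in> E0" for c d
    using that pm.subspace_add[OF sF] pm.subspace_add[OF N_sub] by (auto simp: E0_def Gk.polys_def evx_add)
  show "Gk.pscl a c \<in> E0" if "c \<in> E0" for a c
    using that pm.subspace_scale[OF sF] pm.subspace_scale[OF N_sub] by (auto simp: E0_def Gk.polys_def evx_pscl)
  show "pCons 0 c \<in> E0" if "c \<in> E0" for c
    using that pm.subspace_0[OF sF] pm.subspace_scale[OF N_sub]
    by (auto simp: E0_def Gk.polys_def evx_pCons coeff_pCons split: nat.split)
  show "Gk.popr c r \<in> E0" if c: "c \<in> E0" and r: "r \<in> carrier R" for c r
  proof -
    have cp: "c \<in> Gk.polys MR.A.F" "evx c \<in> N" using c by (auto simp: E0_def)
    have "evx (Gk.popr c r) - actK (evx c) (incl r) \<in> N" using evx_actk[OF cp(1) r] NullK_N by blast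
    from pm.subspace_add[OF N_sub this GK.submodD(4)[OF N cp(2) incl_carrier[OF r]]]
    have "evx (Gk.popr c r) \<in> N" by simp
    moreover have "Gk.popr c r \<in> Gk.polys MR.A.F"
      using cp(1) Gk.opr_T[OF _ r] by (auto simp: Gk.polys_def Gk.coeff_popr r)
    ultimately show ?thesis by (simp add: E0_def)
  qed
qed

lemma E0_diff: "\<lbrakk>c \<in> E0; d \<in> E0\<rbrakk> \<Longrightarrow> c - d \<in> E0"
proof -
  assume cd: "c \<in> E0" "d \<in> E0"
  have eq: "c - d = c + Gk.pscl (- 1) d" by (rule poly_eqI) simp
  show ?thesis unfolding eq using cd by (intro E0_add E0_scale)
qed

lemma E0_Null: "(\<And>i. coeff c i \<in> MR.A.Null) \<Longrightarrow> c \<in> E0"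
proof -
  assume c: "\<And>i. coeff c i \<in> MR.A.Null"
  have "evx c = (\<Sum>i<Suc (degree c). pscale (xK ^ i) (emb (coeff c i)))"
    by (rule evx_eq) (auto intro: coeff_eq_0)
  also have "\<dots> \<in> MR.A.NullK"
    by (intro pm.subspace_sum[OF MR.A.subspace_NullK] pm.subspace_scale[OF MR.A.subspace_NullK] MR.A.emb_Null c)
  finally show ?thesis using NullK_N c by (auto simp: E0_def Gk.polys_def MR.A.Null_def)
qed

context
  fixes A :: "('m \<Rightarrow>\<^sub>0 'k ratfun) set"
  assumes A: "GK.submod A"
begin

interpretation H: gk_space RK GK.pscl GK.popr "GK.polys MR.A.FK" "GK.polys MR.A.NullK"
  by (rule GK.gk_space_poly)

text \<open>
  The \<open>K\<close>-span of \<open>E0\<close> in \<open>A[X]\<close>, described by duality: all \<open>k\<close>-linear functionals \<open>K \<rightarrow> k\<close>, applied to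
  the coefficients, map it to \<open>E0\<close>.
\<close>

definition E :: "('m \<Rightarrow>\<^sub>0 'k ratfun) poly set" where
  "E = {p \<in> GK.polys A. \<forall>l. lin_fun l \<longrightarrow> map_poly (Lam l) p \<in> E0}"

lemma A_subspace: "pm.subspace A"
  by (rule GK.submodD(3)[OF A])

lemma map_Lam_add: "lin_fun l \<Longrightarrow> map_poly (Lam l) (p + q) = map_poly (Lam l) p + map_poly (Lam l) q"
  by (rule poly_eqI) (simp add: coeff_map_Lam Lam_add)

lemma map_Lam_pscl: "lin_fun l \<Longrightarrow> map_poly (Lam l) (GK.pscl f p) = map_poly (Lam (\<lambda>g. l (f * g))) p"
  by (rule poly_eqI) (simp add: coeff_map_Lam Lam_pscale lin_fun_mult)

lemma map_Lam_popr:
  assumes p: "p \<in> E" and a: "a \<in> MR.B.FK" and l: "lin_fun l"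
  shows "map_poly (\<lambda>v. Lam l (bilin_ext (act M) v a)) p \<in> E0"
  using a unfolding supported_def mem_Collect_eq
proof (induction rule: poly_mapping_lin_induct)
  case zero
  have "map_poly (\<lambda>v. Lam l (bilin_ext (act M) v 0)) p = 0"
    by (rule poly_eqI) (simp add: coeff_map_poly Lam_0[OF l])
  then show ?case using E0_0 by simp
next
  case (single r f)
  have "map_poly (\<lambda>v. Lam l (bilin_ext (act M) v (Poly_Mapping.single r f))) p
      = Gk.popr (map_poly (Lam (\<lambda>g. l (f * g))) p) r"
    by (rule poly_eqI)
      (simp add: coeff_map_poly Lam_0[OF l] Lam_0[OF lin_fun_mult[OF l]] Gk.coeff_popr single Lam_bilin_single[OF l] coeff_map_Lam lin_fun_mult[OF l])
  moreover have "map_poly (Lam (\<lambda>g. l (f * g))) p \<in> E0" using p lin_fun_mult[OF l] by (auto simp: E_def)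
  ultimately show ?case using E0_popr single by simp
next
  case (add a b)
  have "map_poly (\<lambda>v. Lam l (bilin_ext (act M) v (a + b))) p
      = map_poly (\<lambda>v. Lam l (bilin_ext (act M) v a)) p + map_poly (\<lambda>v. Lam l (bilin_ext (act M) v b)) p"
    by (rule poly_eqI) (simp add: coeff_map_poly Lam_0[OF l] bilin_ext_add_right Lam_add[OF l])
  then show ?case using E0_add add by simp
qed

lemma submod_E: "H.submod E"
  unfolding H.submod_def
proof (intro conjI ballI)
  have AT: "A \<subseteq> MR.A.FK" "MR.A.NullK \<subseteq> A" using GK.submodD[OF A] by auto
  show "GK.polys MR.A.NullK \<subseteq> E"
  proof
    fix p assume p: "p \<in> GK.polys MR.A.NullK"
    have "map_poly (Lam l) p \<in> E0" if l: "lin_fun l" for l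
      by (rule E0_Null) (simp add: coeff_map_Lam[OF l] MR.A.Lam_NullK[OF l] GK.polysD[OF p])
    then show "p \<in> E" using p AT(2) by (auto simp: E_def GK.polys_def)
  qed
  show "E \<subseteq> GK.polys MR.A.FK" using AT(1) by (auto simp: E_def GK.polys_def)
  show "H.vs.subspace E"
  proof (rule H.vs.subspaceI)
    have "map_poly (Lam l) 0 \<in> E0" for l :: "'k ratfun \<Rightarrow> 'k" using E0_0 by simp
    then show "0 \<in> E" using pm.subspace_0[OF A_subspace] by (simp add: E_def GK.polys_def)
    show "p + q \<in> E" if "p \<in> E" "q \<in> E" for p q
      using that pm.subspace_add[OF A_subspace] by (auto simp: E_def GK.polys_def map_Lam_add E0_add)
    show "GK.pscl f p \<in> E" if "p \<in> E" for f p
      using that pm.subspace_scale[OF A_subspace] by (auto simp: E_def GK.polys_def map_Lam_pscl lin_fun_mult)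
  qed
  fix p X assume p: "p \<in> E" and X: "X \<in> carrier RK"
  have "map_poly (Lam l) (GK.popr p X) \<in> E0" if l: "lin_fun l" for l
  proof -
    have "map_poly (Lam l) (GK.popr p X) = map_poly (\<lambda>v. Lam l (bilin_ext (act M) v (rep X))) p"
      by (rule poly_eqI) (simp add: coeff_map_Lam[OF l] GK.coeff_popr[OF X] coeff_map_poly Lam_0[OF l])
    then show ?thesis using map_Lam_popr[OF p rep(1)[OF X] l] by simp
  qed
  moreover have "GK.popr p X \<in> GK.polys A"
    using p GK.submodD(4)[OF A _ X] by (auto simp: E_def GK.polys_def GK.coeff_popr[OF X])
  ultimately show "GK.popr p X \<in> E" by (simp add: E_def)
qed

lemma E_scale: "p \<in> E \<Longrightarrow> GK.pscl f p \<in> E"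
  by (rule H.vs.subspace_scale[OF H.submodD(3)[OF submod_E]])

lemma E_pCons: "p \<in> E \<Longrightarrow> pCons 0 p \<in> E"
proof -
  assume p: "p \<in> E"
  have "map_poly (Lam l) (pCons 0 p) \<in> E0" if l: "lin_fun l" for l
  proof -
    have "map_poly (Lam l) (pCons 0 p) = pCons 0 (map_poly (Lam l) p)"
      by (rule poly_eqI) (simp add: coeff_map_Lam[OF l] coeff_pCons Lam_0[OF l] split: nat.split)
    then show ?thesis using E0_pCons p l by (auto simp: E_def)
  qed
  then show ?thesis using p pm.subspace_0[OF A_subspace]
    by (auto simp: E_def GK.polys_def coeff_pCons split: nat.split)
qed

lemma clear_poly:
  fixes p :: "('m \<Rightarrow>\<^sub>0 'k ratfun) poly"
  obtains q where "q \<noteq> 0" "\<And>i. integral (coeff (GK.pscl (pfract q) p) i)"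
proof -
  \<comment> \<open>The index \<open>Suc (degree p)\<close> stands for all vanishing coefficients,
    so this finite image contains every coefficient of \<open>p\<close>.\<close>
  have f: "finite (coeff p ` {..Suc (degree p)})" by simp
  obtain q where q: "q \<noteq> 0" "\<And>v. v \<in> coeff p ` {..Suc (degree p)} \<Longrightarrow> integral (pscale (pfract q) v)"
    using clear_denominators[OF f] by blast
  have "coeff p i \<in> coeff p ` {..Suc (degree p)}" for i
  proof (cases "i \<le> degree p")
    case False
    then have "coeff p i = coeff p (Suc (degree p))" by (simp add: coeff_eq_0)
    then show ?thesis by blast
  qed auto
  with q that show thesis by auto
qed

lemma pscl_pfract_cancel: "q \<noteq> 0 \<Longrightarrow> GK.pscl (inverse (pfract q)) (GK.pscl (pfract q) p) = p"
  by (rule poly_eqI) simp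

text \<open>Without denominators \<open>p\<close> is a sum of terms \<open>x^l c_l\<close>, and the
  \<open>c_l\<close> lie in \<open>E0\<close> because they are obtained by the functionals
  \<open>cfun l\<close>. Evaluation gives a \<open>K\<close>-combination of the values
  \<open>evx c_l\<close>, all in \<open>N\<close>.\<close>

lemma E_evp:
  assumes p: "p \<in> E"
  shows "GK.evp xK p \<in> N"
proof -
  obtain q where q: "q \<noteq> 0" "\<And>i. integral (coeff (GK.pscl (pfract q) p) i)" using clear_poly by blast
  let ?p = "GK.pscl (pfract q) p"
  have pE: "?p \<in> E" by (rule E_scale[OF p])
  obtain n where "\<And>l. l \<ge> n \<Longrightarrow> map_poly (Lam (cfun l)) ?p = 0"
    and n: "\<And>i. coeff ?p i = (\<Sum>l<n. pscale (xK ^ l) (emb (Lam (cfun l) (coeff ?p i))))"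
    by (rule poly_integral_expand[OF q(2)]) (rule that)
  let ?c = "\<lambda>l. map_poly (Lam (cfun l)) ?p"
  have eq: "?p = (\<Sum>l<n. GK.pscl (xK ^ l) (map_poly emb (?c l)))"
  proof (rule poly_eqI)
    fix i
    show "coeff ?p i = coeff (\<Sum>l<n. GK.pscl (xK ^ l) (map_poly emb (?c l))) i"
      unfolding coeff_sum GK.coeff_pscl[of "xK ^ _"] coeff_map_emb coeff_map_Lam[OF cfun(1)] by (rule n)
  qed
  have ev: "GK.evp xK (\<Sum>l<n. GK.pscl (xK ^ l) (map_poly emb (?c l))) = (\<Sum>l<n. pscale (xK ^ l) (evx (?c l)))" for n
  proof (induction n)
    case 0
    show ?case using GK.evp_add[of xK 0 0] by simp
  qed (simp add: GK.evp_add GK.evp_pscl evx_def)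
  have "?c l \<in> E0" for l using pE cfun(1)[of l] unfolding E_def by blast
  then have "evx (?c l) \<in> N" for l unfolding E0_def by blast
  then have "(\<Sum>l<n. pscale (xK ^ l) (evx (?c l))) \<in> N"
    by (intro pm.subspace_sum[OF N_sub] pm.subspace_scale[OF N_sub])
  then have "GK.evp xK ?p \<in> N" unfolding trans[OF arg_cong[OF eq, of "GK.evp xK"] ev] .
  from pm.subspace_scale[OF N_sub this, of "inverse (pfract q)"] show ?thesis using q(1)
    by (simp add: GK.evp_pscl)
qed

text \<open>
  After clearing denominators \<open>p = \<Sum>\<^sub>l x\<^sup>l c\<^sub>l\<close> with \<open>c\<^sub>l \<in> M[X]\<close>. The coefficient of \<open>x\<^sup>l\<^sup>+\<^sup>1\<close> in
  \<open>(X - x) p\<close> is \<open>X c\<^sub>l\<^sub>+\<^sub>1 - c\<^sub>l\<close>, so all \<open>c\<^sub>l\<close> lie in \<open>E0\<close> by descending induction on \<open>l\<close>.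
\<close>

lemma E_saturated:
  assumes p: "p \<in> GK.polys A" and D: "GK.Dx xK p \<in> E"
  shows "p \<in> E"
proof -
  obtain q where q: "q \<noteq> 0" "\<And>i. integral (coeff (GK.pscl (pfract q) p) i)" using clear_poly by blast
  let ?p = "GK.pscl (pfract q) p"
  have D': "GK.Dx xK ?p \<in> E" unfolding GK.Dx_pscl by (rule E_scale[OF D])
  obtain n where n: "\<And>l. l \<ge> n \<Longrightarrow> map_poly (Lam (cfun l)) ?p = 0"
    "\<And>i. coeff ?p i = (\<Sum>l<n. pscale (xK ^ l) (emb (Lam (cfun l) (coeff ?p i))))"
    by (rule poly_integral_expand[OF q(2)]) (rule that)
  define c where "c l = map_poly (Lam (cfun l)) ?p" for l
  have step: "c l \<in> E0" if "c (Suc l) \<in> E0" for l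
  proof -
    have "map_poly (Lam (cfun (Suc l))) (GK.Dx xK ?p) = pCons 0 (c (Suc l)) - c l"
    proof (rule poly_eqI)
      fix i
      show "coeff (map_poly (Lam (cfun (Suc l))) (GK.Dx xK ?p)) i = coeff (pCons 0 (c (Suc l)) - c l) i"
        unfolding coeff_map_Lam[OF cfun(1)] GK.coeff_Dx Lam_diff[OF cfun(1)] integral_cfun_shift[OF q(2)]
        by (simp add: c_def coeff_map_Lam[OF cfun(1)] Lam_0[OF cfun(1)] coeff_pCons split: nat.split)
    qed
    moreover have "map_poly (Lam (cfun (Suc l))) (GK.Dx xK ?p) \<in> E0"
      using D' cfun(1)[of "Suc l"] unfolding E_def by blast
    ultimately have "pCons 0 (c (Suc l)) - c l \<in> E0" by simp
    from E0_diff[OF E0_pCons[OF that] this] show ?thesis by simp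
  qed
  \<comment> \<open>Descending induction starting from \<open>c n = 0\<close>, phrased as induction
    on the distance \<open>k\<close> from \<open>n\<close>.\<close>
  have cE0: "c (n - k) \<in> E0" for k
  proof (induction k)
    case 0
    show ?case using n(1)[of n] E0_0 by (simp add: c_def)
  next
    case (Suc k)
    show ?case
    proof (cases "k < n")
      case True
      then have "n - k = Suc (n - Suc k)" by simp
      then show ?thesis using Suc step[of "n - Suc k"] by simp
    qed (use Suc in auto)
  qed
  have cl: "c l \<in> E0" if "l < n" for l using cE0[of "n - l"] that by simp
  have "map_poly (Lam h) ?p \<in> E0" if h: "lin_fun h" for h
  proof -
    \<comment> \<open>An arbitrary functional sees the cleared polynomial only through its values at
      the powers of \<open>x\<close>, so the image is a \<open>k\<close>-combination of the
      \<open>c l\<close>.\<close>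
    have "map_poly (Lam h) ?p = (\<Sum>l<n. Gk.pscl (h (xK ^ l)) (c l))"
    proof (rule poly_eqI)
      fix i
      have "Lam h (coeff ?p i) = (\<Sum>l<n. pscale (h (xK ^ l)) (Lam (cfun l) (coeff ?p i)))"
        by (subst n(2)) (simp add: Lam_sum[OF h] Lam_pscale_emb[OF h])
      then show "coeff (map_poly (Lam h) ?p) i = coeff (\<Sum>l<n. Gk.pscl (h (xK ^ l)) (c l)) i"
        by (simp add: coeff_map_Lam h cfun(1) coeff_sum c_def del: GK.coeff_pscl)
    qed
    moreover have "(\<Sum>l\<in>I. Gk.pscl (h (xK ^ l)) (c l)) \<in> E0" if "I \<subseteq> {..<n}" for I
      using finite_subset[OF that] that by (induction I rule: finite_induct) (auto intro!: E0_0 E0_add E0_scale cl)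
    ultimately show ?thesis by simp
  qed
  moreover have "?p \<in> GK.polys A" using p pm.subspace_scale[OF A_subspace] by (auto simp: GK.polys_def)
  ultimately have "?p \<in> E" by (simp add: E_def)
  from E_scale[OF this, of "inverse (pfract q)"] show ?thesis by (simp only: pscl_pfract_cancel[OF q(1)])
qed

text \<open>On a polynomial coming from \<open>M[X]\<close> a functional \<open>l\<close> acts as
  multiplication by \<open>l 1\<close>.\<close>

lemma emb_poly_E:
  assumes "c \<in> E0" "\<And>i. emb (coeff c i) \<in> A"
  shows "map_poly emb c \<in> E"
proof -
  have "map_poly (Lam l) (map_poly emb c) \<in> E0" if l: "lin_fun l" for l
  proof -
    have "map_poly (Lam l) (map_poly emb c) = Gk.pscl (l 1) c"
      by (rule poly_eqI) (simp add: coeff_map_Lam[OF l] Lam_emb[OF l])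
    then show ?thesis using E0_scale[OF assms(1)] by simp
  qed
  then show ?thesis using assms(2) by (simp add: E_def GK.polys_def)
qed

text \<open>The \<open>v\<close> such that \<open>v X^j\<close> is, modulo \<open>NullK\<close>, the
  top term of an element of \<open>E\<close> form a submodule. It contains the leading coefficient
  of \<open>W\<close>, since \<open>X^(j-n) W\<close> lies in \<open>E\<close>.\<close>

lemma E_lead:
  assumes W: "W \<in> E" "degree W = n" and v: "v \<in> GK.gen {coeff W n} MR.A.NullK" and j: "j \<ge> n"
  shows "\<exists>p\<in>E. \<forall>i\<ge>j. coeff p i - coeff (monom v j) i \<in> MR.A.NullK"
proof -
  define B where "B = {v \<in> MR.A.FK. \<exists>p\<in>E. \<forall>i\<ge>j. coeff p i - coeff (monom v j) i \<in> MR.A.NullK}"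
  note sN = MR.A.subspace_NullK
  note sE = H.submodD(3)[OF submod_E]
  have NB: "MR.A.NullK \<subseteq> B"
  proof
    fix v assume v: "v \<in> MR.A.NullK"
    have "coeff 0 i - coeff (monom v j) i \<in> MR.A.NullK" for i
      using pm.subspace_neg[OF sN v] pm.subspace_0[OF sN] by auto
    then show "v \<in> B" using v MR.A.NullK_supported H.vs.subspace_0[OF sE] unfolding B_def by blast
  qed
  have "GK.submod B" unfolding GK.submod_def
  proof (intro conjI ballI)
    show "MR.A.NullK \<subseteq> B" by (rule NB)
    show "B \<subseteq> MR.A.FK" by (auto simp: B_def)
    show "pm.subspace B"
    proof (rule pm.subspaceI)
      show "0 \<in> B" using NB pm.subspace_0[OF sN] by auto
      fix v w c assume v: "v \<in> B"
      then obtain p where p: "p \<in> E" "\<And>i. i \<ge> j \<Longrightarrow> coeff p i - coeff (monom v j) i \<in> MR.A.NullK" by (auto simp: B_def)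
      have vF: "v \<in> MR.A.FK" using v by (auto simp: B_def)
      have "coeff (GK.pscl c p) i - coeff (monom (pscale c v) j) i \<in> MR.A.NullK" if "i \<ge> j" for i
      proof -
        have "coeff (GK.pscl c p) i - coeff (monom (pscale c v) j) i = pscale c (coeff p i - coeff (monom v j) i)"
          by (simp add: pm.scale_right_diff_distrib)
        then show ?thesis using pm.subspace_scale[OF sN p(2)[OF that]] by simp
      qed
      then show "pscale c v \<in> B" using E_scale[OF p(1)] pm.subspace_scale[OF subspace_supported vF]
        unfolding B_def by blast
      assume w: "w \<in> B"
      then obtain q where q: "q \<in> E" "\<And>i. i \<ge> j \<Longrightarrow> coeff q i - coeff (monom w j) i \<in> MR.A.NullK" by (auto simp: B_def)
      have wF: "w \<in> MR.A.FK" using w by (auto simp: B_def)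
      have "coeff (p + q) i - coeff (monom (v + w) j) i \<in> MR.A.NullK" if "i \<ge> j" for i
        using pm.subspace_add[OF sN p(2)[OF that] q(2)[OF that]]
        by (simp add: add_monom[symmetric] algebra_simps del: coeff_monom)
      then show "v + w \<in> B" using H.vs.subspace_add[OF sE p(1) q(1)] pm.subspace_add[OF subspace_supported vF wF]
        unfolding B_def by blast
    qed
    fix v X assume v: "v \<in> B" and X: "X \<in> carrier RK"
    then obtain p where p: "p \<in> E" "\<And>i. i \<ge> j \<Longrightarrow> coeff p i - coeff (monom v j) i \<in> MR.A.NullK" by (auto simp: B_def)
    have "coeff (GK.popr p X) i - coeff (monom (actK v X) j) i \<in> MR.A.NullK" if "i \<ge> j" for i
      using GK.opr_Z[OF p(2)[OF that] X] by (cases "i = j") (auto simp: GK.coeff_popr[OF X] bilin_ext_diff_left)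
    then show "actK v X \<in> B" using H.submodD(4)[OF submod_E p(1) X] GK.opr_T[OF _ X] v unfolding B_def by blast
  qed
  moreover have "coeff W n \<in> B"
  proof -
    have E: "(pCons 0 ^^ k) W \<in> E" for k by (induction k) (auto intro: W(1) E_pCons)
    have cf: "coeff ((pCons 0 ^^ k) W) i = (if i < k then 0 else coeff W (i - k))" for k i
      by (induction k arbitrary: i) (auto simp: coeff_pCons split: nat.split)
    have "coeff ((pCons 0 ^^ (j - n)) W) i - coeff (monom (coeff W n) j) i = 0" if "i \<ge> j" for i
      using that j W(2) by (cases "i = j") (auto simp: cf coeff_eq_0)
    then have "\<forall>i\<ge>j. coeff ((pCons 0 ^^ (j - n)) W) i - coeff (monom (coeff W n) j) i \<in> MR.A.NullK"
      using pm.subspace_0[OF sN] by simp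
    moreover have "coeff W n \<in> MR.A.FK" using W(1) H.submodD(2)[OF submod_E] by (auto dest: GK.polysD)
    ultimately show ?thesis using E[of "j - n"] unfolding B_def by blast
  qed
  ultimately have "GK.gen {coeff W n} MR.A.NullK \<subseteq> B" using NB by (intro GK.gen_minimal) auto
  then show ?thesis using v unfolding B_def by blast
qed

end

end

section \<open>Preservation of criticality\<close>

lemma gkr_extend_critical:
  assumes ex: "gk_exact RK" and part: "gk_finitely_partitive RK"
    and crit: "\<And>L. \<lbrakk>Gk.submod L; \<not> L \<subseteq> MR.A.Null\<rbrakk> \<Longrightarrow> Gk.gkr MR.A.F L < Gk.gkr MR.A.F MR.A.Null"
    and N: "GK.submod N" "\<not> N \<subseteq> MR.A.NullK"
  shows "GK.gkr MR.A.FK N < GK.gkr MR.A.FK MR.A.NullK"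
proof (rule ccontr)
  let ?d = "GK.gkr MR.A.FK MR.A.NullK"
  assume "\<not> GK.gkr MR.A.FK N < ?d"
  then have dN: "?d \<le> GK.gkr MR.A.FK N" by simp
  note sN = GK.submodD(3)[OF N(1)] and sZ = MR.A.subspace_NullK
  have NF: "N \<subseteq> MR.A.FK" "MR.A.NullK \<subseteq> N" using GK.submodD[OF N(1)] by auto
  obtain w where w: "w \<in> N" "w \<notin> MR.A.NullK" using N(2) by auto
  obtain q where q: "q \<noteq> 0" "integral (pscale (pfract q) w)"
    using clear_denominators[of "{w}"] by auto
  define w' where "w' = pscale (pfract q) w"
  have w': "w' \<in> N" unfolding w'_def by (rule pm.subspace_scale[OF sN w(1)])
  have w'0: "w' \<notin> MR.A.NullK"
  proof
    assume "w' \<in> MR.A.NullK"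
    from pm.subspace_scale[OF sZ this, of "inverse (pfract q)"] show False using w(2) q(1) by (simp add: w'_def)
  qed
  define u where "u j = Lam (cfun j) w'" for j
  obtain n0 where n0': "\<And>j. j \<ge> n0 \<Longrightarrow> Lam (cfun j) (pscale (pfract q) w) = 0"
    "\<And>m. m \<ge> n0 \<Longrightarrow> pscale (pfract q) w
      = (\<Sum>j<m. pscale (xK ^ j) (emb (Lam (cfun j) (pscale (pfract q) w))))"
    by (rule integral_expand[OF q(2)]) (rule that)
  have n0: "u j = 0" if "j \<ge> n0" for j unfolding u_def w'_def by (rule n0'(1)[OF that])
  have w'_eq: "w' = (\<Sum>j<n0. pscale (xK ^ j) (emb (u j)))"
    unfolding u_def w'_def by (rule n0'(2)[OF order_refl])
  have uF: "u j \<in> MR.A.F" for j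
    unfolding u_def using w' NF(1) by (intro Lam_supported cfun) auto
  \<comment> \<open>A coefficient may be nonzero as a formal combination and yet vanish in
    \<open>M\<close>; only the indices of coefficients nonzero in \<open>M\<close> count.\<close>
  let ?J = "{j. u j \<notin> MR.A.Null}"
  have J: "?J \<subseteq> {..<n0}" 
  proof
    fix j assume j: "j \<in> ?J"
    have "\<not> n0 \<le> j"
    proof
      assume "n0 \<le> j"
      then have "u j = 0" by (rule n0)
      then show False using j pm.subspace_0[OF MR.A.subspace_Null] by simp
    qed
    then show "j \<in> {..<n0}" by simp
  qed
  have fJ: "finite ?J" using J finite_subset by blast
  have "?J \<noteq> {}"
  proof
    assume "?J = {}"
    then have "w' \<in> MR.A.NullK" unfolding w'_eq
      by (intro pm.subspace_sum[OF sZ] pm.subspace_scale[OF sZ] MR.A.emb_Null) auto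
    then show False using w'0 by simp
  qed
  define n where "n = Max ?J"
  have n: "u n \<notin> MR.A.Null" "\<And>j. j > n \<Longrightarrow> u j \<in> MR.A.Null"
    using Max_in[OF fJ \<open>?J \<noteq> {}\<close>] Max_ge[OF fJ] unfolding n_def by force+
  have nn: "n < n0" using n(1) J by auto
  \<comment> \<open>The coefficients above \<open>n\<close> vanish in \<open>M\<close> and are
    dropped. The value at \<open>x\<close> changes only by an element of \<open>NullK\<close>, while
    \<open>c\<close> has degree exactly \<open>n\<close> with leading coefficient nonzero in
    \<open>M\<close>.\<close>
  define c where "c = (\<Sum>i\<le>n. monom (u i) i)"
  have cc: "coeff c i = (if i \<le> n then u i else 0)" for i
    unfolding c_def by (simp add: coeff_sum)
  have un0: "u n \<noteq> 0" using n(1) pm.subspace_0[OF MR.A.subspace_Null] by auto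
  have dc: "degree c = n"
    using un0 by (intro antisym degree_le le_degree) (auto simp: cc)
  have evc: "evx c \<in> N"
  proof -
    have "evx c = (\<Sum>i<n0. pscale (xK ^ i) (emb (coeff c i)))" using nn by (intro evx_eq) (auto simp: cc)
    then have "w' - evx c = (\<Sum>i<n0. pscale (xK ^ i) (emb (u i - coeff c i)))"
      by (simp add: w'_eq emb_diff pm.scale_right_diff_distrib sum_subtractf)
    also have "\<dots> \<in> MR.A.NullK"
      using n(2) pm.subspace_0[OF MR.A.subspace_Null]
      by (intro pm.subspace_sum[OF sZ] pm.subspace_scale[OF sZ] MR.A.emb_Null) (auto simp: cc)
    finally have "w' - evx c \<in> N" using NF(2) by auto
    from pm.subspace_diff[OF sN w' this] show ?thesis by simp
  qed
  have cE0: "c \<in> E0 N" using evc uF pm.subspace_0[OF subspace_supported]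
    by (auto simp: E0_def[OF N(1)] Gk.polys_def cc)
  define A where "A = GK.gen (emb ` u ` {..n}) MR.A.NullK"
  have WT: "emb ` u ` {..n} \<subseteq> MR.A.FK" using uF by auto
  note AG = GK.gen[OF GK.submod_Z WT, folded A_def]
  have fgA: "GK.fin_gen A MR.A.NullK" unfolding A_def by (rule GK.fin_gen_gen[OF GK.submod_Z WT]) simp
  define L' where "L' = GK.gen {emb (u n)} MR.A.NullK"
  have unF: "{emb (u n)} \<subseteq> MR.A.FK" using uF by auto
  note LG = GK.gen[OF GK.submod_Z unF, folded L'_def]
  have L'A: "L' \<subseteq> A" unfolding L'_def by (rule GK.gen_minimal[OF AG(1,2)]) (use AG(3) in auto)
  define L where "L = Gk.gen {u n} MR.A.Null"
  have "{u n} \<subseteq> MR.A.F" using uF by auto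
  note kG = Gk.gen[OF Gk.submod_Z this, folded L_def]
  \<comment> \<open>The elements of the free \<open>k\<close>-space whose embedding lies in
    \<open>L'\<close> form an \<open>R\<close>-submodule containing \<open>u n\<close>, hence
    contain \<open>L\<close>.\<close>
  have LL: "emb ` L \<subseteq> L'"
  proof -
    let ?X = "{v \<in> MR.A.F. emb v \<in> L'}"
    note sL = GK.submodD(3)[OF LG(1)]
    have "Gk.submod ?X" unfolding Gk.submod_def
    proof (intro conjI ballI)
      show "MR.A.Null \<subseteq> ?X" using Gk.Z_T LG(2) MR.A.emb_Null by auto
      show "?X \<subseteq> MR.A.F" by auto
      show "pm.subspace ?X"
        using pm.subspace_0[OF sL] pm.subspace_add[OF sL] pm.subspace_scale[OF sL]
          pm.subspace_add[OF Gk.T_sub] pm.subspace_scale[OF Gk.T_sub]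
        by (intro pm.subspaceI) (auto simp: emb_add emb_pscale)
      fix v r assume v: "v \<in> ?X" and r: "r \<in> carrier R"
      have "actK (emb v) (incl r) - emb (actk v r) \<in> L'" using actK_emb_incl[of v r] v r LG(2) by auto
      moreover have "actK (emb v) (incl r) \<in> L'" using v GK.submodD(4)[OF LG(1) _ incl_carrier[OF r]] by auto
      ultimately have "emb (actk v r) \<in> L'" using pm.subspace_diff[OF sL] by fastforce
      then show "actk v r \<in> ?X" using v Gk.opr_T[OF _ r] by auto
    qed
    moreover have "MR.A.Null \<subseteq> ?X" using Gk.Z_T LG(2) MR.A.emb_Null by auto
    moreover have "{u n} \<subseteq> ?X" using LG(3) uF by auto
    ultimately have "L \<subseteq> ?X" unfolding L_def by (intro Gk.gen_minimal) auto
    then show ?thesis by auto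
  qed
  \<comment> \<open>\<open>M_K/L'\<close> is a quotient of \<open>(M/u_n R)_K\<close>, whose
    dimension is bounded by that of \<open>M/u_n R\<close>; criticality applies because
    \<open>u n\<close> is nonzero in \<open>M\<close>.\<close>
  have e: "GK.gkr MR.A.FK L' < ?d"
  proof -
    have "GK.gkr MR.A.FK L' \<le> Gk.gkr MR.A.F L" by (rule gkr_extend_le[OF kG(1) LG(1) LL])
    also have "\<dots> < Gk.gkr MR.A.F MR.A.Null" using kG(3) n(1) by (intro crit[OF kG(1)]) auto
    also have "\<dots> \<le> ?d" by (rule gkr_extend_ge)
    finally show ?thesis .
  qed
  show False
  proof (rule GK.poly_chain_contradiction[OF ex part AG(1) fgA, where E = "E N A" and N = N and L = L' and n = n and x = xK and d = ?d])
    show "gk_space.submod RK GK.pscl GK.popr (GK.polys MR.A.FK) (GK.polys MR.A.NullK) (E N A)"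
      by (rule submod_E[OF N(1) AG(1)])
    show "E N A \<subseteq> GK.polys A" by (auto simp: E_def[OF N(1) AG(1)])
    show "p \<in> E N A" if "p \<in> GK.polys A" "GK.Dx xK p \<in> E N A" for p
      by (rule E_saturated[OF N(1) AG(1) that])
    show "GK.submod N" "GK.submod L'" "L' \<subseteq> A" by (rule N LG L'A)+
    show "GK.evp xK p \<in> N" if "p \<in> E N A" for p by (rule E_evp[OF N(1) AG(1) that])
    show "\<exists>p\<in>E N A. \<forall>i\<ge>j. coeff p i - coeff (monom v j) i \<in> MR.A.NullK" if "v \<in> L'" "n \<le> j" for v j
    proof (rule E_lead[OF N(1) AG(1), where W = "map_poly emb c" and n = n])
      show "map_poly emb c \<in> E N A"
      proof (rule emb_poly_E[OF N(1) AG(1) cE0])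
        show "emb (coeff c i) \<in> A" for i
          using AG(3) pm.subspace_0[OF GK.submodD(3)[OF AG(1)]] by (auto simp: cc)
      qed
      have "emb (u n) \<noteq> 0" 
      proof
        assume "emb (u n) = 0"
        then have "Lam (cfun 0) (emb (u n)) = 0" by (simp add: Lam_0[OF cfun(1)])
        then show False using un0 by (simp add: Lam_emb[OF cfun(1)])
      qed
      then show "degree (map_poly emb c) = n"
        by (intro antisym degree_le le_degree) (auto simp: cc)
      show "v \<in> GK.gen {coeff (map_poly emb c) n} MR.A.NullK" using that(1) by (simp add: L'_def cc)
      show "n \<le> j" by (rule that(2))
    qed
    show "GK.gkr A MR.A.NullK \<le> ?d"
      using AG GK.submodD(2)[OF AG(1)] by (intro GK.gkr_le_sub GK.submod_T GK.submod_Z) auto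
    show "GK.gkr A L' < ?d"
    proof -
      have "GK.gkr A L' \<le> GK.gkr MR.A.FK L'"
        using GK.submodD(2)[OF AG(1)] by (intro GK.gkr_le_sub GK.submod_T AG LG) auto
      then show ?thesis using e by simp
    qed
    show "?d \<noteq> -1" using e GK.gkr_ge[of MR.A.FK L'] by auto
    \<comment> \<open>This permits replacing \<open>M_K\<close> by \<open>A\<close>: since
      \<open>L' \<subseteq> A\<close>, the module \<open>M_K/(A + N)\<close> is a quotient of
      \<open>M_K/L'\<close> and has dimension below \<open>d\<close>, so exactness forces dimension
      at least \<open>d\<close> on \<open>(A + N)/N\<close>, that is, on
      \<open>A/(A \<inter> N)\<close>.\<close>
    show "?d \<le> GK.gkr A N"
    proof -
      let ?X = "GK.plus_set A N"
      have X: "GK.submod ?X" by (rule GK.submod_plus[OF AG(1) N(1)])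
      have NX: "N \<subseteq> ?X" by (rule GK.plus_set_right[OF AG(1)])
      have AX: "A \<subseteq> ?X" by (rule GK.plus_set_left[OF N(1)])
      have "?d \<le> max (GK.gkr ?X N) (GK.gkr MR.A.FK ?X)"
        using dN GK.gkr_exact[OF ex GK.submod_T X GK.submodD(2)[OF X] N(1) NX] by (rule order_trans)
      moreover have "GK.gkr MR.A.FK ?X \<le> GK.gkr MR.A.FK L'"
        using GK.submodD(2)[OF LG(1)] L'A AX GK.plus_set_left[OF X] by (intro GK.gkr_le_quot GK.submod_T X LG) auto
      ultimately have "?d \<le> GK.gkr ?X N" using e by (auto simp: le_max_iff_disj)
      also have "\<dots> \<le> GK.gkr A (A \<inter> N)"
        by (intro GK.gkr_le_quot AG X N GK.submod_inter) auto
      also have "\<dots> \<le> GK.gkr A N" by (intro GK.gkr_le_sub AG N GK.submod_inter) auto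
      finally show ?thesis .
    qed
  qed
qed

theorem gk_critical_ratfun_module:
  assumes ex: "gk_exact RK" and part: "gk_finitely_partitive RK" and crit: "gk_critical R M"
  shows "gk_critical RK (ratfun_module R M)"
proof -
  have M: "carrier M \<noteq> {\<zero>}" "gkdim R M < \<infinity>"
    and cr: "\<And>N. \<lbrakk>is_submodule R N M; N \<noteq> {\<zero>}\<rbrakk> \<Longrightarrow> gkdim R (quot M N) < gkdim R M"
    using crit unfolding gk_critical_def by auto
  note Pk = presents_k and PK = presents_K
  let ?X = "ratfun_module R M"
  \<comment> \<open>Criticality of \<open>M\<close> restated upstairs: a submodule of the free
    \<open>k\<close>-space not contained in \<open>Null\<close> has a nonzero image in
    \<open>M\<close>.\<close>
  have crk: "Gk.gkr MR.A.F L < Gk.gkr MR.A.F MR.A.Null" if L: "Gk.submod L" "\<not> L \<subseteq> MR.A.Null" for L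
  proof -
    note LF = Gk.submodD(1,2)[OF L(1)]
    have "MR.A.ev ` L \<noteq> {\<zero>}" using L(2) LF by (auto simp: MR.A.Null_def)
    then have "gkdim R (quot M (MR.A.ev ` L)) < gkdim R M"
      by (intro cr Gk.is_submodule_image[OF Pk L(1) LF(2)])
    moreover have "gkdim R (quot (M\<lparr>carrier := MR.A.ev ` MR.A.F\<rparr>) (MR.A.ev ` L)) = Gk.gkr MR.A.F L"
      by (rule Gk.gkdim_presents[OF Gk.presents_quot[OF Pk Gk.submod_T order_refl L(1) LF]])
    ultimately show ?thesis unfolding Gk.presentsD(4)[OF Pk, symmetric]
      by (simp only: Gk.gkdim_presents[OF Pk] rmod_update_carrier)
  qed
  have fin: "GK.gkr MR.A.FK MR.A.NullK \<le> Gk.gkr MR.A.F MR.A.Null"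
    by (rule gkr_extend_le[OF Gk.submod_Z GK.submod_Z]) (use MR.A.emb_Null in auto)
  show ?thesis unfolding gk_critical_def
  proof (intro conjI allI impI)
    show "right_module RK ?X" by (rule GK.presents_right_module[OF PK])
    \<comment> \<open>A nonzero module has dimension at least \<open>0\<close> and the zero module
      has \<open>-1\<close>, so the comparison of dimensions shows that \<open>M_K\<close> is
      nonzero.\<close>
    have "\<not> MR.A.F \<subseteq> MR.A.Null" using M(1) Gk.presents_trivial_iff[OF Pk] by simp
    then have "0 \<le> Gk.gkr MR.A.F MR.A.Null" by (rule Gk.gkr_nonneg)
    then have "0 \<le> GK.gkr MR.A.FK MR.A.NullK" using gkr_extend_ge order_trans by blast
    then have "\<not> MR.A.FK \<subseteq> MR.A.NullK" using GK.gkr_eq[of MR.A.FK MR.A.NullK] by auto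
    then show "carrier ?X \<noteq> {\<zero>\<^bsub>?X\<^esub>}" using GK.presents_trivial_iff[OF PK] by simp
    show "gkdim RK ?X < \<infinity>"
      using fin M(2) unfolding GK.gkdim_presents[OF PK] Gk.gkdim_presents[OF Pk] by (rule order.strict_trans1)
    fix N' assume N': "is_submodule RK N' ?X \<and> N' \<noteq> {\<zero>\<^bsub>?X\<^esub>}"
    define N where "N = {a \<in> MR.A.FK. MR.A.cls a \<in> N'}"
    note pre = GK.submod_preimage[OF PK conjunct1[OF N'], folded N_def]
    have NF: "N \<subseteq> MR.A.FK" by (auto simp: N_def)
    have "\<not> N \<subseteq> MR.A.NullK"
    proof
      assume s: "N \<subseteq> MR.A.NullK"
      have "MR.A.cls a = MR.A.cls 0" if "a \<in> N" for a
        using GK.presentsD(8)[OF PK, of a 0] that s NF by auto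
      then have "MR.A.cls ` N \<subseteq> {\<zero>\<^bsub>?X\<^esub>}" using GK.presentsD(5)[OF PK] by auto
      moreover have "\<zero>\<^bsub>?X\<^esub> \<in> MR.A.cls ` N"
        unfolding GK.presentsD(5)[OF PK] using pm.subspace_0[OF GK.submodD(3)[OF pre(1)]] by (rule imageI)
      ultimately show False using N' pre(3) by auto
    qed
    then have "GK.gkr MR.A.FK N < GK.gkr MR.A.FK MR.A.NullK"
      by (intro gkr_extend_critical[OF ex part crk pre(1)])
    moreover have "gkdim RK (quot (?X\<lparr>carrier := MR.A.cls ` MR.A.FK\<rparr>) (MR.A.cls ` N)) = GK.gkr MR.A.FK N"
      by (rule GK.gkdim_presents[OF GK.presents_quot[OF PK GK.submod_T order_refl pre(1,2) NF]])
    ultimately show "gkdim RK (quot ?X N') < gkdim RK ?X"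
      unfolding GK.presentsD(4)[OF PK, symmetric] pre(3)
      by (simp only: GK.gkdim_presents[OF PK] rmod_update_carrier)
  qed
qed

end

theorem proposition2p6:
  fixes R :: "('k::field, 'r) module" and M :: "('r, 'm) rmod"
  assumes "k_algebra R"
    and "right_module R M"
    and "gk_exact R"
    and "gk_exact (ratfun_algebra R)"
    and "gk_finitely_partitive (ratfun_algebra R)"
    and "gk_critical R M"
  shows "gk_critical (ratfun_algebra R) (ratfun_module R M)"
  using right_module.gk_critical_ratfun_module[OF assms(2,4,5,6)] .

end
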